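(* There is a randomized catalytic algorithm that, given oracle access to a simple directed graph $G$ with $n$ vertices and $m\ge n$ edges together with vertices $s,t$, decides whether there exists a directed path from $s$ to $t$ (always restoring the catalytic tape, always answering no if no path exists, and answering yes with probability at least $1/2$ if a path exists). The algorithm uses $O(\log n)$ workspace and $\widetilde{O}(n^3)$ catalytic space, and runs in time $\widetilde{O}(nm)$. Moreover, the algorithm is locally revertible in time $\mathrm{polylog}(n)$.
   Context: Catalytic (RAM) model: the algorithm has read-only access to the input, read-write access to a small work tape, read-write access to a catalytic tape that starts in an arbitrary configuration $\tau$, and a write-only output tape; it may read or write any specified bit of the catalytic tape in constant time after writing the bit's index to a query tape. For every input and every initial $\tau$, the algorithm must halt within the stated time with the catalytic tape restored exactly to $\tau$. A randomized catalytic algorithm additionally has access to random coins. A catalytic algorithm $A$ is locally revertible in time $t$ if at any point during the execution of $A$ with initial catalytic tape $\tau$, the algorithm can be paused and queried on an index $i$, and will return $\tau_i$ (the original $i$-th bit of the catalytic tape) in time $t$, and then continue its execution. Oracle access to a graph: the vertex set is $[n]$ and for any vertex $v$ one can query its in-degree, out-degree, $i$-th in-neighbor and $i$-th out-neighbor (or $\perp$). $\widetilde{O}(\cdot)$ hides polylogarithmic factors. *)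

theory Defs
  imports "HOL-Probability.Probability" "HOL-Library.Log_Nat" "Graph_Theory.Pair_Digraph"
begin

section \<open>Input: oracle access to a directed graph\<close>

text \<open>The adjacency lists may list the neighbours in any order.\<close>

record stcon_input =
  vertex_count :: nat
  source :: nat
  target :: nat
  out_nbrs :: "nat \<Rightarrow> nat list"
  in_nbrs :: "nat \<Rightarrow> nat list"

definition presents :: "stcon_input \<Rightarrow> nat pair_pre_digraph \<Rightarrow> nat \<Rightarrow> nat \<Rightarrow> bool" where
  "presents x G u v \<longleftrightarrow>
     pverts G = {1..vertex_count x} \<and> source x = u \<and> target x = v \<and>
     (\<forall>a\<in>pverts G.
        distinct (out_nbrs x a) \<and> set (out_nbrs x a) = {b. (a, b) \<in> parcs G} \<and>
        distinct (in_nbrs x a) \<and> set (in_nbrs x a) = {b. (b, a) \<in> parcs G})"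

datatype graph_query = Vertex_Count | Source | Target | Out_Degree | In_Degree | Out_Nbr | In_Nbr

definition list_nth1 :: "nat list \<Rightarrow> nat \<Rightarrow> nat" where
  "list_nth1 xs i = (if 1 \<le> i \<and> i \<le> length xs then xs ! (i - 1) else 0)"

text \<open>Vertices and neighbour positions are numbered from 1; the answer 0 stands for \<open>\<bottom>\<close>.
  Arguments a query does not need are ignored.\<close>

fun answer :: "stcon_input \<Rightarrow> graph_query \<Rightarrow> nat \<Rightarrow> nat \<Rightarrow> nat" where
  "answer x Vertex_Count a i = vertex_count x"
| "answer x Source a i = source x"
| "answer x Target a i = target x"
| "answer x Out_Degree a i = (if a \<in> {1..vertex_count x} then length (out_nbrs x a) else 0)"
| "answer x In_Degree a i = (if a \<in> {1..vertex_count x} then length (in_nbrs x a) else 0)"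
| "answer x Out_Nbr a i = (if a \<in> {1..vertex_count x} then list_nth1 (out_nbrs x a) i else 0)"
| "answer x In_Nbr a i = (if a \<in> {1..vertex_count x} then list_nth1 (in_nbrs x a) i else 0)"


section \<open>Catalytic random access machines\<close>

text \<open>
  The work tape is organised as binary numbers held in registers. There is no indirect
  addressing, so a program uses a fixed finite set of registers, and the space charged is the
  total bit length of their contents. Within workspace \<open>O(log n)\<close> all operands have \<open>O(log n)\<close>
  bits, so charging one step for an arithmetic instruction changes running times only by
  polylogarithmic factors.

  \<open>CatRead r a\<close> and \<open>CatWrite a r\<close> access the single bit of the catalytic tape whose index is in
  register \<open>a\<close>: that register plays the role of the query tape. \<open>Ask\<close> is the only
  access to the input, and \<open>Emit\<close> appends a bit to the write-only output tape.

  The catalytic tape is represented as an infinite bit sequence; that only a finite prefix of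
  it is available is imposed below by bounding the addresses that are accessed. A program can
  thus not learn anything from the length of the tape.
\<close>

datatype arith = Add | Sub | Mult | Div | Mod

fun apply_arith :: "arith \<Rightarrow> nat \<Rightarrow> nat \<Rightarrow> nat" where
  "apply_arith Add a b = a + b"
| "apply_arith Sub a b = a - b"
| "apply_arith Mult a b = a * b"
| "apply_arith Div a b = a div b"
| "apply_arith Mod a b = a mod b"

datatype instr =
    Const nat nat
  | Arith arith nat nat nat
  | Jump nat
  | JumpLess nat nat nat
  | Flip nat
  | Ask graph_query nat nat nat
  | CatRead nat nat
  | CatWrite nat nat
  | Emit nat

type_synonym program = "instr list"

record config =
  pc :: nat
  regs :: "nat \<Rightarrow> nat"
  cat :: "nat \<Rightarrow> bool"
  outp :: "bool list"

definition advance :: "config \<Rightarrow> config" where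
  "advance c = c\<lparr>pc := Suc (pc c)\<rparr>"

definition set_reg :: "nat \<Rightarrow> nat \<Rightarrow> config \<Rightarrow> config" where
  "set_reg r k c = c\<lparr>regs := (regs c)(r := k)\<rparr>"

fun exec :: "stcon_input \<Rightarrow> instr \<Rightarrow> config \<Rightarrow> config pmf" where
  "exec x (Const r k) c = return_pmf (advance (set_reg r k c))"
| "exec x (Arith f r a b) c =
     return_pmf (advance (set_reg r (apply_arith f (regs c a) (regs c b)) c))"
| "exec x (Jump l) c = return_pmf (c\<lparr>pc := l\<rparr>)"
| "exec x (JumpLess a b l) c =
     return_pmf (if regs c a < regs c b then c\<lparr>pc := l\<rparr> else advance c)"
| "exec x (Flip r) c =
     map_pmf (\<lambda>b. advance (set_reg r (of_bool b) c)) (bernoulli_pmf (1/2))"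
| "exec x (Ask q r a b) c =
     return_pmf (advance (set_reg r (answer x q (regs c a) (regs c b)) c))"
| "exec x (CatRead r a) c =
     return_pmf (advance (set_reg r (of_bool (cat c (regs c a))) c))"
| "exec x (CatWrite a r) c =
     return_pmf (advance (c\<lparr>cat := (cat c)(regs c a := (regs c r \<noteq> 0))\<rparr>))"
| "exec x (Emit r) c =
     return_pmf (advance (c\<lparr>outp := outp c @ [regs c r \<noteq> 0]\<rparr>))"

definition halted :: "program \<Rightarrow> config \<Rightarrow> bool" where
  "halted P c \<longleftrightarrow> length P \<le> pc c"

definition step :: "program \<Rightarrow> stcon_input \<Rightarrow> config \<Rightarrow> config pmf" where
  "step P x c = (if halted P c then return_pmf c else exec x (P ! pc c) c)"

primrec run :: "program \<Rightarrow> stcon_input \<Rightarrow> nat \<Rightarrow> config \<Rightarrow> config pmf" where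
  "run P x 0 c = return_pmf c"
| "run P x (Suc k) c = bind_pmf (step P x c) (run P x k)"

definition init :: "(nat \<Rightarrow> bool) \<Rightarrow> config" where
  "init \<tau> = \<lparr>pc = 0, regs = (\<lambda>_. 0), cat = \<tau>, outp = []\<rparr>"


section \<open>Resources\<close>

text \<open>The configurations that occur for some outcome of the coins.\<close>

definition reachable_configs :: "program \<Rightarrow> stcon_input \<Rightarrow> config \<Rightarrow> config set" where
  "reachable_configs P x c = (\<Union>k. set_pmf (run P x k c))"

definition final_dist :: "program \<Rightarrow> stcon_input \<Rightarrow> real \<Rightarrow> config \<Rightarrow> config pmf" where
  "final_dist P x T c = run P x (nat \<lfloor>T\<rfloor>) c"

text \<open>The time bound is a worst-case bound over the coins.\<close>

definition halts_within :: "program \<Rightarrow> stcon_input \<Rightarrow> real \<Rightarrow> config \<Rightarrow> bool" where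
  "halts_within P x T c \<longleftrightarrow> (\<forall>d\<in>set_pmf (final_dist P x T c). halted P d)"

definition workspace :: "config \<Rightarrow> nat" where
  "workspace c = (\<Sum>r | regs c r \<noteq> 0. floorlog 2 (regs c r))"

definition cat_accesses :: "program \<Rightarrow> config \<Rightarrow> nat set" where
  "cat_accesses P c =
     (if halted P c then {} else
        (case P ! pc c of
           CatRead r a \<Rightarrow> {regs c a}
         | CatWrite a r \<Rightarrow> {regs c a}
         | _ \<Rightarrow> {}))"

definition space_bounded ::
    "program \<Rightarrow> stcon_input \<Rightarrow> real \<Rightarrow> nat \<Rightarrow> config \<Rightarrow> bool" where
  "space_bounded P x W S c \<longleftrightarrow>
     (\<forall>d\<in>reachable_configs P x c. real (workspace d) \<le> W \<and> cat_accesses P d \<subseteq> {..<S})"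


section \<open>Catalytic algorithms and local revertibility\<close>

definition catalytic_on :: "program \<Rightarrow> stcon_input \<Rightarrow> real \<Rightarrow> nat \<Rightarrow> real \<Rightarrow> bool" where
  "catalytic_on P x W S T \<longleftrightarrow>
     (\<forall>\<tau>. halts_within P x T (init \<tau>) \<and> space_bounded P x W S (init \<tau>) \<and>
          (\<forall>d\<in>set_pmf (final_dist P x T (init \<tau>)). cat d = \<tau>))"

text \<open>
  The machine is paused in configuration \<open>c\<close> and queried on index \<open>i\<close>: control passes to a
  revert routine, which finds \<open>i\<close> in register 0, the control state of the paused computation in
  register 1, and the registers of the paused computation shifted up by two.
\<close>

definition paused :: "nat \<Rightarrow> config \<Rightarrow> config" where
  "paused i c =
     c\<lparr>pc := 0,
       regs := (\<lambda>r. case r of 0 \<Rightarrow> i | Suc 0 \<Rightarrow> pc c | Suc (Suc q) \<Rightarrow> regs c q)\<rparr>"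

text \<open>
  The revert routine \<open>R\<close> may modify the catalytic tape and the registers (using unused registers
  as scratch space), but when it halts register 0 holds the original bit \<open>\<tau> i\<close> and everything
  else is as at the pause, so that the paused computation can continue. It has to respect the
  space bounds as well. If \<open>R\<close> flips coins, it has to succeed for all their outcomes.
\<close>

definition locally_revertible_on ::
    "program \<Rightarrow> program \<Rightarrow> stcon_input \<Rightarrow> real \<Rightarrow> nat \<Rightarrow> real \<Rightarrow> bool" where
  "locally_revertible_on P R x W S t \<longleftrightarrow>
     (\<forall>\<tau>. \<forall>c\<in>reachable_configs P x (init \<tau>). \<forall>i<S.
        halts_within R x t (paused i c) \<and> space_bounded R x W S (paused i c) \<and>
        (\<forall>d\<in>set_pmf (final_dist R x t (paused i c)).
           regs d = (regs (paused i c))(0 := of_bool (\<tau> i)) \<and>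
           cat d = cat c \<and> outp d = outp c))"

text \<open>One-sided error; the output is a single bit, \<open>True\<close> meaning yes.\<close>

definition decides_path_on ::
    "program \<Rightarrow> stcon_input \<Rightarrow> real \<Rightarrow> nat pair_pre_digraph \<Rightarrow> nat \<Rightarrow> nat \<Rightarrow> bool" where
  "decides_path_on P x T G u v \<longleftrightarrow>
     (\<forall>\<tau>. (\<forall>d\<in>set_pmf (final_dist P x T (init \<tau>)). outp d \<in> {[True], [False]}) \<and>
          ((\<nexists>p. pre_digraph.apath (with_proj G) u p v) \<longrightarrow>
             (\<forall>d\<in>set_pmf (final_dist P x T (init \<tau>)). outp d = [False])) \<and>
          ((\<exists>p. pre_digraph.apath (with_proj G) u p v) \<longrightarrow>
             measure_pmf.prob (final_dist P x T (init \<tau>)) {d. outp d = [True]} \<ge> 1/2))"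

text \<open>A positive substitute for \<open>log n\<close>: at least 1 for \<open>n \<ge> 1\<close>, and of the same order.\<close>

definition lg :: "nat \<Rightarrow> real" where
  "lg n = log 2 (real n + 1)"

end

theory Submission
  imports Defs "HOL-Number_Theory.Prime_Powers" "HOL-Number_Theory.Cong"
begin

text \<open>
  Let a lazy walk either follow an arc or stay in each step, and let \<open>N\<close> be the number of lazy
  walks of length \<open>n\<close> from \<open>s\<close> to \<open>t\<close>, so that \<open>N \<le> n ^ n\<close>, and \<open>N > 0\<close> if and only if \<open>t\<close> can be
  reached. The catalytic tape is cut into blocks of \<open>O(log n)\<close> bits, one for each layer
  \<open>i < n\<close>, vertex \<open>v\<close> and lazy arc into \<open>v\<close>. A forward sweep adds to every block, modulo a
  random \<open>q\<close>, the content of the preceding block of \<open>v\<close> and that of the last block of the tail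
  of the arc in the layer before; in layer 0 the latter is replaced by the bit \<open>b\<close> if the tail
  is \<open>s\<close>. The last block of \<open>v\<close> in layer \<open>i\<close> is thus increased by a quantity that depends on the
  initial tape, but whose values for \<open>b = 1\<close> and \<open>b = 0\<close> differ by the number of lazy walks of
  length \<open>i + 1\<close> from \<open>s\<close> to \<open>v\<close>. What is added to a block depends on earlier blocks only, so a
  backward sweep restores the tape. Doing this for both values of \<open>b\<close> and comparing the values that
  flow into \<open>t\<close> after the last layer reveals whether \<open>q\<close> divides \<open>N\<close>.

  Without regard to the coins, blocks differ between the two sweeps only at vertices that can be reached
  from \<open>s\<close>: this gives one-sided error. Conversely, since
  \<open>ln N = (\<Sum>d | d dvd N. mangoldt d)\<close> is at most \<open>n ln n\<close>, few of the candidates for \<open>q\<close> divide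
  \<open>N > 0\<close>. The content of a block is a number below a power of two \<open>W\<close>, which need not be a
  multiple of \<open>q\<close>; a random cyclic shift \<open>r\<close> makes it likely that no block falls into the
  incomplete last interval of length \<open>q\<close>, where the addition is not carried out.

  At any time, the original content of a block is obtained by subtracting again what the sweep has
  added to it, which requires reading two other blocks. This makes the algorithm locally
  revertible.
\<close>

section \<open>Structured programs\<close>

text \<open>The modulus is drawn from all of \<open>{1..Q}\<close> and not from the primes, so the
  program needs no primality test; the price is that an arbitrary random integer must rarely divide
  \<open>N\<close>. A Mertens-type estimate bounds the share of such divisors by 1/4 once
  \<open>Q\<close> is at least \<open>2 ^ 15 * n ^ 32\<close>. With \<open>W = Q ^ 2\<close> the
  union bound over all \<open>n ^ 3\<close> blocks for hitting the cut-off interval costs at most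
  another 1/4. Local revertibility concerns every reachable configuration: the pause may fall into
  the initialization, between two register updates, or amid the bitwise overwriting of a block.
  Specifications of initial and final states are therefore not enough. The program logic carries an
  assertion that holds at each single instruction, and the order of the register updates in the
  sweeps is chosen to preserve it. Probabilities enter only through the loop that flips the coins;
  everything else is shown for all outcomes and then transferred.\<close>

datatype com =
    Skip
  | Do instr
  | Seq com com (infixr ";;" 60)
  | IfLess nat nat com com
  | WhileLess nat nat com

primrec code_size :: "com \<Rightarrow> nat" where
  "code_size Skip = 0"
| "code_size (Do i) = 1"
| "code_size (c1 ;; c2) = code_size c1 + code_size c2"
| "code_size (IfLess a b c1 c2) = code_size c1 + code_size c2 + 2"
| "code_size (WhileLess a b c) = code_size c + 3"

text \<open>The only test is \<open>JumpLess\<close>, which falls through if it fails. Hence the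
  else-branch \<open>c2\<close> comes first and ends with a jump over \<open>c1\<close>, and a loop
  has a second jump at its head that leaves it.\<close>

primrec compile :: "nat \<Rightarrow> com \<Rightarrow> program" where
  "compile l Skip = []"
| "compile l (Do i) = [i]"
| "compile l (c1 ;; c2) = compile l c1 @ compile (l + code_size c1) c2"
| "compile l (IfLess a b c1 c2) =
     JumpLess a b (l + code_size c2 + 2) # compile (l + 1) c2 @
     Jump (l + code_size c1 + code_size c2 + 2) # compile (l + code_size c2 + 2) c1"
| "compile l (WhileLess a b c) =
     JumpLess a b (l + 2) # Jump (l + code_size c + 3) # compile (l + 2) c @ [Jump l]"

lemma length_compile [simp]: "length (compile l c) = code_size c"
  by (induction c arbitrary: l) auto

text \<open>Jump targets are absolute, so a command is specified relative to the address at which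
  its code sits in some larger program. Quantifying over these programs makes the rules
  compositional.\<close>

definition fragment :: "program \<Rightarrow> nat \<Rightarrow> program \<Rightarrow> bool" where
  "fragment P l is \<longleftrightarrow> (\<forall>i<length is. l + i < length P \<and> P ! (l + i) = is ! i)"

lemma fragment_Nil [simp]: "fragment P l []"
  by (simp add: fragment_def)

lemma fragment_Cons [simp]:
  "fragment P l (a # is) \<longleftrightarrow> l < length P \<and> P ! l = a \<and> fragment P (Suc l) is"
  by (auto simp: fragment_def less_Suc_eq_0_disj)

lemma fragment_append [simp]:
  "fragment P l (xs @ ys) \<longleftrightarrow> fragment P l xs \<and> fragment P (l + length xs) ys"
  by (induction xs arbitrary: l) auto

lemma fragment_refl: "fragment P 0 P"
  by (simp add: fragment_def)

section \<open>Executions whose configurations all satisfy a guard\<close>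

text \<open>All coin outcomes are covered, as the successors range over the support. The count ends
  at the first configuration with \<open>Q\<close>, where \<open>G\<close> is no longer demanded; a
  rule whose code is followed by a further jump must therefore ask for the guard in the
  postcondition.\<close>

primrec lead ::
    "program \<Rightarrow> stcon_input \<Rightarrow> (config \<Rightarrow> bool) \<Rightarrow> (config \<Rightarrow> bool) \<Rightarrow> nat \<Rightarrow> config \<Rightarrow> bool" where
  "lead P x G Q 0 s = Q s"
| "lead P x G Q (Suc k) s =
     (Q s \<or> G s \<and> \<not> halted P s \<and> (\<forall>d\<in>set_pmf (step P x s). lead P x G Q k d))"

lemma lead_0: "Q s \<Longrightarrow> lead P x G Q k s"
  by (cases k) auto

lemma lead_mono:
  assumes "lead P x G Q k s" "k \<le> k'" "\<And>d. Q d \<Longrightarrow> Q' d"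
  shows "lead P x G Q' k' s"
  using assms(1,2)
proof (induction k arbitrary: k' s)
  case (Suc k)
  then obtain k'' where "k' = Suc k''" "k \<le> k''"
    by (cases k') auto
  with Suc assms(3) show ?case
    by auto
qed (auto intro: lead_0 assms(3))

lemma lead_guard: "lead P x G Q t s \<Longrightarrow> (\<And>d. G d \<Longrightarrow> G' d) \<Longrightarrow> lead P x G' Q t s"
  by (induction t arbitrary: s) auto

lemma lead_trans:
  assumes "lead P x G Q k s" "\<And>d. Q d \<Longrightarrow> lead P x G Q' k' d"
  shows "lead P x G Q' (k + k') s"
  using assms(1)
proof (induction k arbitrary: s)
  case (Suc k)
  show ?case
  proof (cases "Q s")
    case True
    show ?thesis
      by (rule lead_mono[OF assms(2)[OF True]]) auto
  next
    case False
    with Suc show ?thesis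
      by auto
  qed
qed (use assms(2) in auto)

lemma run_halted: "halted P s \<Longrightarrow> run P x k s = return_pmf s"
  by (induction k) (auto simp: step_def bind_return_pmf)

text \<open>A halted configuration is a fixed point of \<open>step\<close>, so nothing changes when
  the run is observed later than the bound \<open>k\<close>. This matters because the final
  distribution is taken at a rounded real time bound.\<close>

lemma lead_final:
  assumes "lead P x G Q k s" "\<And>d. Q d \<Longrightarrow> halted P d" "k \<le> k'" "d \<in> set_pmf (run P x k' s)"
  shows "Q d"
  using assms(1,3,4)
proof (induction k arbitrary: k' s)
  case 0
  then show ?case
    using assms(2) by (auto simp: run_halted)
next
  case (Suc k)
  obtain k'' where k'': "k' = Suc k''" "k \<le> k''"
    using Suc.prems by (cases k') auto
  show ?case
  proof (cases "Q s")
    case True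
    then show ?thesis
      using assms(2) Suc.prems by (auto simp: run_halted)
  next
    case False
    with Suc.prems Suc.IH k'' show ?thesis
      by auto
  qed
qed

text \<open>Reachability has no time bound, but after the end every configuration coincides with the
  halted one. Asking for \<open>G\<close> there as well yields \<open>G\<close> at every
  moment.\<close>

lemma lead_reachable:
  assumes "lead P x G Q k s" "\<And>d. Q d \<Longrightarrow> halted P d \<and> G d" "d \<in> reachable_configs P x s"
  shows "G d"
proof -
  have "G d" if "lead P x G Q k s" "d \<in> set_pmf (run P x k' s)" for k k' s
    using that
  proof (induction k' arbitrary: k s)
    case 0
    then show ?case
      using assms(2) by (cases k) auto
  next
    case (Suc k')
    show ?case
    proof (cases "Q s")
      case True
      then show ?thesis
        using assms(2) Suc.prems run_halted[of P s x "Suc k'"] by (auto simp del: run.simps)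
    next
      case False
      with Suc.prems obtain k0 where "k = Suc k0"
        by (cases k) auto
      with False Suc show ?thesis
        by auto
    qed
  qed
  with assms show ?thesis
    by (auto simp: reachable_configs_def)
qed

section \<open>Worst-case triples\<close>

definition conf :: "nat \<Rightarrow> (nat \<Rightarrow> nat) \<Rightarrow> (nat \<Rightarrow> bool) \<Rightarrow> bool list \<Rightarrow> config" where
  "conf l f a out = \<lparr>pc = l, regs = f, cat = a, outp = out\<rparr>"

lemma conf_simps [simp]:
  "pc (conf l f a out) = l" "regs (conf l f a out) = f" "cat (conf l f a out) = a"
  "outp (conf l f a out) = out"
  "advance (conf l f a out) = conf (Suc l) f a out"
  "set_reg r k (conf l f a out) = conf l (f(r := k)) a out"
  "conf l f a out\<lparr>pc := l'\<rparr> = conf l' f a out"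
  "conf l f a out\<lparr>cat := a'\<rparr> = conf l f a' out"
  "conf l f a out\<lparr>outp := out'\<rparr> = conf l f a out'"
  by (simp_all add: conf_def advance_def set_reg_def)

lemma conf_collapse: "pc c = l \<Longrightarrow> conf l (regs c) (cat c) (outp c) = c"
  by (auto simp: conf_def)

type_synonym assn = "(nat \<Rightarrow> nat) \<Rightarrow> (nat \<Rightarrow> bool) \<Rightarrow> bool list \<Rightarrow> bool"

definition guard :: "assn \<Rightarrow> nat \<Rightarrow> program \<Rightarrow> config \<Rightarrow> bool" where
  "guard J S P s \<longleftrightarrow> J (regs s) (cat s) (outp s) \<and> cat_accesses P s \<subseteq> {..<S}"

text \<open>A weakest precondition: started in the given state, \<open>c\<close> reaches its end with \<open>Q\<close> after at most
  \<open>t\<close> steps, and before that it stays within \<open>J\<close> and the addresses below \<open>S\<close>.\<close>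

definition tri ::
    "stcon_input \<Rightarrow> assn \<Rightarrow> nat \<Rightarrow> com \<Rightarrow> nat \<Rightarrow>
     (nat \<Rightarrow> nat) \<Rightarrow> (nat \<Rightarrow> bool) \<Rightarrow> bool list \<Rightarrow> assn \<Rightarrow> bool" where
  "tri x J S c t f a out Q \<longleftrightarrow>
     (\<forall>P l. fragment P l (compile l c) \<longrightarrow>
        lead P x (guard J S P) (\<lambda>d. pc d = l + code_size c \<and> Q (regs d) (cat d) (outp d)) t
          (conf l f a out))"

lemma triD:
  assumes "tri x J S c t f a out Q" "fragment P l (compile l c)" "l' = l + code_size c"
  shows "lead P x (guard J S P) (\<lambda>d. pc d = l' \<and> Q (regs d) (cat d) (outp d)) t (conf l f a out)"
  using assms unfolding tri_def by blast

lemma tri_mono: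
  assumes "tri x J S c t f a out Q" "t \<le> t'" "\<And>f a out. Q f a out \<Longrightarrow> Q' f a out"
  shows "tri x J S c t' f a out Q'"
  unfolding tri_def
proof (intro allI impI)
  fix P l
  assume "fragment P l (compile l c)"
  with assms(1) have
    "lead P x (guard J S P) (\<lambda>d. pc d = l + code_size c \<and> Q (regs d) (cat d) (outp d)) t
       (conf l f a out)"
    by (simp add: tri_def)
  then show
    "lead P x (guard J S P) (\<lambda>d. pc d = l + code_size c \<and> Q' (regs d) (cat d) (outp d)) t'
       (conf l f a out)"
    by (rule lead_mono) (use assms in auto)
qed

lemma tri_time: "tri x J S c t f a out Q \<Longrightarrow> t \<le> t' \<Longrightarrow> tri x J S c t' f a out Q"
  by (rule tri_mono)

lemma tri_weaken:
  assumes "tri x J S c t f a out Q" "\<And>f a out. J f a out \<Longrightarrow> J' f a out"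
  shows "tri x J' S c t f a out Q"
  unfolding tri_def
proof (intro allI impI)
  fix P l
  assume "fragment P l (compile l c)"
  with assms(1) have "lead P x (guard J S P) (\<lambda>d. pc d = l + code_size c \<and> Q (regs d) (cat d) (outp d)) t
      (conf l f a out)"
    by (simp add: tri_def)
  then show "lead P x (guard J' S P) (\<lambda>d. pc d = l + code_size c \<and> Q (regs d) (cat d) (outp d)) t
      (conf l f a out)"
    by (rule lead_guard) (use assms(2) in \<open>auto simp: guard_def\<close>)
qed

lemma tri_Skip: "Q f a out \<Longrightarrow> tri x J S Skip 0 f a out Q"
  by (simp add: tri_def)

lemma tri_Const:
  "J f a out \<Longrightarrow> Q (f(r := k)) a out \<Longrightarrow> tri x J S (Do (Const r k)) 1 f a out Q"
  by (auto simp: tri_def guard_def halted_def step_def cat_accesses_def)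

lemma tri_Arith:
  "J f a out \<Longrightarrow> Q (f(r := apply_arith g (f p) (f q))) a out \<Longrightarrow>
   tri x J S (Do (Arith g r p q)) 1 f a out Q"
  by (auto simp: tri_def guard_def halted_def step_def cat_accesses_def)

lemma tri_Ask:
  "J f a out \<Longrightarrow> Q (f(r := answer x q (f b) (f c))) a out \<Longrightarrow>
   tri x J S (Do (Ask q r b c)) 1 f a out Q"
  by (auto simp: tri_def guard_def halted_def step_def cat_accesses_def)

lemma tri_Flip:
  "J f a out \<Longrightarrow> Q (f(r := 0)) a out \<Longrightarrow> Q (f(r := 1)) a out \<Longrightarrow>
   tri x J S (Do (Flip r)) 1 f a out Q"
  by (auto simp: tri_def guard_def halted_def step_def cat_accesses_def of_bool_def)

lemma tri_CatRead:
  "J f a out \<Longrightarrow> f p < S \<Longrightarrow> Q (f(r := of_bool (a (f p)))) a out \<Longrightarrow>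
   tri x J S (Do (CatRead r p)) 1 f a out Q"
  by (auto simp: tri_def guard_def halted_def step_def cat_accesses_def)

lemma tri_CatWrite:
  "J f a out \<Longrightarrow> f p < S \<Longrightarrow> Q f (a(f p := (f r \<noteq> 0))) out \<Longrightarrow>
   tri x J S (Do (CatWrite p r)) 1 f a out Q"
  by (auto simp: tri_def guard_def halted_def step_def cat_accesses_def)

lemma tri_Emit:
  "J f a out \<Longrightarrow> Q f a (out @ [f r \<noteq> 0]) \<Longrightarrow> tri x J S (Do (Emit r)) 1 f a out Q"
  by (auto simp: tri_def guard_def halted_def step_def cat_accesses_def)

lemma tri_Seq:
  assumes "tri x J S c1 t1 f a out (\<lambda>f a out. tri x J S c2 t2 f a out Q)"
  shows "tri x J S (c1 ;; c2) (t1 + t2) f a out Q"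
  unfolding tri_def
proof (intro allI impI)
  fix P l
  assume fr: "fragment P l (compile l (c1 ;; c2))"
  show "lead P x (guard J S P) (\<lambda>d. pc d = l + code_size (c1 ;; c2) \<and> Q (regs d) (cat d) (outp d))
          (t1 + t2) (conf l f a out)"
  proof (rule lead_trans)
    show "lead P x (guard J S P)
            (\<lambda>d. pc d = l + code_size c1 \<and> tri x J S c2 t2 (regs d) (cat d) (outp d) Q)
            t1 (conf l f a out)"
      using assms fr unfolding tri_def[of x J S c1] by simp
  next
    fix d :: config
    assume d: "pc d = l + code_size c1 \<and> tri x J S c2 t2 (regs d) (cat d) (outp d) Q"
    then have "lead P x (guard J S P)
      (\<lambda>d. pc d = l + code_size c1 + code_size c2 \<and> Q (regs d) (cat d) (outp d)) t2
      (conf (l + code_size c1) (regs d) (cat d) (outp d))"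
      using fr unfolding tri_def by simp
    then show "lead P x (guard J S P)
      (\<lambda>d. pc d = l + code_size (c1 ;; c2) \<and> Q (regs d) (cat d) (outp d)) t2 d"
      using d by (simp add: conf_collapse add.assoc)
  qed
qed

lemma lead_step:
  assumes "guard J S P s" "\<not> halted P s" "\<And>d. d \<in> set_pmf (step P x s) \<Longrightarrow> lead P x (guard J S P) Q t d"
  shows "lead P x (guard J S P) Q (Suc t) s"
  using assms by auto

lemma lead_jump:
  assumes "J f a out" "l < length P" "P ! l = Jump l'" "lead P x (guard J S P) Q t (conf l' f a out)"
  shows "lead P x (guard J S P) Q (Suc t) (conf l f a out)"
  using assms by (intro lead_step) (auto simp: guard_def halted_def cat_accesses_def step_def)

lemma lead_jump_less:
  assumes "J f a out" "l < length P" "P ! l = JumpLess p q l'"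
    and "f p < f q \<Longrightarrow> lead P x (guard J S P) Q t (conf l' f a out)"
    and "\<not> f p < f q \<Longrightarrow> lead P x (guard J S P) Q t (conf (Suc l) f a out)"
  shows "lead P x (guard J S P) Q (Suc t) (conf l f a out)"
  using assms
  by (intro lead_step) (auto simp: guard_def halted_def cat_accesses_def step_def split: if_splits)

text \<open>The asymmetry reflects the code layout: the else-branch is followed by a jump, which is
  executed in a configuration that has to satisfy \<open>J\<close>, whereas the then-branch lies
  last and runs straight into the end.\<close>

lemma tri_If:
  assumes "J f a out" "f p < f q \<Longrightarrow> tri x J S c1 t1 f a out Q"
    and "\<not> f p < f q \<Longrightarrow> tri x J S c2 t2 f a out (\<lambda>f a out. J f a out \<and> Q f a out)"
  shows "tri x J S (IfLess p q c1 c2) (t1 + t2 + 2) f a out Q"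
  unfolding tri_def
proof (intro allI impI)
  fix P l
  assume fr: "fragment P l (compile l (IfLess p q c1 c2))"
  let ?E = "\<lambda>d. pc d = l + code_size (IfLess p q c1 c2) \<and> Q (regs d) (cat d) (outp d)"
  show "lead P x (guard J S P) ?E (t1 + t2 + 2) (conf l f a out)"
  proof (cases "f p < f q")
    case True
    then have "lead P x (guard J S P) ?E t1 (conf (l + code_size c2 + 2) f a out)"
      using assms(2) fr unfolding tri_def by (force simp: add_ac)
    then have "lead P x (guard J S P) ?E (Suc t1) (conf l f a out)"
      using fr True assms(1) by - (rule lead_jump_less, auto simp del: lead.simps(2))
    then show ?thesis
      by (rule lead_mono) auto
  next
    case False
    have "lead P x (guard J S P) (\<lambda>d. pc d = l + 1 + code_size c2 \<and>
             J (regs d) (cat d) (outp d) \<and> Q (regs d) (cat d) (outp d)) t2 (conf (l + 1) f a out)"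
      by (rule triD[OF assms(3)[OF False]]) (use fr in auto)
    then have "lead P x (guard J S P) ?E (t2 + 1) (conf (l + 1) f a out)"
    proof (rule lead_trans)
      fix d :: config
      assume d: "pc d = l + 1 + code_size c2 \<and> J (regs d) (cat d) (outp d) \<and> Q (regs d) (cat d) (outp d)"
      then have "lead P x (guard J S P) ?E (Suc 0) (conf (l + 1 + code_size c2) (regs d) (cat d) (outp d))"
        using fr by - (rule lead_jump, auto simp: add_ac simp del: lead.simps(2))
      with d show "lead P x (guard J S P) ?E 1 d"
        by (simp add: conf_collapse del: lead.simps(2))
    qed
    then have "lead P x (guard J S P) ?E (Suc (t2 + 1)) (conf l f a out)"
      using fr False assms(1)
      by - (rule lead_jump_less[where p = p and q = q and l' = "l + code_size c2 + 2"],
        auto simp del: lead.simps(2))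
    then show ?thesis
      by (rule lead_mono) auto
  qed
qed

text \<open>Each iteration pays for the test and for the jump back besides the body, hence
  \<open>t + 2\<close>; the final 2 steps are the failing test and the exit jump. The measure may
  depend on the registers only.\<close>

lemma tri_While:
  assumes body: "\<And>f a out. I f a out \<Longrightarrow> f p < f q \<Longrightarrow>
      J f a out \<and> tri x J S c t f a out (\<lambda>f' a' out'. I f' a' out' \<and> \<mu> f' < (\<mu> f :: nat))"
    and exit: "\<And>f a out. I f a out \<Longrightarrow> \<not> f p < f q \<Longrightarrow> J f a out \<and> Q f a out"
    and J: "\<And>f a out. I f a out \<Longrightarrow> J f a out"
    and init: "I f a out"
    and t': "t' = \<mu> f * (t + 2) + 2"
  shows "tri x J S (WhileLess p q c) t' f a out Q"
  unfolding tri_def t'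
proof (intro allI impI)
  fix P l
  assume fr: "fragment P l (compile l (WhileLess p q c))"
  let ?E = "\<lambda>d. pc d = l + code_size (WhileLess p q c) \<and> Q (regs d) (cat d) (outp d)"
  show "lead P x (guard J S P) ?E (\<mu> f * (t + 2) + 2) (conf l f a out)"
    using init
  proof (induction "\<mu> f" arbitrary: f a out rule: less_induct)
    case less
    show ?case
    proof (cases "f p < f q")
      case False
      have "lead P x (guard J S P) ?E 0 (conf (l + code_size c + 3) f a out)"
        using exit[OF less.prems False] by simp
      then have "lead P x (guard J S P) ?E (Suc 0) (conf (Suc l) f a out)"
        using fr exit[OF less.prems False] by - (rule lead_jump, auto simp del: lead.simps(2))
      then have "lead P x (guard J S P) ?E (Suc (Suc 0)) (conf l f a out)"
        using fr exit[OF less.prems False] False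
        by - (rule lead_jump_less[where p = p and q = q and l' = "l + 2"], auto simp del: lead.simps(2))
      then show ?thesis
        by (rule lead_mono) auto
    next
      case True
      note b = body[OF less.prems True]
      \<comment> \<open>With measure 0 the body would have to reach a configuration with
        \<open>False\<close>. That is impossible, as every step has a nonempty support.\<close>
      have "0 < \<mu> f"
      proof (rule ccontr)
        assume "\<not> 0 < \<mu> f"
        with b have b0: "tri x J S c t f a out (\<lambda>_ _ _. False)"
          by simp
        have fr': "fragment P (l + 2) (compile (l + 2) c)"
          using fr by simp
        have "\<not> lead P x G (\<lambda>_. False) k s" for G k s
        proof (induction k arbitrary: s)
          case (Suc k)
          then show ?case
            using set_pmf_not_empty[of "step P x s"] by auto
        qed simp
        moreover have "lead P x (guard J S P) (\<lambda>_. False) t (conf (l + 2) f a out)"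
          using b0 fr' by (simp add: tri_def)
        ultimately show False
          by blast
      qed
      then obtain u where u: "\<mu> f = Suc u"
        by (cases "\<mu> f") auto
      have "lead P x (guard J S P) (\<lambda>d. pc d = l + 2 + code_size c \<and> I (regs d) (cat d) (outp d) \<and>
               \<mu> (regs d) < \<mu> f) t (conf (l + 2) f a out)"
        by (rule triD[OF conjunct2[OF b]]) (use fr in auto)
      then have "lead P x (guard J S P) ?E (t + Suc (u * (t + 2) + 2)) (conf (l + 2) f a out)"
      proof (rule lead_trans)
        fix d :: config
        assume d: "pc d = l + 2 + code_size c \<and> I (regs d) (cat d) (outp d) \<and> \<mu> (regs d) < \<mu> f"
        then have "lead P x (guard J S P) ?E (\<mu> (regs d) * (t + 2) + 2) (conf l (regs d) (cat d) (outp d))"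
          using less.hyps by blast
        then have "lead P x (guard J S P) ?E (u * (t + 2) + 2) (conf l (regs d) (cat d) (outp d))"
          by (rule lead_mono) (use d u in \<open>simp_all only: less_Suc_eq_le add_le_mono1 mult_le_mono1\<close>)
        then have "lead P x (guard J S P) ?E (Suc (u * (t + 2) + 2))
                     (conf (l + 2 + code_size c) (regs d) (cat d) (outp d))"
          using fr d J by - (rule lead_jump, auto simp: add_ac simp del: lead.simps(2))
        with d show "lead P x (guard J S P) ?E (Suc (u * (t + 2) + 2)) d"
          by (simp add: conf_collapse del: lead.simps(2))
      qed
      then have "lead P x (guard J S P) ?E (Suc (t + Suc (u * (t + 2) + 2))) (conf l f a out)"
        using fr b True by - (rule lead_jump_less, auto simp del: lead.simps(2))
      then show ?thesis
        by (rule lead_mono) (auto simp: u)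
    qed
  qed
qed

text \<open>Past the last instruction of a whole program the configuration is halted and accesses no
  tape cell, so \<open>J\<close> suffices for the guard at the end.\<close>

lemma tri_lead:
  assumes "tri x J S c t f a out Q" "\<And>f a out. Q f a out \<Longrightarrow> J f a out"
  shows "lead (compile 0 c) x (guard J S (compile 0 c))
    (\<lambda>d. halted (compile 0 c) d \<and> guard J S (compile 0 c) d \<and> pc d = code_size c \<and>
         Q (regs d) (cat d) (outp d)) t (conf 0 f a out)"
proof -
  have "lead (compile 0 c) x (guard J S (compile 0 c))
          (\<lambda>d. pc d = 0 + code_size c \<and> Q (regs d) (cat d) (outp d)) t (conf 0 f a out)"
    using assms(1) fragment_refl unfolding tri_def by blast
  then show ?thesis
    by (rule lead_mono) (use assms(2) in \<open>auto simp: halted_def guard_def cat_accesses_def\<close>)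
qed

section \<open>Lower bounds on probabilities\<close>

text \<open>Asking for all \<open>k \<ge> n\<close> instead of a single \<open>k\<close> makes the
  bound monotone in \<open>n\<close>, so that branches of different durations can be
  combined.\<close>

definition pr :: "program \<Rightarrow> stcon_input \<Rightarrow> config set \<Rightarrow> nat \<Rightarrow> real \<Rightarrow> config \<Rightarrow> bool" where
  "pr P x E n \<rho> s \<longleftrightarrow> (\<forall>k\<ge>n. \<rho> \<le> measure_pmf.prob (run P x k s) E)"

lemma prob_bind_pmf_ge:
  assumes "\<And>y. y \<in> set_pmf p \<Longrightarrow> \<rho> \<le> measure_pmf.prob (f y) E"
  shows "\<rho> \<le> measure_pmf.prob (bind_pmf p f) E"
proof -
  have "ennreal \<rho> = (\<integral>\<^sup>+y. ennreal \<rho> \<partial>measure_pmf p)"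
    by simp
  also have "\<dots> \<le> (\<integral>\<^sup>+y. emeasure (f y) E \<partial>measure_pmf p)"
    by (intro nn_integral_mono_AE)
      (auto simp: AE_measure_pmf_iff measure_pmf.emeasure_eq_measure intro!: ennreal_leI assms)
  also have "\<dots> = ennreal (measure_pmf.prob (bind_pmf p f) E)"
    by (simp flip: measure_pmf.emeasure_eq_measure)
  finally show ?thesis
    by (simp add: ennreal_le_iff)
qed

lemma pr_lead:
  assumes "lead P x G Q k s" "\<And>d. Q d \<Longrightarrow> pr P x E n \<rho> d"
  shows "pr P x E (k + n) \<rho> s"
  using assms(1)
proof (induction k arbitrary: s)
  case (Suc k)
  show ?case
  proof (cases "Q s")
    case False
    show ?thesis
      unfolding pr_def
    proof (intro allI impI)
      fix k'
      assume "Suc k + n \<le> k'"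
      then obtain k'' where "k' = Suc k''" "k + n \<le> k''"
        by (cases k') auto
      then show "\<rho> \<le> measure_pmf.prob (run P x k' s) E"
        using Suc False by (auto simp: pr_def intro!: prob_bind_pmf_ge)
    qed
  qed (use assms(2) in \<open>auto simp: pr_def\<close>)
qed (use assms(2) in auto)

lemma pr_flip:
  assumes "l < length P" "P ! l = Flip r"
    and "pr P x E n \<rho>0 (conf (Suc l) (f(r := 0)) a out)" "pr P x E n \<rho>1 (conf (Suc l) (f(r := 1)) a out)"
  shows "pr P x E (Suc n) ((\<rho>0 + \<rho>1) / 2) (conf l f a out)"
  unfolding pr_def
proof (intro allI impI)
  fix k
  assume "Suc n \<le> k"
  then obtain k' where k': "k = Suc k'" "n \<le> k'"
    by (cases k) auto
  let ?g = "\<lambda>b. run P x k' (conf (Suc l) (f(r := of_bool b)) a out)"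
  have "emeasure (run P x k (conf l f a out)) E = (\<integral>\<^sup>+b. emeasure (?g b) E \<partial>bernoulli_pmf (1/2))"
    using assms(1,2) by (simp add: k' step_def halted_def)
  also have "\<dots> = ennreal (measure_pmf.prob (?g True) E / 2 + measure_pmf.prob (?g False) E / 2)"
    by (subst nn_integral_bernoulli_pmf)
      (simp_all add: measure_pmf.emeasure_eq_measure ennreal_plus divide_ennreal_def
        flip: ennreal_divide_numeral)
  finally have "measure_pmf.prob (run P x k (conf l f a out)) E =
      measure_pmf.prob (?g True) E / 2 + measure_pmf.prob (?g False) E / 2"
    by (simp add: measure_pmf.emeasure_eq_measure del: ennreal_plus)
  then show "(\<rho>0 + \<rho>1) / 2 \<le> measure_pmf.prob (run P x k (conf l f a out)) E"
    using assms(3,4) k' by (auto simp: pr_def field_simps intro!: add_mono)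
qed

text \<open>An expectation transformer: if the success probability after \<open>c\<close> is bounded below by \<open>g\<close>,
  then before \<open>c\<close> it is bounded below by \<open>\<rho>\<close>.\<close>

definition ptri ::
    "stcon_input \<Rightarrow> com \<Rightarrow> nat \<Rightarrow> (nat \<Rightarrow> nat) \<Rightarrow> (nat \<Rightarrow> bool) \<Rightarrow> bool list \<Rightarrow>
     ((nat \<Rightarrow> nat) \<Rightarrow> (nat \<Rightarrow> bool) \<Rightarrow> bool list \<Rightarrow> real) \<Rightarrow> real \<Rightarrow> bool" where
  "ptri x c t f a out g \<rho> \<longleftrightarrow>
     (\<forall>P l E n. fragment P l (compile l c) \<longrightarrow>
        (\<forall>f a out. pr P x E n (g f a out) (conf (l + code_size c) f a out)) \<longrightarrow>
        pr P x E (n + t) \<rho> (conf l f a out))"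

lemma pr_mono: "pr P x E n \<rho> s \<Longrightarrow> n \<le> n' \<Longrightarrow> \<rho>' \<le> \<rho> \<Longrightarrow> pr P x E n' \<rho>' s"
  unfolding pr_def by (meson order_trans)

lemma ptriD:
  assumes "ptri x c t f a out g \<rho>" "fragment P l (compile l c)"
    and "\<And>f a out. pr P x E n (g f a out) (conf (l + code_size c) f a out)"
  shows "pr P x E (n + t) \<rho> (conf l f a out)"
  using assms unfolding ptri_def by blast

lemma ptri_time: "ptri x c t f a out g \<rho> \<Longrightarrow> t \<le> t' \<Longrightarrow> ptri x c t' f a out g \<rho>"
  unfolding ptri_def by (blast intro: pr_mono add_left_mono)

lemma ptri_le: "ptri x c t f a out g \<rho> \<Longrightarrow> \<rho>' \<le> \<rho> \<Longrightarrow> ptri x c t f a out g \<rho>'"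
  unfolding ptri_def by (blast intro: pr_mono)

text \<open>The function \<open>g\<close> of \<open>ptri\<close> is evaluated at all states, also at
  those that violate every invariant. There it is set to 0, and this rule disposes of them.\<close>

lemma ptri_0: "ptri x c t f a out g 0"
  by (simp add: ptri_def pr_def)

text \<open>Worst-case statements are transferred into the expectation calculus: whatever the coins
  do, the end satisfies \<open>Q\<close>, so an average over outcomes is at least
  \<open>\<rho>\<close>.\<close>

lemma ptri_tri:
  assumes "tri x J S c t f a out Q" "\<And>f a out. Q f a out \<Longrightarrow> \<rho> \<le> g f a out"
  shows "ptri x c t f a out g \<rho>"
  unfolding ptri_def
proof (intro allI impI)
  fix P l E n
  assume fr: "fragment P l (compile l c)"
    and pr: "\<forall>f a out. pr P x E n (g f a out) (conf (l + code_size c) f a out)"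
  have "pr P x E (t + n) \<rho> (conf l f a out)"
  proof (rule pr_lead)
    show "lead P x (guard J S P) (\<lambda>d. pc d = l + code_size c \<and> Q (regs d) (cat d) (outp d)) t
            (conf l f a out)"
      using assms(1) fr by (simp add: tri_def)
  next
    fix d :: config
    assume "pc d = l + code_size c \<and> Q (regs d) (cat d) (outp d)"
    then show "pr P x E n \<rho> d"
      using pr[rule_format, of "regs d" "cat d" "outp d"] assms(2)
      by (auto simp: conf_collapse intro: pr_mono)
  qed
  then show "pr P x E (n + t) \<rho> (conf l f a out)"
    by (simp add: add.commute)
qed

lemma ptri_Flip:
  assumes "\<rho> \<le> (g (f(r := 0)) a out + g (f(r := 1)) a out) / 2"
  shows "ptri x (Do (Flip r)) 1 f a out g \<rho>"
  unfolding ptri_def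
proof (intro allI impI)
  fix P l E n
  assume "fragment P l (compile l (Do (Flip r)))"
    and "\<forall>f a out. pr P x E n (g f a out) (conf (l + code_size (Do (Flip r))) f a out)"
  then have "pr P x E (Suc n) ((g (f(r := 0)) a out + g (f(r := 1)) a out) / 2) (conf l f a out)"
    by (intro pr_flip) auto
  then show "pr P x E (n + 1) \<rho> (conf l f a out)"
    by (rule pr_mono) (use assms in auto)
qed

lemma ptri_Seq:
  assumes "ptri x c1 t1 f a out h \<rho>" "\<And>f a out. ptri x c2 t2 f a out g (h f a out)"
  shows "ptri x (c1 ;; c2) (t1 + t2) f a out g \<rho>"
  unfolding ptri_def
proof (intro allI impI)
  fix P l E n
  assume fr: "fragment P l (compile l (c1 ;; c2))"
    and pr: "\<forall>f a out. pr P x E n (g f a out) (conf (l + code_size (c1 ;; c2)) f a out)"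
  have "pr P x E (n + t2) (h f a out) (conf (l + code_size c1) f a out)" for f a out
    using assms(2)[of f a out] fr pr unfolding ptri_def by (simp add: add.assoc)
  then have "pr P x E (n + t2 + t1) \<rho> (conf l f a out)"
    using assms(1) fr unfolding ptri_def by simp
  then show "pr P x E (n + (t1 + t2)) \<rho> (conf l f a out)"
    by (simp add: add_ac)
qed

lemma pr_det:
  assumes "l < length P" "exec x (P ! l) (conf l f a out) = return_pmf d" "pr P x E n \<rho> d"
  shows "pr P x E (Suc n) \<rho> (conf l f a out)"
  unfolding pr_def
proof (intro allI impI)
  fix k
  assume "Suc n \<le> k"
  then obtain k' where "k = Suc k'" "n \<le> k'"
    by (cases k) auto
  then show "\<rho> \<le> measure_pmf.prob (run P x k (conf l f a out)) E"
    using assms by (simp add: step_def halted_def bind_return_pmf pr_def)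
qed

text \<open>Loops are unrolled one iteration at a time here, since the expected value changes with
  each coin; the induction over the remaining iterations is left to the application.\<close>

lemma ptri_While_exit:
  assumes "\<not> f p < f q" "\<rho> \<le> g f a out"
  shows "ptri x (WhileLess p q c) 2 f a out g \<rho>"
  unfolding ptri_def
proof (intro allI impI)
  fix P l E n
  assume fr: "fragment P l (compile l (WhileLess p q c))"
    and pr: "\<forall>f a out. pr P x E n (g f a out) (conf (l + code_size (WhileLess p q c)) f a out)"
  have "pr P x E n \<rho> (conf (l + code_size c + 3) f a out)"
    using pr assms(2) by (auto intro: pr_mono simp: add_ac)
  then have "pr P x E (Suc n) \<rho> (conf (Suc l) f a out)"
    using fr by (intro pr_det) auto
  then have "pr P x E (Suc (Suc n)) \<rho> (conf l f a out)"
    using fr assms(1) by (intro pr_det) auto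
  then show "pr P x E (n + 2) \<rho> (conf l f a out)"
    by simp
qed

lemma ptri_While_step:
  assumes "f p < f q" "ptri x c t1 f a out h \<rho>"
    and "\<And>f a out. ptri x (WhileLess p q c) t2 f a out g (h f a out)"
  shows "ptri x (WhileLess p q c) (t1 + t2 + 2) f a out g \<rho>"
  unfolding ptri_def
proof (intro allI impI)
  fix P l E n
  assume fr: "fragment P l (compile l (WhileLess p q c))"
    and pr: "\<forall>f a out. pr P x E n (g f a out) (conf (l + code_size (WhileLess p q c)) f a out)"
  have "pr P x E (n + t2) (h f a out) (conf l f a out)" for f a out
    using assms(3)[of f a out] fr pr unfolding ptri_def by blast
  then have "pr P x E (Suc (n + t2)) (h f a out) (conf (l + 2 + code_size c) f a out)" for f a out
    using fr by (intro pr_det) (auto simp: add_ac)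
  then have "pr P x E (Suc (n + t2) + t1) \<rho> (conf (l + 2) f a out)"
    by (rule ptriD[OF assms(2), rotated]) (use fr in auto)
  then have "pr P x E (Suc (Suc (n + t2) + t1)) \<rho> (conf l f a out)"
    using fr assms(1) by (intro pr_det) auto
  then show "pr P x E (n + (t1 + t2 + 2)) \<rho> (conf l f a out)"
    by (simp add: add_ac)
qed

section \<open>Few small numbers divide a given number\<close>

text \<open>Write each \<open>ln q\<close> as the sum of \<open>mangoldt d\<close> over its divisors
  \<open>d\<close> and exchange the two sums.\<close>

lemma sum_ln_mangoldt:
  assumes "A \<subseteq> {1..n}"
  shows "(\<Sum>q\<in>A. ln (real q)) = (\<Sum>d = 1..n. mangoldt d * real (card {q \<in> A. d dvd q}))"
proof -
  have fin: "finite A"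
    using assms by (rule finite_subset) simp
  have "(\<Sum>q\<in>A. ln (real q)) = (\<Sum>q\<in>A. \<Sum>d = 1..n. if d dvd q then mangoldt d else 0)"
  proof (rule sum.cong)
    fix q
    assume "q \<in> A"
    then have q: "0 < q" "q \<le> n"
      using assms by auto
    have "ln (real q) = (\<Sum>d | d dvd q. mangoldt d)"
      using mangoldt_sum[of q, where ?'a = real] q by simp
    also have "\<dots> = (\<Sum>d = 1..n. if d dvd q then mangoldt d else 0)"
      using q by (intro sum.mono_neutral_cong_left)
        (auto simp: dvd_imp_le Suc_le_eq dest: dvd_pos_nat intro: dvd_imp_le[THEN order_trans])
    finally show "ln (real q) = \<dots>" .
  qed simp
  also have "\<dots> = (\<Sum>d = 1..n. \<Sum>q\<in>A. if d dvd q then mangoldt d else 0)"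
    by (rule sum.swap)
  also have "\<dots> = (\<Sum>d = 1..n. mangoldt d * real (card {q \<in> A. d dvd q}))"
  proof (rule sum.cong)
    fix d
    have "(\<Sum>q\<in>A. if d dvd q then mangoldt d else 0) = (\<Sum>q\<in>{q \<in> A. d dvd q}. mangoldt d :: real)"
      using fin by (intro sum.mono_neutral_cong_right) auto
    then show "(\<Sum>q\<in>A. if d dvd q then mangoldt d else 0) = mangoldt d * real (card {q \<in> A. d dvd q})"
      by (simp add: mult.commute)
  qed simp
  finally show ?thesis .
qed

lemma card_multiples:
  assumes "0 < d"
  shows "card {q \<in> {1..n::nat}. d dvd q} = n div d"
proof -
  have "{q \<in> {1..n}. d dvd q} = (\<lambda>k. d * k) ` {1..n div d}"
    using assms by (auto simp: dvd_def image_iff less_eq_div_iff_mult_less_eq mult.commute Suc_le_eq)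
  then show ?thesis
    using assms by (simp add: card_image inj_on_def)
qed

text \<open>A weak one-sided form of Mertens' estimate. The sum of \<open>ln q\<close> for
  \<open>q \<le> y\<close> is at most \<open>y * ln y\<close> and equals the sum of
  \<open>mangoldt d * (y div d)\<close>; for \<open>d \<le> y\<close> rounding down loses at most a
  factor of 2.\<close>

lemma sum_mangoldt_div_le:
  assumes "1 \<le> y"
  shows "(\<Sum>d = 1..y. mangoldt d / real d) \<le> 2 * ln (real y)"
proof -
  have "(\<Sum>d = 1..y. mangoldt d * (real y / (2 * real d)))
      \<le> (\<Sum>d = 1..y. mangoldt d * real (card {q \<in> {1..y}. d dvd q}))"
  proof (intro sum_mono mult_left_mono mangoldt_nonneg)
    fix d
    assume d: "d \<in> {1..y}"
    then have "y < d * (y div d) + d" "1 \<le> y div d"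
      using dividend_less_times_div[of d y] by (auto simp: less_eq_div_iff_mult_less_eq)
    then have "y < 2 * d * (y div d)"
      using d by (smt (verit) mult.assoc mult_2 mult_le_mono2 nat_mult_1_right add_le_cancel_left order_less_le_trans)
    then have "real y \<le> 2 * real d * real (y div d)"
      by (metis less_imp_le of_nat_le_iff of_nat_mult of_nat_numeral)
    then show "real y / (2 * real d) \<le> real (card {q \<in> {1..y}. d dvd q})"
      using d by (subst card_multiples) (auto simp: field_simps)
  qed
  also have "\<dots> = (\<Sum>q = 1..y. ln (real q))"
    by (rule sum_ln_mangoldt[symmetric]) simp
  also have "\<dots> \<le> (\<Sum>q = 1..y. ln (real y))"
    by (intro sum_mono) auto
  also have "\<dots> = real y * ln (real y)"
    by simp
  also have "(\<Sum>d = 1..y. mangoldt d * (real y / (2 * real d))) = (real y / 2) * (\<Sum>d = 1..y. mangoldt d / real d)"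
    by (simp add: sum_distrib_left field_simps)
  finally show ?thesis
    using assms by (simp add: field_simps)
qed

text \<open>Only \<open>d dvd N\<close> can divide a divisor of \<open>N\<close>, and at most
  \<open>Q / d\<close> of the candidates are multiples of \<open>d\<close>. It remains to bound the
  sum of \<open>mangoldt d / d\<close> over the divisors of \<open>N\<close>: those up to
  \<open>y\<close> contribute at most \<open>2 * ln y\<close>, the larger ones at most
  \<open>ln N / y \<le> 1\<close>.\<close>

lemma sum_ln_divisors_le:
  assumes "0 < N" "ln (real N) \<le> real y" "1 \<le> y"
  shows "(\<Sum>q | q \<in> {1..Q} \<and> q dvd N. ln (real q)) \<le> real Q * (2 * ln (real y) + 1)"
proof -
  let ?D = "{q. q \<in> {1..Q} \<and> q dvd N}"
  let ?E = "{d \<in> {1..Q}. d dvd N}"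
  have fin: "finite {d. d dvd N}"
    using assms by simp
  have "(\<Sum>q\<in>?D. ln (real q)) = (\<Sum>d = 1..Q. mangoldt d * real (card {q \<in> ?D. d dvd q}))"
    by (rule sum_ln_mangoldt) auto
  also have "\<dots> = (\<Sum>d\<in>?E. mangoldt d * real (card {q \<in> ?D. d dvd q}))"
  proof (rule sum.mono_neutral_right)
    show "\<forall>d\<in>{1..Q} - ?E. mangoldt d * real (card {q \<in> ?D. d dvd q}) = 0"
    proof
      fix d
      assume "d \<in> {1..Q} - ?E"
      then have "{q \<in> ?D. d dvd q} = {}"
        using dvd_trans[of d _ N] by blast
      then show "mangoldt d * real (card {q \<in> ?D. d dvd q}) = 0"
        by simp
    qed
  qed auto
  also have "\<dots> \<le> (\<Sum>d\<in>?E. mangoldt d * (real Q / real d))"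
  proof (intro sum_mono mult_left_mono mangoldt_nonneg)
    fix d
    assume d: "d \<in> ?E"
    have "card {q \<in> ?D. d dvd q} \<le> card {q \<in> {1..Q}. d dvd q}"
      by (rule card_mono) auto
    also have "\<dots> = Q div d"
      using d by (subst card_multiples) auto
    finally have "real (card {q \<in> ?D. d dvd q}) \<le> real (Q div d)"
      by simp
    also have "\<dots> \<le> real Q / real d"
      by (rule of_nat_div_le_of_nat)
    finally show "real (card {q \<in> ?D. d dvd q}) \<le> real Q / real d" .
  qed
  also have "\<dots> = real Q * (\<Sum>d\<in>?E. mangoldt d / real d)"
    by (simp add: sum_distrib_left field_simps)
  also have "\<dots> \<le> real Q * (2 * ln (real y) + 1)"
  proof (rule mult_left_mono)
    have "(\<Sum>d\<in>?E. mangoldt d / real d)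
        \<le> (\<Sum>d\<in>{1..y} \<union> {d. d dvd N}. if d \<le> y then mangoldt d / real d else mangoldt d / real y)"
    proof -
      have "(\<Sum>d\<in>?E. mangoldt d / real d)
          \<le> (\<Sum>d\<in>?E. if d \<le> y then mangoldt d / real d else mangoldt d / real y)"
        using assms by (intro sum_mono) (auto intro!: divide_left_mono mangoldt_nonneg)
      also have "\<dots> \<le> (\<Sum>d\<in>{1..y} \<union> {d. d dvd N}. if d \<le> y then mangoldt d / real d else mangoldt d / real y)"
        using fin by (intro sum_mono2) (auto intro!: divide_nonneg_nonneg mangoldt_nonneg)
      finally show ?thesis .
    qed
    also have "\<dots> \<le> (\<Sum>d\<in>{1..y} \<union> {d. d dvd N}.
        (if d \<in> {1..y} then mangoldt d / real d else 0) + (if d dvd N then mangoldt d / real y else 0))"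
      using assms(1) by (intro sum_mono) (auto intro!: divide_nonneg_nonneg mangoldt_nonneg dest: dvd_pos_nat)
    also have "\<dots> = (\<Sum>d = 1..y. mangoldt d / real d) + (\<Sum>d | d dvd N. mangoldt d / real y)"
    proof -
      have "(\<Sum>d\<in>{1..y} \<union> {d. d dvd N}. if d \<in> {1..y} then mangoldt d / real d else 0)
          = (\<Sum>d = 1..y. mangoldt d / real d)"
        using fin by (intro sum.mono_neutral_cong_right) auto
      moreover have "(\<Sum>d\<in>{1..y} \<union> {d. d dvd N}. if d dvd N then mangoldt d / real y else 0)
          = (\<Sum>d | d dvd N. mangoldt d / real y)"
        using fin by (intro sum.mono_neutral_cong_right) auto
      ultimately show ?thesis
        by (simp add: sum.distrib)
    qed
    also have "(\<Sum>d | d dvd N. mangoldt d / real y) = ln (real N) / real y"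
      using mangoldt_sum[of N, where ?'a = real] assms by (simp flip: sum_divide_distrib)
    also have "\<dots> \<le> 1"
      using assms by simp
    also have "(\<Sum>d = 1..y. mangoldt d / real d) \<le> 2 * ln (real y)"
      using assms by (intro sum_mangoldt_div_le) simp
    finally show "(\<Sum>d\<in>?E. mangoldt d / real d) \<le> 2 * ln (real y) + 1"
      by simp
  qed simp
  finally show ?thesis .
qed

text \<open>If more than a quarter of the numbers up to \<open>Q\<close> divided \<open>N\<close>,
  at least \<open>Q / 8\<close> of these divisors would exceed \<open>Q / 8\<close>. Their
  logarithms would then be too large for the previous bound unless
  \<open>ln (Q / 8) \<le> 16 * ln y + 8\<close>.\<close>

lemma card_divisors_le:
  assumes N: "0 < N" "ln (real N) \<le> real y" and y: "1 \<le> y" and Q: "2 ^ 15 * y ^ 16 \<le> Q"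
  shows "4 * card {q \<in> {1..Q}. q dvd N} \<le> Q"
proof (rule ccontr)
  let ?D = "{q \<in> {1..Q}. q dvd N}"
  let ?B = "{q \<in> ?D. Q div 8 < q}"
  assume "\<not> ?thesis"
  then have D: "Q < 4 * card ?D"
    by simp
  \<comment> \<open>Ensures that \<open>ln (real Q / 8)\<close> is nonnegative, so that the count of
    \<open>?B\<close> may be multiplied by it.\<close>
  have "8 * 1 \<le> (2 ^ 15 :: nat) * y ^ 16"
    using y by (intro mult_le_mono) auto
  then have "8 \<le> Q"
    using Q by linarith
  then have Q8: "0 < Q" "8 \<le> Q"
    by simp_all
  have "card ?D \<le> card (?B \<union> {1..Q div 8})"
    by (rule card_mono) auto
  also have "\<dots> \<le> card ?B + Q div 8"
    using card_Un_le[of ?B "{1..Q div 8}"] by simp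
  finally have B: "Q \<le> 8 * card ?B"
    using D by linarith
  have "real Q / 8 * ln (real Q / 8) \<le> real (card ?B) * ln (real Q / 8)"
    using B Q8 by (intro mult_right_mono) auto
  also have "\<dots> = (\<Sum>q\<in>?B. ln (real Q / 8))"
    by simp
  also have "\<dots> \<le> (\<Sum>q\<in>?B. ln (real q))"
    using Q8 by (intro sum_mono) auto
  also have "\<dots> \<le> (\<Sum>q\<in>?D. ln (real q))"
    by (intro sum_mono2) auto
  also have "\<dots> \<le> real Q * (2 * ln (real y) + 1)"
    using sum_ln_divisors_le[of N y Q] N y by simp
  finally have *: "real Q / 8 * ln (real Q / 8) \<le> real Q * (2 * ln (real y) + 1)" .
  have "b \<le> 16 * c + 8" if "real Q / 8 * b \<le> real Q * (2 * c + 1)" for b c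
  proof -
    have "real Q * b \<le> real Q * (16 * c + 8)"
      using that by (simp add: algebra_simps)
    then show ?thesis
      using Q8 by simp
  qed
  from this[OF *] have "ln (real Q / 8) \<le> 16 * ln (real y) + 8" .
  also have "\<dots> = ln (real y ^ 16 * exp 8)"
    using y by (simp add: ln_mult ln_realpow)
  finally have "real Q / 8 \<le> real y ^ 16 * exp 8"
    using Q8 y by (simp add: ln_le_cancel_iff del: ln_mult)
  \<comment> \<open>\<open>8 * 4096 = 2 ^ 15\<close> is where the constant in the assumption on
    \<open>Q\<close> comes from.\<close>
  also have "exp 8 < (4096 :: real)"
  proof -
    have "exp 8 = exp (1 :: real) ^ 8"
      by (simp flip: exp_of_nat_mult)
    also have "\<dots> \<le> (272 / 100) ^ 8"
      using e_less_272 by (intro power_mono) auto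
    also have "\<dots> < 4096"
      by (simp add: power_divide)
    finally show ?thesis .
  qed
  finally have "real Q < 2 ^ 15 * real y ^ 16"
    using y by simp
  also have "\<dots> = real (2 ^ 15 * y ^ 16)"
    by simp
  finally show False
    using Q by linarith
qed

section \<open>The block structure\<close>

text \<open>\<open>nb v\<close> is the list of in-neighbours. In a simple graph it has fewer than
  \<open>n\<close> entries, so that a row of \<open>n\<close> blocks has room for these arcs and for
  staying.\<close>

locale grid =
  fixes n q r W :: nat and nb :: "nat \<Rightarrow> nat list" and src :: nat
  assumes n_pos: "0 < n" and q_pos: "0 < q" and q_le: "q \<le> W" and r_less: "r < W"
    and nb_range: "\<And>v. v \<in> {1..n} \<Longrightarrow> set (nb v) \<subseteq> {1..n}"
    and nb_length: "\<And>v. v \<in> {1..n} \<Longrightarrow> length (nb v) < n"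
begin

text \<open>Block \<open>(i * n + (v - 1)) * n + j\<close> belongs to layer \<open>i\<close>, vertex \<open>v\<close> and its \<open>j\<close>-th
  in-neighbour; \<open>j = 0\<close> stands for staying at \<open>v\<close>. Blocks with \<open>j\<close> larger than the in-degree of
  \<open>v\<close> are not used.\<close>

definition vert :: "nat \<Rightarrow> nat" where
  "vert p = p div n mod n + 1"

text \<open>Layer \<open>n\<close> is not on the tape, but \<open>start n v\<close> is meaningful as
  an index at which \<open>inflow\<close> is evaluated: this is how the result is extracted after
  the last layer.\<close>

definition start :: "nat \<Rightarrow> nat \<Rightarrow> nat" where
  "start i v = i * (n * n) + (v - 1) * n"

definition last_block :: "nat \<Rightarrow> nat \<Rightarrow> nat" where
  "last_block i v = start i v + length (nb v)"

definition used :: "nat \<Rightarrow> bool" where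
  "used p \<longleftrightarrow> p mod n \<le> length (nb (vert p))"

definition pre :: "nat \<Rightarrow> nat" where
  "pre p = (if p mod n = 0 then vert p else nb (vert p) ! (p mod n - 1))"

definition residue :: "nat \<Rightarrow> nat" where
  "residue y = (y + r) mod W mod q"

definition whole :: "nat \<Rightarrow> bool" where
  "whole y \<longleftrightarrow> ((y + r) mod W div q + 1) * q \<le> W"

text \<open>Adds \<open>f\<close> to the residue of \<open>y\<close>. The shifted value \<open>(y + r) mod W\<close> moves within its interval
  \<open>{k * q..<(k + 1) * q}\<close>; nothing happens in the last interval if it is cut off at \<open>W\<close>, so that
  the map is a permutation of \<open>{..<W}\<close>.\<close>

definition shift :: "nat \<Rightarrow> nat \<Rightarrow> nat" where
  "shift y f =
     (let z = (y + r) mod W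
      in ((if W < (z div q + 1) * q then z else z div q * q + (z mod q + f) mod q) + W - r) mod W)"

definition inflow :: "nat \<Rightarrow> (nat \<Rightarrow> nat) \<Rightarrow> nat \<Rightarrow> nat" where
  "inflow b Y p =
     (if used p then
        ((if p mod n = 0 then 0 else residue (Y (p - 1))) +
         (if p div (n * n) = 0 then (if pre p = src then b else 0)
          else residue (Y (last_block (p div (n * n) - 1) (pre p))))) mod q
      else 0)"

text \<open>All intermediate tapes of a forward sweep. The backward sweep passes through the same
  tapes in reverse, so that the single number \<open>c\<close> describes the tape in either
  direction.\<close>

primrec state :: "(nat \<Rightarrow> nat) \<Rightarrow> nat \<Rightarrow> nat \<Rightarrow> (nat \<Rightarrow> nat)" where
  "state X b 0 = X"
| "state X b (Suc c) = (state X b c)(c := shift (X c) (inflow b (state X b c) c))"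

subsection \<open>Shifting a block\<close>

lemma W_pos: "0 < W"
  using q_pos q_le by simp

lemma unshift:
  assumes "z < W"
  shows "((z + W - r) mod W + r) mod W = z"
proof -
  have "((z + W - r) mod W + r) mod W = (z + W - r + r) mod W"
    by (simp add: mod_simps)
  also have "z + W - r + r = z + W"
    using r_less by simp
  finally show ?thesis
    using assms by simp
qed

lemma shift_less: "shift y f < W"
  using W_pos by (simp add: shift_def Let_def)

lemma unshift':
  assumes "y < W"
  shows "((y + r) mod W + W - r) mod W = y"
proof (cases "y + r < W")
  case False
  then have "(y + r) mod W = y + r - W"
    using assms r_less by (simp add: mod_if)
  then show ?thesis
    using False assms by simp
qed (use assms in simp)

lemma shift_0:
  assumes "y < W"
  shows "shift y 0 = y"
  using unshift'[OF assms] by (simp add: shift_def Let_def)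

lemma interval_le:
  assumes "(z div q + 1) * q \<le> W" "f < q"
  shows "z div q * q + f < W"
  using assms by (simp add: algebra_simps)

text \<open>Shifting stays within one interval of length \<open>q\<close>, so both applications fall
  under the same case. For \<open>f = 0\<close> the inverse is a shift by \<open>q\<close>, which is
  the identity as well.\<close>

lemma shift_inverse:
  assumes "y < W" "f < q"
  shows "shift (shift y f) (q - f) = y"
proof -
  define z where "z = (y + r) mod W"
  show ?thesis
  proof (cases "W < (z div q + 1) * q")
    case True
    have "shift y f = (z + W - r) mod W"
      using True by (simp add: shift_def Let_def flip: z_def)
    then have "shift y f = y"
      using unshift'[OF assms(1)] by (simp add: z_def)
    then show ?thesis
      using True unshift'[OF assms(1)] by (simp add: shift_def Let_def flip: z_def)
  next
    case False
    define z' where "z' = z div q * q + (z mod q + f) mod q"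
    have "z' < W"
      unfolding z'_def using False q_pos by (intro interval_le) auto
    have "shift y f = (z' + W - r) mod W"
      using False by (simp add: shift_def Let_def z'_def flip: z_def)
    then have z': "(shift y f + r) mod W = z'"
      using unshift[OF \<open>z' < W\<close>] by simp
    have d: "z' div q = z div q" "z' mod q = (z mod q + f) mod q"
      using q_pos by (simp_all add: z'_def)
    have "((z mod q + f) mod q + (q - f)) mod q = z mod q"
    proof -
      have "((z mod q + f) mod q + (q - f)) mod q = (z mod q + f + (q - f)) mod q"
        by (simp only: mod_add_left_eq[of "z mod q + f"])
      also have "z mod q + f + (q - f) = z mod q + q"
        using assms by simp
      finally show ?thesis
        by simp
    qed
    then have "z' div q * q + (z' mod q + (q - f)) mod q = z"
      using d by simp
    moreover have "\<not> W < (z' div q + 1) * q"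
      using False d(1) by simp
    ultimately have "shift (shift y f) (q - f) = (z + W - r) mod W"
      by (simp only: shift_def[of "shift y f"] z' Let_def if_False)
    then show ?thesis
      using unshift'[OF assms(1)] by (simp add: z_def)
  qed
qed

lemma residue_shift:
  assumes "whole y"
  shows "residue (shift y f) = (residue y + f) mod q"
proof -
  define z where "z = (y + r) mod W"
  define z' where "z' = z div q * q + (z mod q + f) mod q"
  have w: "\<not> W < (z div q + 1) * q"
    using assms by (simp add: whole_def z_def)
  have "z' < W"
    unfolding z'_def using w q_pos by (intro interval_le) auto
  have "shift y f = (z' + W - r) mod W"
    using w by (simp add: shift_def Let_def z'_def flip: z_def)
  then have "(shift y f + r) mod W = z'"
    using unshift[OF \<open>z' < W\<close>] by simp
  then show ?thesis
    using q_pos by (simp add: residue_def z'_def flip: z_def)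
qed

lemma inflow_less: "inflow b Y p < q"
  using q_pos by (simp add: inflow_def)

subsection \<open>Indices\<close>

lemma vert_range: "vert p \<in> {1..n}"
  using n_pos by (simp add: vert_def Suc_le_eq)

lemma pre_range:
  assumes "used p"
  shows "pre p \<in> {1..n}"
proof (cases "p mod n = 0")
  case False
  then have "p mod n - 1 < length (nb (vert p))"
    using assms by (simp add: used_def)
  then have "nb (vert p) ! (p mod n - 1) \<in> set (nb (vert p))"
    by (rule nth_mem)
  then show ?thesis
    using nb_range[OF vert_range, of p] False by (auto simp: pre_def)
qed (use vert_range in \<open>simp add: pre_def\<close>)

lemma index_simps:
  assumes "v \<in> {1..n}" "j < n"
  shows "(start i v + j) mod n = j" "(start i v + j) div (n * n) = i" "vert (start i v + j) = v"
proof -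
  obtain w where w: "v = Suc w" "w < n"
    using assms by (cases v) auto
  have e: "start i v + j = (i * n + w) * n + j"
    by (simp add: start_def w algebra_simps)
  have d: "(start i v + j) div n = i * n + w"
    using assms by (simp add: e)
  show "(start i v + j) mod n = j"
    using assms by (simp add: e)
  show "(start i v + j) div (n * n) = i"
    using w d by (simp add: div_mult2_eq)
  show "vert (start i v + j) = v"
    using w d by (simp add: vert_def)
qed

lemma index_split: "p = start (p div (n * n)) (vert p) + p mod n"
proof -
  define a b c where "a = p div n div n" "b = p div n mod n" "c = p mod n"
  have "p = (a * n + b) * n + c"
    by (simp add: a_b_c_def)
  also have "\<dots> = start a (b + 1) + c"
    by (simp add: start_def algebra_simps)
  finally show ?thesis
    by (simp only: a_b_c_def vert_def div_mult2_eq)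
qed

lemma start_add_less:
  assumes "v \<in> {1..n}" "j < n"
  shows "start i v + j < (i + 1) * (n * n)"
proof -
  have "(v - 1) * n + j < n * n"
  proof -
    have "(v - 1) * n + j < (v - 1) * n + n"
      using assms by simp
    also have "\<dots> = v * n"
      using assms by (cases v) auto
    also have "\<dots> \<le> n * n"
      using assms by simp
    finally show ?thesis .
  qed
  then show ?thesis
    by (simp add: start_def algebra_simps)
qed

lemma last_block_less:
  assumes "v \<in> {1..n}"
  shows "last_block i v < (i + 1) * (n * n)"
  using start_add_less[OF assms nb_length[OF assms]] by (simp add: last_block_def)

lemma last_block_pre_less:
  assumes "used p" "0 < p div (n * n)"
  shows "last_block (p div (n * n) - 1) (pre p) < p"
proof -
  have "last_block (p div (n * n) - 1) (pre p) < p div (n * n) * (n * n)"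
    using last_block_less[OF pre_range[OF assms(1)], of "p div (n * n) - 1"] assms(2) by simp
  also have "\<dots> \<le> p"
    by simp
  finally show ?thesis .
qed

lemma last_block_simps:
  assumes "v \<in> {1..n}"
  shows "last_block i v mod n = length (nb v)" "last_block i v div (n * n) = i" "vert (last_block i v) = v"
    "used (last_block i v)"
  using index_simps[OF assms nb_length[OF assms]] by (simp_all add: last_block_def used_def)

lemma index_pred:
  assumes "0 < p mod n"
  shows "(p - 1) mod n = p mod n - 1" "(p - 1) div (n * n) = p div (n * n)" "vert (p - 1) = vert p"
proof -
  have "p - 1 = start (p div (n * n)) (vert p) + (p mod n - 1)"
    using index_split[of p] assms by linarith
  moreover have "p mod n - 1 < n"
    using n_pos by (simp add: less_imp_diff_less)
  ultimately show "(p - 1) mod n = p mod n - 1" "(p - 1) div (n * n) = p div (n * n)" "vert (p - 1) = vert p"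
    using index_simps[OF vert_range] by metis+
qed

subsection \<open>States\<close>

lemma state_ge: "c \<le> k \<Longrightarrow> state X b c k = X k"
  by (induction c) auto

lemma state_eq:
  assumes "k < c" "c \<le> c'"
  shows "state X b c' k = state X b c k"
  using assms(2,1) by (induction rule: dec_induct) auto

text \<open>Causality: the predecessor in the row and the last block of a vertex in the layer before
  both precede \<open>p\<close>. This allows an inflow to be recomputed from any later tape.\<close>

lemma inflow_cong:
  assumes "\<And>k. k < p \<Longrightarrow> Y k = Y' k"
  shows "inflow b Y p = inflow b Y' p"
proof -
  have "Y (p - 1) = Y' (p - 1)" if "p mod n \<noteq> 0"
    using that by (intro assms) (cases p, auto)
  moreover have "Y (last_block (p div (n * n) - 1) (pre p)) = Y' (last_block (p div (n * n) - 1) (pre p))"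
    if "used p" "p div (n * n) \<noteq> 0"
    using that by (intro assms last_block_pre_less) auto
  ultimately show ?thesis
    by (simp add: inflow_def)
qed

lemma inflow_state: "p \<le> c \<Longrightarrow> inflow b (state X b c) p = inflow b (state X b p) p"
  by (rule inflow_cong) (rule state_eq)

text \<open>A fixed-point equation valid at all later times, not only when block \<open>p\<close>
  was changed. Undoing a block therefore requires the current tape only, both in the backward sweep
  and in the revert routine.\<close>

lemma state_at:
  assumes "p < c"
  shows "state X b c p = shift (X p) (inflow b (state X b c) p)"
proof -
  have "state X b c p = state X b (Suc p) p"
    using assms by (intro state_eq) auto
  also have "\<dots> = shift (X p) (inflow b (state X b p) p)"
    by simp
  also have "inflow b (state X b p) p = inflow b (state X b c) p"
    using assms by (intro inflow_state[symmetric]) auto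
  finally show ?thesis .
qed

lemma state_skip:
  assumes "c \<le> c'" "\<And>k. k \<in> {c..<c'} \<Longrightarrow> \<not> used k" "\<And>k. X k < W"
  shows "state X b c' = state X b c"
  using assms(1,2)
proof (induction c' rule: dec_induct)
  case (step m)
  then have "inflow b (state X b m) m = 0"
    by (simp add: inflow_def)
  then have "state X b (Suc m) = state X b m"
    using assms(3) by (auto simp: fun_eq_iff shift_0 state_ge)
  with step show ?case
    by simp
qed simp

definition succ_block :: "nat \<Rightarrow> nat" where
  "succ_block p = (if p mod n < length (nb (vert p)) then p + 1 else p + (n - p mod n))"

definition pred_block :: "nat \<Rightarrow> nat" where
  "pred_block c = (if 0 < c mod n then c - 1 else c - n + length (nb (vert (c - 1))))"

lemma succ_block:
  assumes "used p"
  shows "p < succ_block p" "used (succ_block p)" "\<And>k. k \<in> {Suc p..<succ_block p} \<Longrightarrow> \<not> used k"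
    "p < n * n * n \<Longrightarrow> succ_block p \<le> n * n * n"
proof -
  note l = nb_length[OF vert_range]
  have m: "p mod n < n"
    using n_pos by simp
  show "p < succ_block p"
    unfolding succ_block_def using m by (auto intro: less_add_same_cancel1[THEN iffD2])
  show "used (succ_block p)"
  proof (cases "p mod n < length (nb (vert p))")
    case True
    then have "Suc (p mod n) < n"
      using l[of p] by simp
    then have "0 < (p + 1) mod n" and m1: "(p + 1) mod n = p mod n + 1"
      by (simp_all add: mod_Suc)
    then show ?thesis
      using True index_pred[of "p + 1"] m1 by (simp add: succ_block_def used_def)
  next
    case False
    have "p + (n - p mod n) = (p div n + 1) * n"
      using m div_mult_mod_eq[of p n] unfolding add_mult_distrib by linarith
    then have "succ_block p mod n = 0"
      using False by (simp add: succ_block_def)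
    then show ?thesis
      by (simp add: used_def)
  qed
  show "\<not> used k" if k: "k \<in> {Suc p..<succ_block p}" for k
  proof -
    have F: "\<not> p mod n < length (nb (vert p))" and k': "p < k" "k < p + (n - p mod n)"
      using k by (auto simp: succ_block_def split: if_splits)
    have "k = start (p div (n * n)) (vert p) + (p mod n + (k - p))"
      using index_split[of p] k' by linarith
    moreover have j: "p mod n + (k - p) < n"
      using k' m by linarith
    ultimately have "k mod n = p mod n + (k - p)" "vert k = vert p"
      using index_simps[OF vert_range j] by metis+
    then show ?thesis
      using F k' by (simp add: used_def)
  qed
  show "succ_block p \<le> n * n * n" if "p < n * n * n"
  proof (cases "p mod n < length (nb (vert p))")
    case False
    have "p + (n - p mod n) = (p div n + 1) * n"
      using m div_mult_mod_eq[of p n] unfolding add_mult_distrib by linarith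
    moreover have "p div n < n * n"
      using that n_pos by (simp add: less_mult_imp_div_less)
    then have "(p div n + 1) * n \<le> n * n * n"
      by (intro mult_le_mono1) auto
    ultimately show ?thesis
      using False by (simp add: succ_block_def)
  qed (use that in \<open>simp add: succ_block_def\<close>)
qed

lemma pred_block:
  assumes "used c" "0 < c"
  shows "pred_block c < c" "used (pred_block c)" "\<And>k. k \<in> {Suc (pred_block c)..<c} \<Longrightarrow> \<not> used k"
proof -
  have "pred_block c < c \<and> used (pred_block c) \<and> (\<forall>k. k \<in> {Suc (pred_block c)..<c} \<longrightarrow> \<not> used k)"
  proof (cases "0 < c mod n")
    case True
    then show ?thesis
      using assms index_pred[OF True] by (auto simp: pred_block_def used_def)
  next
    case False
    let ?v = "vert (c - 1)" and ?i = "(c - 1) div (n * n)"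
    have "n dvd c"
      using False by (simp add: mod_eq_0_iff_dvd)
    then obtain k where k: "c = n * k" ..
    then have cn: "n \<le> c"
      using assms by (cases k) auto
    \<comment> \<open>Here \<open>c\<close> begins a row, so \<open>c - 1\<close> is the last slot
      of the preceding row and identifies its vertex and layer.\<close>
    have "(c - 1) mod n = n - 1"
    proof -
      have "c - 1 = n - 1 + n * (k - 1)"
        using k assms n_pos by (cases k) auto
      then have "(c - 1) mod n = (n - 1) mod n"
        by (simp only: mod_mult_self2)
      then show ?thesis
        using n_pos by simp
    qed
    then have s: "start ?i ?v = c - n"
      using index_split[of "c - 1"] cn n_pos by linarith
    have l: "length (nb ?v) < n"
      by (rule nb_length[OF vert_range])
    have p: "pred_block c = start ?i ?v + length (nb ?v)"
      using False s by (simp add: pred_block_def)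
    have "\<not> used m" if m: "m \<in> {Suc (pred_block c)..<c}" for m
    proof -
      have "m = start ?i ?v + (m - (c - n))" "m - (c - n) < n" "length (nb ?v) < m - (c - n)"
        using m s p cn by auto
      then have "m mod n = m - (c - n)" "vert m = ?v"
        using index_simps[OF vert_range, of "m - (c - n)" ?i "c - 1"] by metis+
      then show ?thesis
        using \<open>length (nb ?v) < m - (c - n)\<close> by (simp add: used_def)
    qed
    moreover have "used (pred_block c)"
      using index_simps[OF vert_range l] by (simp add: p used_def)
    moreover have "pred_block c < c"
      using p s l cn by simp
    ultimately show ?thesis
      by blast
  qed
  then show "pred_block c < c" "used (pred_block c)" "\<And>k. k \<in> {Suc (pred_block c)..<c} \<Longrightarrow> \<not> used k"
    by auto
qed

lemma used_0: "used 0"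
  by (simp add: used_def)

text \<open>The index after the last block counts as used by convention, so that hopping from one
  used index to the next arrives at it exactly and the loop ends there.\<close>

lemma used_top: "used (n * n * n)"
  by (simp add: used_def)

lemma used_start: "v \<in> {1..n} \<Longrightarrow> used (start i v)"
  using index_simps[of v 0 i] n_pos by (simp add: used_def)

text \<open>The source of the factor \<open>n * m\<close> in the running time: each sweep visits the
  used blocks only.\<close>

lemma card_used: "card {k. k < n * n * n \<and> used k} \<le> n * (\<Sum>v = 1..n. length (nb v) + 1)"
proof -
  let ?f = "\<lambda>k. (k div (n * n), vert k, k mod n)"
  let ?T = "{..<n} \<times> (SIGMA v:{1..n}. {..length (nb v)})"
  have "inj_on ?f {k. k < n * n * n \<and> used k}"
  proof (rule inj_onI)
    fix k k'
    assume "?f k = ?f k'"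
    then have "start (k div (n * n)) (vert k) + k mod n = start (k' div (n * n)) (vert k') + k' mod n"
      by simp
    then show "k = k'"
      by (simp only: index_split[symmetric])
  qed
  moreover have "?f ` {k. k < n * n * n \<and> used k} \<subseteq> ?T"
    using vert_range by (auto simp: used_def less_mult_imp_div_less mult.assoc)
  ultimately have "card {k. k < n * n * n \<and> used k} \<le> card ?T"
    by (intro card_inj_on_le) auto
  also have "\<dots> = n * (\<Sum>v = 1..n. length (nb v) + 1)"
    by (simp add: card_cartesian_product)
  finally show ?thesis .
qed

subsection \<open>Soundness\<close>

definition edges :: "nat rel" where
  "edges = {(u, v). v \<in> {1..n} \<and> u \<in> set (nb v)}"

text \<open>Equal ingredients give equal inflows, so a difference stems from the preceding block,
  from the bit at \<open>src\<close>, or from the tail's last block. In each case reachability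
  passes on to \<open>vert p\<close>. Since \<open>q\<close> and \<open>r\<close> are arbitrary, the
  error is one-sided for all coins.\<close>

lemma inflow_differs:
  assumes "inflow 0 Y p \<noteq> inflow b Y' p"
    and IH: "\<And>k. k < p \<Longrightarrow> Y k \<noteq> Y' k \<Longrightarrow> (src, vert k) \<in> edges\<^sup>*"
  shows "(src, vert p) \<in> edges\<^sup>*"
proof -
  have u: "used p"
    using assms(1) by (auto simp: inflow_def split: if_splits)
  have step: "(src, vert p) \<in> edges\<^sup>*" if "(src, pre p) \<in> edges\<^sup>*"
  proof (cases "p mod n = 0")
    case False
    then have "(pre p, vert p) \<in> edges"
      using u vert_range[of p] by (auto simp: edges_def pre_def used_def)
    with that show ?thesis
      by (rule rtrancl_into_rtrancl)
  qed (use that in \<open>simp add: pre_def\<close>)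
  have "0 < p mod n \<and> Y (p - 1) \<noteq> Y' (p - 1) \<or> pre p = src \<or>
      0 < p div (n * n) \<and>
      Y (last_block (p div (n * n) - 1) (pre p)) \<noteq> Y' (last_block (p div (n * n) - 1) (pre p))"
    (is "?A \<or> ?B \<or> ?C")
  proof (rule ccontr)
    assume "\<not> (?A \<or> ?B \<or> ?C)"
    then have "inflow 0 Y p = inflow b Y' p"
      by (auto simp: inflow_def)
    with assms(1) show False ..
  qed
  then consider ?A | ?B | ?C
    by blast
  then show ?thesis
  proof cases
    case 1
    then have "p - 1 < p"
      by (cases p) auto
    then show ?thesis
      using IH[of "p - 1"] 1 index_pred[of p] by simp
  next
    case 2
    then show ?thesis
      using step by simp
  next
    case 3
    then show ?thesis
      using IH[OF last_block_pre_less[OF u conjunct1[OF 3]]] last_block_simps[OF pre_range[OF u]] step by simp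
  qed
qed

text \<open>Both sweeps start from the same \<open>X\<close>, so a block can differ only if its
  inflow does.\<close>

lemma state_differs:
  "state X 0 c k \<noteq> state X b c k \<Longrightarrow> (src, vert k) \<in> edges\<^sup>*"
proof (induction k rule: less_induct)
  case (less k)
  then have "k < c"
    by (metis not_le_imp_less state_ge)
  then have "inflow 0 (state X 0 c) k \<noteq> inflow b (state X b c) k"
    using less.prems state_at by metis
  then show ?case
    using less.IH by (rule inflow_differs)
qed

lemma sound:
  assumes "v \<in> {1..n}" "inflow 0 (state X 0 c) (start i v) \<noteq> inflow b (state X b c) (start i v)"
  shows "(src, v) \<in> edges\<^sup>*"
  using inflow_differs[OF assms(2) state_differs] index_simps[OF assms(1), of 0 i] n_pos by simp

subsection \<open>Completeness\<close>

text \<open>Counts the lazy walks of length \<open>i\<close> from \<open>src\<close> to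
  \<open>v\<close>, decomposed by their last step.\<close>

primrec walks :: "nat \<Rightarrow> nat \<Rightarrow> nat" where
  "walks 0 v = of_bool (v = src)"
| "walks (Suc i) v = walks i v + (\<Sum>u\<leftarrow>nb v. walks i u)"

text \<open>Lazy walks of length \<open>i + 1\<close> to \<open>v\<close> whose last step uses a
  lazy arc up to that of block \<open>p\<close>. At the last block of a row this is
  \<open>walks (Suc i) v\<close>, at the first one \<open>walks i v\<close>.\<close>

definition walks_upto :: "nat \<Rightarrow> nat" where
  "walks_upto p =
     walks (p div (n * n)) (vert p) + (\<Sum>u\<leftarrow>take (p mod n) (nb (vert p)). walks (p div (n * n)) u)"

text \<open>The two ingredients of the inflow differ by \<open>walks_upto (p - 1)\<close> and by the
  number of walks to the tail \<open>pre p\<close>; the latter is exactly what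
  \<open>walks_upto\<close> gains from \<open>p - 1\<close> to \<open>p\<close>.\<close>

lemma inflow_walks:
  assumes "used p"
    and "0 < p mod n \<Longrightarrow> [residue (Y' (p - 1)) = residue (Y (p - 1)) + walks_upto (p - 1)] (mod q)"
    and "0 < p div (n * n) \<Longrightarrow>
      [residue (Y' (last_block (p div (n * n) - 1) (pre p))) =
       residue (Y (last_block (p div (n * n) - 1) (pre p))) +
       walks_upto (last_block (p div (n * n) - 1) (pre p))] (mod q)"
  shows "[inflow 1 Y' p = inflow 0 Y p + walks_upto p] (mod q)"
proof -
  let ?i = "p div (n * n)"
  define a where "a Y = (if p mod n = 0 then 0 else residue (Y (p - 1)))" for Y
  define d where "d = (if p mod n = 0 then 0 else walks_upto (p - 1))"
  define a' where "a' b Y = (if ?i = 0 then if pre p = src then b else 0 else residue (Y (last_block (?i - 1) (pre p))))"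
    for b :: nat and Y
  have 1: "[a Y' = a Y + d] (mod q)"
    using assms(2) by (simp add: a_def d_def)
  have 2: "[a' 1 Y' = a' 0 Y + walks ?i (pre p)] (mod q)"
  proof (cases "?i = 0")
    case False
    have "walks_upto (last_block (?i - 1) (pre p)) = walks (Suc (?i - 1)) (pre p)"
      using last_block_simps[OF pre_range[OF assms(1)]] by (simp add: walks_upto_def)
    then show ?thesis
      using assms(3) False by (simp add: a'_def)
  qed (simp add: a'_def)
  have 3: "walks_upto p = d + walks ?i (pre p)"
  proof (cases "p mod n = 0")
    case False
    then have j: "p mod n = Suc (p mod n - 1)" "p mod n - 1 < length (nb (vert p))"
      using assms(1) by (auto simp: used_def)
    have "take (p mod n) (nb (vert p)) = take (p mod n - 1) (nb (vert p)) @ [pre p]"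
      using j False take_Suc_conv_app_nth[OF j(2)] by (simp add: pre_def)
    then show ?thesis
      using False index_pred[of p] by (simp add: walks_upto_def d_def)
  qed (simp add: walks_upto_def d_def pre_def)
  have c: "[inflow b Y p = a Y + a' b Y] (mod q)" for b Y
    using assms(1) by (simp add: inflow_def a_def a'_def cong_def)
  have "[inflow 1 Y' p = a Y' + a' 1 Y'] (mod q)"
    by (rule c)
  also have "[a Y' + a' 1 Y' = a Y + a' 0 Y + (d + walks ?i (pre p))] (mod q)"
    using cong_add[OF 1 2] by (simp add: add_ac)
  also have "[a Y + a' 0 Y + (d + walks ?i (pre p)) = inflow 0 Y p + (d + walks ?i (pre p))] (mod q)"
    by (intro cong_add cong_refl cong_sym[OF c])
  finally show ?thesis
    by (simp only: 3)
qed

text \<open>In whole intervals a shift adds its amount to the residue. The unknown initial residue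
  is the same in both sweeps and cancels, which leaves the walk count.\<close>

lemma residue_state_walks:
  assumes "\<And>k. k < c \<Longrightarrow> whole (X k)" "p < c" "used p"
  shows "[residue (state X 1 c p) = residue (state X 0 c p) + walks_upto p] (mod q)"
  using assms(2,3)
proof (induction p rule: less_induct)
  case (less p)
  have "[inflow 1 (state X 1 c) p = inflow 0 (state X 0 c) p + walks_upto p] (mod q)"
  proof (rule inflow_walks)
    show "used p"
      by fact
    show "[residue (state X 1 c (p - 1)) = residue (state X 0 c (p - 1)) + walks_upto (p - 1)] (mod q)"
      if "0 < p mod n"
    proof (rule less.IH)
      show "p - 1 < p" "p - 1 < c"
        using that less.prems by (cases p; auto)+
      show "used (p - 1)"
        using index_pred[OF that] less.prems by (simp add: used_def)
    qed
    let ?l = "last_block (p div (n * n) - 1) (pre p)"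
    show "[residue (state X 1 c ?l) = residue (state X 0 c ?l) + walks_upto ?l] (mod q)"
      if "0 < p div (n * n)"
    proof (rule less.IH)
      show "?l < p"
        by (rule last_block_pre_less) (use that less.prems in auto)
      then show "?l < c"
        using less.prems by simp
      show "used ?l"
        using last_block_simps pre_range less.prems by blast
    qed
  qed
  note inflow = this
  have residue: "[residue (state X b c p) = residue (X p) + inflow b (state X b c) p] (mod q)" for b
    using state_at[OF less.prems(1)] assms(1)[OF less.prems(1)] by (simp add: residue_shift cong_def)
  have "[residue (state X 1 c p) = residue (X p) + inflow 1 (state X 1 c) p] (mod q)"
    by (rule residue)
  also have "[residue (X p) + inflow 1 (state X 1 c) p =
      residue (X p) + (inflow 0 (state X 0 c) p + walks_upto p)] (mod q)"
    by (intro cong_add cong_refl inflow)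
  also have "residue (X p) + (inflow 0 (state X 0 c) p + walks_upto p) =
      residue (X p) + inflow 0 (state X 0 c) p + walks_upto p"
    by simp
  also have "[\<dots> = residue (state X 0 c p) + walks_upto p] (mod q)"
    by (intro cong_add cong_refl cong_sym[OF residue])
  finally show ?case .
qed

text \<open>At the first block of \<open>v\<close> in the fictitious layer \<open>n\<close>,
  \<open>walks_upto\<close> is \<open>walks n v\<close>; equal inflows would make it vanish modulo
  \<open>q\<close>.\<close>

lemma complete:
  assumes "\<And>k. k < n * n * n \<Longrightarrow> whole (X k)" "v \<in> {1..n}" "\<not> q dvd walks n v"
  shows "inflow 0 (state X 0 (n * n * n)) (start n v) \<noteq> inflow 1 (state X 1 (n * n * n)) (start n v)"
proof
  let ?c = "n * n * n"
  assume eq: "inflow 0 (state X 0 ?c) (start n v) = inflow 1 (state X 1 ?c) (start n v)"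
  have s: "start n v mod n = 0" "start n v div (n * n) = n" "vert (start n v) = v"
    using index_simps[OF assms(2), of 0 n] n_pos by simp_all
  then have p: "pre (start n v) = v"
    by (simp add: pre_def)
  have "[inflow 1 (state X 1 ?c) (start n v) =
      inflow 0 (state X 0 ?c) (start n v) + walks_upto (start n v)] (mod q)"
  proof (rule inflow_walks)
    show "used (start n v)"
      by (rule used_start) fact
    let ?l = "last_block (n - 1) v"
    have "?l < ?c"
      using last_block_less[OF assms(2), of "n - 1"] n_pos by (simp add: mult.assoc)
    then have "[residue (state X 1 ?c ?l) = residue (state X 0 ?c ?l) + walks_upto ?l] (mod q)"
      using assms by (intro residue_state_walks last_block_simps) auto
    then show "[residue (state X 1 ?c (last_block (start n v div (n * n) - 1) (pre (start n v)))) =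
       residue (state X 0 ?c (last_block (start n v div (n * n) - 1) (pre (start n v)))) +
       walks_upto (last_block (start n v div (n * n) - 1) (pre (start n v)))] (mod q)"
      by (simp add: s p)
  qed (simp add: s)
  then have "[inflow 0 (state X 0 ?c) (start n v) + walks n v = inflow 0 (state X 0 ?c) (start n v) + 0] (mod q)"
    by (simp add: eq s walks_upto_def cong_sym_eq)
  then have "[walks n v = 0] (mod q)"
    by (simp only: cong_add_lcancel_nat)
  then show False
    using assms(3) by (simp add: cong_0_iff)
qed

text \<open>Each vertex has at most \<open>n\<close> incoming lazy arcs, staying included.\<close>

lemma walks_le: "v \<in> {1..n} \<Longrightarrow> walks i v \<le> n ^ i"
proof (induction i arbitrary: v)
  case (Suc i)
  have "(\<Sum>u\<leftarrow>nb v. walks i u) \<le> (\<Sum>u\<leftarrow>nb v. n ^ i)"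
    using nb_range[OF Suc.prems] by (intro sum_list_mono Suc.IH) auto
  also have "\<dots> = length (nb v) * n ^ i"
    by (simp add: sum_list_triv)
  finally have "walks (Suc i) v \<le> (1 + length (nb v)) * n ^ i"
    using Suc.IH[OF Suc.prems] by simp
  also have "\<dots> \<le> n * n ^ i"
    using nb_length[OF Suc.prems] by (intro mult_le_mono1) simp
  finally show ?case
    by simp
qed simp

text \<open>Staying lengthens a walk, so a path with fewer than \<open>n\<close> arcs is still
  counted after \<open>n\<close> layers.\<close>

lemma walks_mono: "i \<le> j \<Longrightarrow> walks i v \<le> walks j v"
  by (rule lift_Suc_mono_le[of "\<lambda>i. walks i v"]) auto

lemma walks_step: "u \<in> set (nb v) \<Longrightarrow> walks i u \<le> walks (Suc i) v"
  by (simp add: member_le_sum_list trans_le_add2)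

end

section \<open>Numbers on the tape\<close>

primrec number :: "(nat \<Rightarrow> bool) \<Rightarrow> nat \<Rightarrow> nat \<Rightarrow> nat" where
  "number a p 0 = 0"
| "number a p (Suc w) = of_bool (a p) + 2 * number a (Suc p) w"

definition block :: "nat \<Rightarrow> (nat \<Rightarrow> bool) \<Rightarrow> nat \<Rightarrow> nat" where
  "block w a k = number a (k * w) w"

lemma number_less: "number a p w < 2 ^ w"
proof (induction w arbitrary: p)
  case (Suc w)
  then have "number a (Suc p) w + 1 \<le> 2 ^ w"
    by (simp add: Suc_le_eq)
  then show ?case
    by (auto simp: of_bool_def)
qed simp

lemma number_cong: "(\<And>i. i < w \<Longrightarrow> a (p + i) = a' (p + i)) \<Longrightarrow> number a p w = number a' p w"
proof (induction w arbitrary: p)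
  case (Suc w)
  have "a p = a' p"
    using Suc.prems[of 0] by simp
  moreover have "number a (Suc p) w = number a' (Suc p) w"
    using Suc.prems[of "Suc i" for i] by (intro Suc.IH) simp
  ultimately show ?case
    by simp
qed simp

lemma number_bits: "(\<And>i. i < w \<Longrightarrow> a (p + i) = odd (y div 2 ^ i)) \<Longrightarrow> number a p w = y mod 2 ^ w"
proof (induction w arbitrary: p y)
  case (Suc w)
  have "a p = odd y"
    using Suc.prems[of 0] by simp
  moreover have "number a (Suc p) w = y div 2 mod 2 ^ w"
  proof (rule Suc.IH)
    fix i
    assume "i < w"
    then show "a (Suc p + i) = odd (y div 2 div 2 ^ i)"
      using Suc.prems[of "Suc i"] by (simp add: div_mult2_eq)
  qed
  ultimately show ?case
    by (simp add: mod_mult2_eq mod2_eq_if)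
qed simp

lemma number_bit: "i < w \<Longrightarrow> odd (number a p w div 2 ^ i) = a (p + i)"
proof (induction w arbitrary: p i)
  case (Suc w)
  show ?case
  proof (cases i)
    case (Suc j)
    have "number a p (Suc w) div 2 ^ i = number a (Suc p) w div 2 ^ j"
      by (simp add: Suc div_mult2_eq)
    then show ?thesis
      using Suc.IH[of j "Suc p"] Suc \<open>i < Suc w\<close> by simp
  qed simp
qed simp

lemma block_bit: "0 < w \<Longrightarrow> odd (block w a (i div w) div 2 ^ (i mod w)) = a i"
  by (simp add: block_def number_bit)

lemma block_less: "block w a k < 2 ^ w"
  by (simp add: block_def number_less)

lemma block_inject:
  assumes "0 < w" "\<And>k. block w a k = block w a' k"
  shows "a = a'"
proof
  fix i
  show "a i = a' i"
    using block_bit[OF assms(1), of a i] block_bit[OF assms(1), of a' i] assms(2) by simp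
qed

lemma block_cong:
  assumes "\<And>i. i div w = k \<Longrightarrow> a i = a' i"
  shows "block w a k = block w a' k"
  unfolding block_def by (intro number_cong assms) simp

section \<open>Straight-line code\<close>

primrec code :: "instr list \<Rightarrow> com" where
  "code [] = Skip"
| "code (i # is) = Do i ;; code is"

declare code.simps [simp del]

fun dest :: "instr \<Rightarrow> nat" where
  "dest (Const r k) = r"
| "dest (Arith g r p q) = r"
| "dest (Ask s r p q) = r"
| "dest _ = 0"

fun val :: "stcon_input \<Rightarrow> instr \<Rightarrow> (nat \<Rightarrow> nat) \<Rightarrow> nat" where
  "val x (Const r k) f = k"
| "val x (Arith g r p q) f = apply_arith g (f p) (f q)"
| "val x (Ask s r p q) f = answer x s (f p) (f q)"
| "val x _ f = 0"

fun pure :: "instr \<Rightarrow> bool" where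
  "pure (Const r k) = True"
| "pure (Arith g r p q) = True"
| "pure (Ask s r p q) = True"
| "pure _ = False"

text \<open>Symbolic execution that the simplifier can carry out: unfolding it leaves the final
  register function and the side conditions under which the invariant survives, namely destinations
  in \<open>V\<close> and values up to \<open>M\<close>.\<close>

fun straight ::
    "stcon_input \<Rightarrow> nat set \<Rightarrow> nat \<Rightarrow> instr list \<Rightarrow> (nat \<Rightarrow> nat) \<Rightarrow> ((nat \<Rightarrow> nat) \<Rightarrow> bool) \<Rightarrow> bool" where
  "straight x V M [] f Q = Q f"
| "straight x V M (i # is) f Q =
     (pure i \<and> dest i \<in> V \<and> val x i f \<le> M \<and>
      straight x V M is (f(dest i := val x i f)) Q)"

lemma straight_mono: "straight x V M is f R \<Longrightarrow> (\<And>f'. R f' \<Longrightarrow> Q f') \<Longrightarrow> straight x V M is f Q"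
  by (induction "is" arbitrary: f) auto

definition agree :: "nat set \<Rightarrow> (nat \<Rightarrow> nat) \<Rightarrow> (nat \<Rightarrow> nat) \<Rightarrow> bool" where
  "agree V f f' \<longleftrightarrow> (\<forall>r. r \<notin> V \<longrightarrow> f' r = f r)"

text \<open>\<open>J\<close> is kept abstract because the same code runs under different invariants:
  \<open>blank\<close> before the sweeps, \<open>inv\<close> during them, and a frozen tape in the
  revert routine.\<close>

locale scratch =
  fixes x :: stcon_input and J :: assn and S M :: nat and V :: "nat set"
  assumes J_scratch: "J f a out \<Longrightarrow> k \<in> V \<Longrightarrow> v \<le> M \<Longrightarrow> J (f(k := v)) a out"
begin

lemmas tri_If_J = tri_If[where J = J and x = x and S = S]

lemma tri_pure:
  assumes "pure i" "J f a out" "Q (f(dest i := val x i f)) a out"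
  shows "tri x J S (Do i) 1 f a out Q"
  using assms by (cases i) (auto intro: tri_Const tri_Arith tri_Ask simp del: One_nat_def)

lemma tri_code:
  assumes "J f a out" "straight x V M is f (\<lambda>f'. J f' a out \<longrightarrow> Q f' a out)"
  shows "tri x J S (code is) (length is) f a out Q"
  using assms
proof (induction "is" arbitrary: f)
  case Nil
  then show ?case
    by (simp add: tri_Skip code.simps)
next
  case (Cons i "is")
  have J: "J (f(dest i := val x i f)) a out"
    using Cons.prems by (intro J_scratch) auto
  have "tri x J S (code is) (length is) (f(dest i := val x i f)) a out Q"
    by (rule Cons.IH[OF J]) (use Cons.prems in \<open>simp only: straight.simps\<close>)
  then have "tri x J S (Do i ;; code is) (1 + length is) f a out Q"
    using Cons.prems by (intro tri_Seq tri_pure) simp_all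
  then show ?case
    by (simp add: code.simps)
qed

lemma tri_code_Seq:
  assumes "J f a out" "straight x V M is f (\<lambda>f'. J f' a out \<longrightarrow> tri x J S c t f' a out Q)"
  shows "tri x J S (code is ;; c) (length is + t) f a out Q"
  using assms by (intro tri_Seq tri_code)

lemma tri_code_SeqI:
  assumes "J f a out" "straight x V M is f R" "\<And>f'. J f' a out \<Longrightarrow> R f' \<Longrightarrow> tri x J S c t f' a out Q"
  shows "tri x J S (code is ;; c) (length is + t) f a out Q"
  using assms(1) by (rule tri_code_Seq) (rule straight_mono[OF assms(2)], use assms(3) in blast)

lemma tri_codeI:
  assumes "J f a out" "straight x V M is f R" "\<And>f'. J f' a out \<Longrightarrow> R f' \<Longrightarrow> Q f' a out"
    "length is \<le> t"
  shows "tri x J S (code is) t f a out Q"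
  by (rule tri_time[OF tri_code, OF assms(1) _ assms(4)])
    (rule straight_mono[OF assms(2)], use assms(3) in blast)

lemma tri_CatRead_scratch:
  assumes "J f a out" "f p < S" "k \<in> V" "1 \<le> M"
    and "J (f(k := of_bool (a (f p)))) a out \<Longrightarrow> Q (f(k := of_bool (a (f p)))) a out"
  shows "tri x J S (Do (CatRead k p)) 1 f a out Q"
proof -
  have "J (f(k := of_bool (a (f p)))) a out"
    using assms by (intro J_scratch) (auto simp: of_bool_def)
  then show ?thesis
    using assms by (intro tri_CatRead)
qed

end

section \<open>Computing with blocks\<close>

text \<open>Registers 0 to 9 hold all that determines the meaning of the tape; these are the ones
  that the revert routine takes over from a paused run. Registers 10 to 59 are scratch space, which
  the invariant of the sweeps only bounds.\<close>

abbreviation (input) "rN \<equiv> 0 :: nat"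
abbreviation (input) "rNN \<equiv> 1 :: nat"
abbreviation (input) "rB \<equiv> 2 :: nat"
abbreviation (input) "rW \<equiv> 3 :: nat"
abbreviation (input) "rQ \<equiv> 4 :: nat"
abbreviation (input) "rR \<equiv> 5 :: nat"
abbreviation (input) "rBit \<equiv> 6 :: nat"
abbreviation (input) "rC \<equiv> 7 :: nat"
abbreviation (input) "rK \<equiv> 8 :: nat"
abbreviation (input) "rH \<equiv> 9 :: nat"
abbreviation (input) "rOne \<equiv> 10 :: nat"
abbreviation (input) "rTwo \<equiv> 11 :: nat"
abbreviation (input) "rZero \<equiv> 12 :: nat"
abbreviation (input) "rTop \<equiv> 13 :: nat"
abbreviation (input) "rP \<equiv> 14 :: nat"
abbreviation (input) "rF \<equiv> 15 :: nat"
abbreviation (input) "rk \<equiv> 20 :: nat"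
abbreviation (input) "ra \<equiv> 21 :: nat"
abbreviation (input) "re \<equiv> 22 :: nat"
abbreviation (input) "ry \<equiv> 23 :: nat"
abbreviation (input) "rX \<equiv> 24 :: nat"
abbreviation (input) "rOld \<equiv> 25 :: nat"
abbreviation (input) "rj \<equiv> 26 :: nat"
abbreviation (input) "ri \<equiv> 27 :: nat"
abbreviation (input) "rv \<equiv> 28 :: nat"
abbreviation (input) "rd \<equiv> 29 :: nat"
abbreviation (input) "ru \<equiv> 30 :: nat"
abbreviation (input) "rt \<equiv> 31 :: nat"

text \<open>Horner's scheme from the most significant bit down, since blocks are stored with the
  least significant bit first.\<close>

definition read_block :: com where
  "read_block =
     code [Arith Mult ra rk rB, Arith Add re ra rB, Const rX 0] ;;
     WhileLess ra re
       (code [Arith Sub re re rOne] ;; Do (CatRead ry re) ;;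
        code [Arith Add rX rX rX, Arith Add rX rX ry])"

definition read_residue :: com where
  "read_residue = read_block ;; code [Arith Add rX rX rR, Arith Mod rX rX rW, Arith Mod rX rX rQ]"

definition calc_inflow :: com where
  "calc_inflow =
     code [Arith Mod rj rP rN, Arith Div ri rP rNN, Arith Div rv rP rN, Arith Mod rv rv rN,
           Arith Add rv rv rOne, Ask In_Degree rd rv rv, Const rF 0] ;;
     IfLess rd rj Skip
       (IfLess rZero rj
          (code [Ask In_Nbr ru rv rj, Arith Sub rk rP rOne] ;; read_residue ;;
           code [Arith Add rF rX rZero])
          (code [Arith Add ru rv rZero]) ;;
        IfLess rZero ri
          (code [Ask In_Degree rd ru ru, Arith Sub ri ri rOne, Arith Mult rk ri rNN,
                 Arith Sub ru ru rOne, Arith Mult ru ru rN, Arith Add rk rk ru, Arith Add rk rk rd] ;;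
           read_residue ;; code [Arith Add rF rF rX])
          (code [Ask Source rd rZero rZero] ;;
           IfLess ru rd Skip (IfLess rd ru Skip (code [Arith Add rF rF rBit]))) ;;
        code [Arith Mod rF rF rQ])"

text \<open>Both the old and the new content are delivered, in \<open>rOld\<close> and
  \<open>rX\<close>: the original content of the block is the former in the forward and the latter
  in the backward sweep.\<close>

definition calc_shift :: com where
  "calc_shift =
     code [Arith Add rk rP rZero] ;; read_block ;;
     code [Arith Add rOld rX rZero, Arith Add rX rX rR, Arith Mod rX rX rW, Arith Div rt rX rQ,
           Arith Add ru rt rOne, Arith Mult ru ru rQ] ;;
     IfLess rW ru Skip
       (code [Arith Mod rX rX rQ, Arith Add rX rX rF, Arith Mod rX rX rQ, Arith Mult rt rt rQ,
              Arith Add rX rt rX]) ;;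
     code [Arith Add rX rX rW, Arith Sub rX rX rR, Arith Mod rX rX rW]"

text \<open>\<open>M\<close> bounds all intermediate results: \<open>S\<close> is for tape
  addresses, \<open>4 * W\<close> for sums of block contents, and \<open>4 * (n * n * n)\<close> for
  block indices including those of layer \<open>n\<close>.\<close>

locale machine = grid n q r W nb src + scratch x J S M "{10..<60}"
  for n q r W nb src x J S M +
  fixes w :: nat
  assumes n_def: "vertex_count x = n" and nb_def: "in_nbrs x = nb" and src_def: "source x = src"
    and W_def: "W = 2 ^ w" and S_def: "S = n * n * n * w"
    and M_bounds: "S \<le> M" "4 * W \<le> M" "4 * (n * n * n) \<le> M" and src_le: "src \<le> n"
begin

definition ready :: "(nat \<Rightarrow> nat) \<Rightarrow> bool" where
  "ready f \<longleftrightarrow> f rN = n \<and> f rNN = n * n \<and> f rB = w \<and> f rW = W \<and> f rQ = q \<and> f rR = r \<and>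
     f rBit \<le> 1 \<and> f rOne = 1 \<and> f rTwo = 2 \<and> f rZero = 0"

lemma readyD:
  assumes "ready f"
  shows "f rN = n" "f (Suc 0) = n * n" "f rB = w" "f rW = W" "f rQ = q" "f rR = r" "f rBit \<le> 1"
    "f rOne = 1" "f rTwo = 2" "f rZero = 0"
  using assms by (simp_all add: ready_def)

lemma ready_agree:
  assumes "ready f" "agree V f f'" "V \<inter> {..<13} = {}"
  shows "ready f'"
proof -
  have "f' k = f k" if "k < 13" for k
    using assms(2,3) that by (auto simp: agree_def disjoint_iff)
  then show ?thesis
    using assms(1) by (simp add: ready_def)
qed

lemma M_1: "1 \<le> M"
  using M_bounds(2) W_pos by simp

lemma tri_read_block:
  assumes J: "J f a out" and f: "ready f" "f rk < n * n * n"
    and Q: "\<And>f'. J f' a out \<Longrightarrow> agree {ra, re, ry, rX} f f' \<Longrightarrow> f' rX = block w a (f rk) \<Longrightarrow> Q f' a out"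
  shows "tri x J S read_block (6 * w + 5) f a out Q"
proof -
  define k where "k = f rk"
  have "(k + 1) * w \<le> n * n * n * w"
    using f by (intro mult_le_mono1) (simp add: k_def)
  then have kw: "k * w + w \<le> S"
    by (simp add: S_def)
  define I where "I f' a' out' \<longleftrightarrow> J f' a' out' \<and> a' = a \<and> out' = out \<and> agree {ra, re, ry, rX} f f' \<and>
      f' ra = k * w \<and> k * w \<le> f' re \<and> f' re \<le> k * w + w \<and>
      f' rX = number a (f' re) (k * w + w - f' re)" for f' a' out'
  have body: "J f' a' out' \<and> tri x J S (code [Arith Sub re re rOne] ;; Do (CatRead ry re) ;;
        code [Arith Add rX rX rX, Arith Add rX rX ry]) 4 f' a' out'
      (\<lambda>f'' a' out'. I f'' a' out' \<and> f'' re - f'' ra < f' re - f' ra)"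
    if I: "I f' a' out'" and less: "f' ra < f' re" for f' a' out'
  proof -
    have [simp]: "f' rOne = 1" "f' ra = k * w" "a' = a" "out' = out"
      using I f by (auto simp: I_def agree_def ready_def)
    define e where "e = f' re - 1"
    have e: "f' re = Suc e" "k * w \<le> e" "e < k * w + w"
      using I less by (auto simp: I_def e_def)
    have num: "number a e (k * w + w - e) = of_bool (a e) + 2 * f' rX"
    proof -
      have "k * w + w - e = Suc (k * w + w - Suc e)"
        using e by simp
      then show ?thesis
        using I e by (simp add: I_def)
    qed
    have "number a e (k * w + w - e) < 2 ^ (k * w + w - e)"
      by (rule number_less)
    also have "\<dots> \<le> 2 ^ w"
      using e by (intro power_increasing) auto
    finally have num_le: "number a e (k * w + w - e) \<le> M"
      using M_bounds(2) by (simp add: W_def)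
    have "J f' a' out'"
      using I by (simp add: I_def)
    moreover have "tri x J S (code [Arith Sub re re rOne] ;; Do (CatRead ry re) ;;
        code [Arith Add rX rX rX, Arith Add rX rX ry]) 4 f' a' out'
      (\<lambda>f'' a' out'. I f'' a' out' \<and> f'' re - f'' ra < f' re - f' ra)"
      apply (rule tri_time)
       apply (rule tri_code_Seq)
      subgoal using I by (simp add: I_def)
       apply (use e kw M_bounds in \<open>simp\<close>)
       apply (intro impI, rule tri_Seq, rule tri_CatRead_scratch, assumption)
      using e kw apply simp
        apply simp
       apply (rule M_1)
       apply (rule tri_code, assumption)
      using num num_le I e less apply (auto simp: I_def agree_def)
      done
    ultimately show ?thesis ..
  qed
  show ?thesis
    unfolding read_block_def
    apply (rule tri_time)
     apply (rule tri_code_Seq[OF J])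
     apply (use f kw M_bounds in \<open>simp add: ready_def flip: k_def\<close>)
     apply (intro impI)
     apply (rule tri_While[where I = I and \<mu> = "\<lambda>f. f re - f ra" and t = 4, OF _ _ _ _ refl])
    subgoal by (rule body)
    subgoal for f' a' out'
      by (rule conjI; (simp add: I_def; fail)?) (auto simp: I_def block_def intro!: Q simp flip: k_def)
    subgoal by (auto simp: I_def)
    subgoal by (simp add: I_def agree_def)
    by simp
qed

lemma residue_less: "residue y < q"
  using q_pos by (simp add: residue_def)

lemma tri_read_residue:
  assumes J: "J f a out" and f: "ready f" "f rk < n * n * n"
    and Q: "\<And>f'. J f' a out \<Longrightarrow> agree {ra, re, ry, rX} f f' \<Longrightarrow> f' rX = residue (block w a (f rk)) \<Longrightarrow>
      Q f' a out"
  shows "tri x J S read_residue (6 * w + 8) f a out Q"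
  unfolding read_residue_def
proof (rule tri_time)
  show "tri x J S (read_block ;; code [Arith Add rX rX rR, Arith Mod rX rX rW, Arith Mod rX rX rQ])
      (6 * w + 5 + 3) f a out Q"
  proof (rule tri_Seq, rule tri_read_block[OF J f])
    fix f'
    assume f': "J f' a out" "agree {ra, re, ry, rX} f f'" "f' rX = block w a (f rk)"
    then have ready: "ready f'"
      using f by (auto intro: ready_agree)
    let ?z = "block w a (f rk) + r"
    have "?z \<le> M" "?z mod W \<le> M" "?z mod W mod q \<le> M"
    proof -
      show z: "?z \<le> M"
        using block_less[of w a "f rk"] r_less M_bounds(2) by (simp flip: W_def)
      then show "?z mod W \<le> M"
        using mod_less_eq_dividend order_trans by blast
      then show "?z mod W mod q \<le> M"
        using mod_less_eq_dividend order_trans by blast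
    qed
    then show "tri x J S (code [Arith Add rX rX rR, Arith Mod rX rX rW, Arith Mod rX rX rQ]) 3 f' a out Q"
      using f'
      by (intro tri_time[OF tri_code]) (auto simp: readyD[OF ready] residue_def agree_def intro!: Q)
  qed
qed simp

lemma answers:
  assumes "v \<in> {1..n}"
  shows "answer x In_Degree v i = length (nb v)"
    and "1 \<le> j \<Longrightarrow> j \<le> length (nb v) \<Longrightarrow> answer x In_Nbr v j = nb v ! (j - 1)"
  using assms by (auto simp: n_def nb_def list_nth1_def)

lemma n_le_M: "n \<le> M" "2 * n \<le> M" "n * n \<le> M" "2 * (n * n * n) \<le> M" "n * n \<le> n * n * n"
proof -
  have "n * 1 \<le> n * n" "n * n * 1 \<le> n * n * n"
    using n_pos by (intro mult_le_mono2; simp)+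
  then show "n \<le> M" "2 * n \<le> M" "n * n \<le> M" "2 * (n * n * n) \<le> M" "n * n \<le> n * n * n"
    using M_bounds(3) by linarith+
qed

lemma q_le_M: "2 * q \<le> M"
  using q_le M_bounds(2) by simp

text \<open>The second alternative for \<open>p\<close> covers the fictitious layer
  \<open>n\<close>. There \<open>p mod n = 0\<close>, so block \<open>p - 1\<close>, which may lie
  outside the tape, is not read.\<close>

lemma tri_calc_inflow:
  assumes J: "J f a out" and f: "ready f" "f rP = p"
    and p: "p < n * n * n \<or> p mod n = 0 \<and> p < (n + 1) * (n * n)"
    and Q: "\<And>f'. J f' a out \<Longrightarrow> agree {rF, rk, ra, re, ry, rX, rj, ri, rv, rd, ru} f f' \<Longrightarrow>
      f' rF = inflow (f rBit) (block w a) p \<Longrightarrow> Q f' a out"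
  shows "tri x J S calc_inflow (12 * w + 60) f a out Q"
proof -
  let ?V = "{rF, rk, ra, re, ry, rX, rj, ri, rv, rd, ru}"
  let ?i = "p div (n * n)" and ?j = "p mod n"
  define F0 where "F0 = (if ?j = 0 then 0 else residue (block w a (p - 1)))"
  define F1 where "F1 = (if ?i = 0 then if pre p = src then f rBit else 0
    else residue (block w a (last_block (?i - 1) (pre p))))"
  define R where "R f' a' out' \<longleftrightarrow> J f' a' out' \<and> a' = a \<and> out' = out \<and> agree ?V f f' \<and>
    f' rF = inflow (f rBit) (block w a) p" for f' a' out'
  have R_I: "R f' a out"
    if "J f' a out" "agree ?V f f'" "f' rF = inflow (f rBit) (block w a) p" for f'
    using that by (simp add: R_def)
  have p_le: "p \<le> M"
  proof -
    have "(n + 1) * (n * n) = n * n * n + n * n"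
      by (simp add: algebra_simps)
    then have "p < n * n * n + n * n"
      using p by auto
    then show ?thesis
      using n_le_M M_bounds(3) by linarith
  qed
  have i_le: "?i \<le> n"
  proof -
    have "p < (n + 1) * (n * n)"
      using p by (auto simp: algebra_simps)
    then have "?i < n + 1"
      by (rule less_mult_imp_div_less)
    then show ?thesis
      by simp
  qed
  \<comment> \<open>The pieces \<open>final\<close>, \<open>second\<close>, \<open>first\<close>,
    \<open>rest\<close> are verified from the end of the code towards its beginning, since the rule
    for \<open>;;\<close> takes the remaining code as postcondition.\<close>
  have final: "tri x J S (code [Arith Mod rF rF rQ]) (Suc 0) f' a out R"
    if "used p" "J f' a out" "agree ?V f f'" "f' rF = F0 + F1" for f'
  proof (rule tri_time[OF tri_code])
    have "ready f'"
      using f(1) that(3) by (rule ready_agree) auto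
    moreover have "(F0 + F1) mod q = inflow (f rBit) (block w a) p"
      using that(1) by (simp add: inflow_def F0_def F1_def)
    moreover have "(F0 + F1) mod q \<le> M"
      using mod_less_divisor[OF q_pos, of "F0 + F1"] q_le_M by linarith
    ultimately show "straight x {10..<60} M [Arith Mod rF rF rQ] f' (\<lambda>f'. J f' a out \<longrightarrow> R f' a out)"
      using that by (auto simp: readyD[OF \<open>ready f'\<close>] agree_def intro!: R_I)
  qed (use that in auto)
  have second: "tri x J S (IfLess rZero ri
          (code [Ask In_Degree rd ru ru, Arith Sub ri ri rOne, Arith Mult rk ri rNN,
                 Arith Sub ru ru rOne, Arith Mult ru ru rN, Arith Add rk rk ru, Arith Add rk rk rd] ;;
           read_residue ;; code [Arith Add rF rF rX])
          (code [Ask Source rd rZero rZero] ;;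
           IfLess ru rd Skip (IfLess rd ru Skip (code [Arith Add rF rF rBit]))) ;;
        code [Arith Mod rF rF rQ]) (6 * w + 25) f' a out R"
    if u: "used p" and J': "J f' a out" and f': "agree ?V f f'" "f' rF = F0" "f' ru = pre p" "f' ri = ?i" for f'
  proof -
    have ready: "ready f'"
      using f(1) f'(1) by (rule ready_agree) auto
    have F0: "F0 \<le> q"
      using residue_less by (simp add: F0_def less_imp_le)
    note pre = pre_range[OF u]
    show ?thesis
    proof (rule tri_time, rule tri_Seq, rule tri_If_J[OF J'])
      assume "f' rZero < f' ri"
      then have i: "0 < ?i"
        using ready f' by (simp add: ready_def)
      let ?l = "last_block (?i - 1) (pre p)"
      have l: "?l < n * n * n"
      proof -
        have "?l < (?i - 1 + 1) * (n * n)"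
          by (rule last_block_less[OF pre])
        also have "\<dots> \<le> n * (n * n)"
          using i i_le by (intro mult_le_mono1) auto
        finally show ?thesis
          by (simp add: mult.assoc)
      qed
      have l_def: "?l = (?i - 1) * (n * n) + (pre p - 1) * n + length (nb (pre p))"
        by (simp add: last_block_def start_def)
      have bounds: "length (nb (pre p)) \<le> M" "?i - 1 \<le> M" "(?i - 1) * (n * n) \<le> M" "pre p - 1 \<le> M"
        "(pre p - 1) * n \<le> M" "(?i - 1) * (n * n) + (pre p - 1) * n \<le> M"
        "(?i - 1) * (n * n) + (pre p - 1) * n + length (nb (pre p)) \<le> M"
        using nb_length[OF pre] n_le_M i_le pre l l_def by auto
      show "tri x J S (code [Ask In_Degree rd ru ru, Arith Sub ri ri rOne, Arith Mult rk ri rNN,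
                 Arith Sub ru ru rOne, Arith Mult ru ru rN, Arith Add rk rk ru, Arith Add rk rk rd] ;;
           read_residue ;; code [Arith Add rF rF rX]) (7 + (6 * w + 8 + 1)) f' a out
           (\<lambda>f a out. tri x J S (code [Arith Mod rF rF rQ]) (Suc 0) f a out R)"
      proof (rule tri_time, rule tri_code_SeqI[OF J', where t = "6 * w + 8 + 1"])
        show "straight x {10..<60} M [Ask In_Degree rd ru ru, Arith Sub ri ri rOne, Arith Mult rk ri rNN,
                 Arith Sub ru ru rOne, Arith Mult ru ru rN, Arith Add rk rk ru, Arith Add rk rk rd] f'
           (\<lambda>f''. agree {rd, ri, rk, ru} f' f'' \<and> f'' rk = ?l)"
          using bounds f' answers(1)[OF pre] l_def
          by (simp add: readyD[OF ready] readyD[OF f(1)] agree_def del: answer.simps)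
        show "tri x J S (read_residue ;; code [Arith Add rF rF rX]) (6 * w + 8 + 1) f'' a out
            (\<lambda>f a out. tri x J S (code [Arith Mod rF rF rQ]) (Suc 0) f a out R)"
          if f'': "J f'' a out" "agree {rd, ri, rk, ru} f' f'' \<and> f'' rk = ?l" for f''
        proof (rule tri_Seq, rule tri_read_residue)
          show "ready f''"
            using ready conjunct1[OF f''(2)] by (rule ready_agree) auto
          show "J f'' a out" "f'' rk < n * n * n"
            using f'' l by auto
          fix g
          assume g: "J g a out" "agree {ra, re, ry, rX} f'' g" "g rX = residue (block w a (f'' rk))"
          have F1: "g rX = F1" "g rF = F0" "F1 < q"
            using g f'' f' i residue_less by (auto simp: F1_def agree_def)
          show "tri x J S (code [Arith Add rF rF rX]) 1 g a out
              (\<lambda>f a out. tri x J S (code [Arith Mod rF rF rQ]) (Suc 0) f a out R)"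
          proof (rule tri_codeI)
            show "straight x {10..<60} M [Arith Add rF rF rX] g (\<lambda>g'. g' = g(rF := F0 + F1))"
              using F1 F0 q_le_M by simp
            show "tri x J S (code [Arith Mod rF rF rQ]) (Suc 0) g' a out R"
              if "J g' a out" "g' = g(rF := F0 + F1)" for g'
              using that g f'' f' by (intro final u) (auto simp: agree_def)
          qed (use g in auto)
        qed
      qed simp
    next
      assume "\<not> f' rZero < f' ri"
      then have i: "?i = 0"
        using ready f' by (simp add: ready_def)
      show "tri x J S (code [Ask Source rd rZero rZero] ;;
           IfLess ru rd Skip (IfLess rd ru Skip (code [Arith Add rF rF rBit]))) (1 + (0 + (0 + 1 + 2) + 2)) f' a out
           (\<lambda>f a out. J f a out \<and> tri x J S (code [Arith Mod rF rF rQ]) (Suc 0) f a out R)"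
      proof (rule tri_time, rule tri_code_Seq[OF J', where t = "0 + (0 + 1 + 2) + 2"])
        have "tri x J S (IfLess ru rd Skip (IfLess rd ru Skip (code [Arith Add rF rF rBit])))
            (0 + (0 + 1 + 2) + 2) f'' a out
            (\<lambda>f a out. J f a out \<and> tri x J S (code [Arith Mod rF rF rQ]) (Suc 0) f a out R)"
          if f'': "J f'' a out" "agree ?V f' f''" "f'' rF = F0" "f'' ru = pre p" "f'' rd = src" for f''
        proof -
          have bit: "f'' rBit = f rBit" "f'' rBit \<le> 1"
            using f' f'' readyD(7)[OF f(1)] by (auto simp: agree_def)
          have a: "agree ?V f f''" "agree ?V f (f''(rF := F0 + f'' rBit))"
            using f' f'' by (auto simp: agree_def)
          have F: "F0 + f'' rBit \<le> M"
            using F0 bit q_le_M q_pos by linarith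
          have t: "tri x J S (code [Arith Mod rF rF rQ]) (Suc 0) f'' a out R" if "pre p \<noteq> src"
            using that i a f'' by (intro final u) (auto simp: F1_def)
          have t': "tri x J S (code [Arith Mod rF rF rQ]) (Suc 0) (f''(rF := F0 + f'' rBit)) a out R"
            if "pre p = src" "J (f''(rF := F0 + f'' rBit)) a out"
            using that i a bit by (intro final u) (auto simp: F1_def)
          show ?thesis
          proof (rule tri_If_J[OF f''(1)])
            assume "f'' ru < f'' rd"
            then show "tri x J S Skip 0 f'' a out
                (\<lambda>f a out. J f a out \<and> tri x J S (code [Arith Mod rF rF rQ]) (Suc 0) f a out R)"
              using f'' t by (intro tri_Skip) auto
          next
            assume le: "\<not> f'' ru < f'' rd"
            show "tri x J S (IfLess rd ru Skip (code [Arith Add rF rF rBit])) (0 + 1 + 2) f'' a out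
                (\<lambda>f a out. J f a out \<and> J f a out \<and> tri x J S (code [Arith Mod rF rF rQ]) (Suc 0) f a out R)"
            proof (rule tri_If_J[OF f''(1)])
              assume "f'' rd < f'' ru"
              then show "tri x J S Skip 0 f'' a out
                  (\<lambda>f a out. J f a out \<and> J f a out \<and> tri x J S (code [Arith Mod rF rF rQ]) (Suc 0) f a out R)"
                using f'' t by (intro tri_Skip) auto
            next
              assume "\<not> f'' rd < f'' ru"
              with le have eq: "pre p = src"
                using f'' by simp
              show "tri x J S (code [Arith Add rF rF rBit]) 1 f'' a out
                  (\<lambda>f a out. J f a out \<and> J f a out \<and> J f a out \<and>
                     tri x J S (code [Arith Mod rF rF rQ]) (Suc 0) f a out R)"
                by (rule tri_time[OF tri_code]) (use f'' t'[OF eq] F in auto)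
            qed
          qed
        qed
        then show "straight x {10..<60} M [Ask Source rd rZero rZero] f'
            (\<lambda>f'. J f' a out \<longrightarrow> tri x J S (IfLess ru rd Skip (IfLess rd ru Skip (code [Arith Add rF rF rBit])))
              (0 + (0 + 1 + 2) + 2) f' a out
              (\<lambda>f a out. J f a out \<and> tri x J S (code [Arith Mod rF rF rQ]) (Suc 0) f a out R))"
          using f' src_le n_le_M by (auto simp: src_def agree_def)
      qed simp
    qed simp
  qed
  let ?second = "IfLess rZero ri
          (code [Ask In_Degree rd ru ru, Arith Sub ri ri rOne, Arith Mult rk ri rNN,
                 Arith Sub ru ru rOne, Arith Mult ru ru rN, Arith Add rk rk ru, Arith Add rk rk rd] ;;
           read_residue ;; code [Arith Add rF rF rX])
          (code [Ask Source rd rZero rZero] ;;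
           IfLess ru rd Skip (IfLess rd ru Skip (code [Arith Add rF rF rBit]))) ;;
        code [Arith Mod rF rF rQ]"
  let ?first = "IfLess rZero rj
          (code [Ask In_Nbr ru rv rj, Arith Sub rk rP rOne] ;; read_residue ;;
           code [Arith Add rF rX rZero])
          (code [Arith Add ru rv rZero])"
  have first: "tri x J S (?first ;; ?second) (12 * w + 40) f' a out R"
    if u: "used p" and J': "J f' a out" and f': "agree ?V f f'" "f' rF = 0" "f' rj = ?j" "f' rv = vert p" "f' ri = ?i"
    for f'
  proof -
    have ready: "ready f'"
      using f(1) f'(1) by (rule ready_agree) auto
    have P: "f' rP = p"
      using f' f(2) by (simp add: agree_def)
    show ?thesis
    proof (rule tri_time, rule tri_Seq, rule tri_If_J[OF J'])
      assume "f' rZero < f' rj"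
      then have j: "0 < ?j"
        using f' by (simp add: readyD[OF ready])
      then have p1: "p - 1 < n * n * n"
        using p by auto
      have j_le: "?j \<le> length (nb (vert p))"
        using u by (simp add: used_def)
      have nbr: "answer x In_Nbr (vert p) ?j = pre p" "pre p \<le> M"
        using answers(2)[OF vert_range, of ?j p] j j_le pre_range[OF u] n_le_M(1) by (auto simp: pre_def)
      show "tri x J S (code [Ask In_Nbr ru rv rj, Arith Sub rk rP rOne] ;; read_residue ;;
           code [Arith Add rF rX rZero]) (2 + (6 * w + 8 + 1)) f' a out
           (\<lambda>f a out. tri x J S ?second (6 * w + 25) f a out R)"
      proof (rule tri_time, rule tri_code_Seq[OF J', where t = "6 * w + 8 + 1"])
        have "tri x J S (read_residue ;; code [Arith Add rF rX rZero]) (6 * w + 8 + 1) f'' a out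
            (\<lambda>f a out. tri x J S ?second (6 * w + 25) f a out R)"
          if f'': "J f'' a out" "agree {ru, rk} f' f''" "f'' ru = pre p" "f'' rk = p - 1" for f''
        proof (rule tri_Seq, rule tri_read_residue)
          show r'': "ready f''"
            using ready f''(2) by (rule ready_agree) auto
          show "J f'' a out" "f'' rk < n * n * n"
            using f'' p1 by auto
          fix g
          assume g: "J g a out" "agree {ra, re, ry, rX} f'' g" "g rX = residue (block w a (f'' rk))"
          have ready_g: "ready g"
            using r'' g(2) by (rule ready_agree) auto
          have F0: "g rX = F0" "F0 < q"
            using g f'' j residue_less by (auto simp: F0_def)
          have "tri x J S ?second (6 * w + 25) (g(rF := F0)) a out R" if "J (g(rF := F0)) a out"
            using that g f'' f' by (intro second u) (simp_all add: agree_def)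
          then show "tri x J S (code [Arith Add rF rX rZero]) 1 g a out
              (\<lambda>f a out. tri x J S ?second (6 * w + 25) f a out R)"
            using F0 g q_le_M by (intro tri_codeI[where R = "\<lambda>g'. g' = g(rF := F0)"]) (simp_all add: readyD[OF ready_g])
        qed
        then show "straight x {10..<60} M [Ask In_Nbr ru rv rj, Arith Sub rk rP rOne] f'
            (\<lambda>f'. J f' a out \<longrightarrow> tri x J S (read_residue ;; code [Arith Add rF rX rZero]) (6 * w + 8 + 1) f' a out
              (\<lambda>f a out. tri x J S ?second (6 * w + 25) f a out R))"
          using f' nbr p_le
          by - (rule straight_mono[where R = "\<lambda>f''. agree {ru, rk} f' f'' \<and> f'' ru = pre p \<and> f'' rk = p - 1"],
            simp_all add: readyD[OF ready] P agree_def del: answer.simps)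
      qed simp
    next
      assume "\<not> f' rZero < f' rj"
      then have j: "?j = 0"
        using f' by (simp add: readyD[OF ready])
      have v: "vert p \<le> M"
        using vert_range[of p] n_le_M(1) by simp
      show "tri x J S (code [Arith Add ru rv rZero]) 1 f' a out
           (\<lambda>f a out. J f a out \<and> tri x J S ?second (6 * w + 25) f a out R)"
      proof (rule tri_codeI[OF J'])
        show "straight x {10..<60} M [Arith Add ru rv rZero] f' (\<lambda>g. g = f'(ru := vert p))"
          using f' v by (simp add: readyD[OF ready])
        fix g
        assume g: "J g a out" "g = f'(ru := vert p)"
        have "F0 = 0" "pre p = vert p"
          using j by (simp_all add: F0_def pre_def)
        moreover have "agree ?V f g"
          using f'(1) unfolding g(2) by (auto simp: agree_def)
        moreover have "g rF = f' rF" "g ru = vert p" "g ri = f' ri"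
          unfolding g(2) by simp_all
        ultimately have g': "agree ?V f g" "g rF = F0" "g ru = pre p" "g ri = ?i"
          using f'(2,5) by metis+
        note second' = second[of g, OF u g(1) g']
        show "J g a out \<and> tri x J S ?second (6 * w + 25) g a out R"
          by (rule conjI[OF g(1) second'])
      qed simp
    qed simp
  qed
  let ?init = "[Arith Mod rj rP rN, Arith Div ri rP rNN, Arith Div rv rP rN, Arith Mod rv rv rN,
           Arith Add rv rv rOne, Ask In_Degree rd rv rv, Const rF 0]"
  note ready = readyD[OF f(1)]
  have rest: "tri x J S (IfLess rd rj Skip (?first ;; ?second)) (12 * w + 42) f' a out R"
    if J': "J f' a out" and f': "agree ?V f f'" "f' rF = 0" "f' rj = ?j" "f' rv = vert p" "f' ri = ?i"
      "f' rd = length (nb (vert p))" for f'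
  proof (rule tri_time, rule tri_If_J[OF J'])
    assume "f' rd < f' rj"
    then have "inflow (f rBit) (block w a) p = 0"
      using f' by (simp add: inflow_def used_def)
    then show "tri x J S Skip 0 f' a out R"
      using J' f' by (intro tri_Skip R_I) auto
  next
    assume "\<not> f' rd < f' rj"
    then have "used p"
      using f' by (simp add: used_def)
    then have "tri x J S (?first ;; ?second) (12 * w + 40) f' a out R"
      using J' f' by (intro first) auto
    then show "tri x J S (?first ;; ?second) (12 * w + 40) f' a out (\<lambda>f a out. J f a out \<and> R f a out)"
      by (rule tri_mono) (auto simp: R_def)
  qed simp
  have bounds: "?j \<le> M" "?i \<le> M" "p div n \<le> M" "p div n mod n \<le> M" "vert p \<le> M"
    "length (nb (vert p)) \<le> M"
  proof -
    show "?j \<le> M" "?i \<le> M" "p div n \<le> M"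
      using p_le mod_less_eq_dividend div_le_dividend order_trans by blast+
    then show "p div n mod n \<le> M"
      using mod_less_eq_dividend order_trans by blast
    show "vert p \<le> M" "length (nb (vert p)) \<le> M"
      using vert_range[of p] nb_length[OF vert_range, of p] n_le_M(1) by auto
  qed
  have "tri x J S calc_inflow (12 * w + 60) f a out R"
    unfolding calc_inflow_def
  proof (rule tri_time, rule tri_code_SeqI[OF J])
    show "straight x {10..<60} M ?init f (\<lambda>f'. agree ?V f f' \<and> f' rF = 0 \<and> f' rj = ?j \<and> f' rv = vert p \<and> f' ri = ?i \<and>
        f' rd = length (nb (vert p)))"
      using bounds answers(1)[OF vert_range, of p] f(2)
      by (simp add: ready agree_def vert_def del: answer.simps)
    show "tri x J S (IfLess rd rj Skip (?first ;; ?second)) (12 * w + 42) f' a out R"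
      if "J f' a out" "agree ?V f f' \<and> f' rF = 0 \<and> f' rj = ?j \<and> f' rv = vert p \<and> f' ri = ?i \<and>
        f' rd = length (nb (vert p))" for f'
      using that by (intro rest) auto
  qed simp
  then show ?thesis
    by (rule tri_mono) (auto simp: R_def intro: Q)
qed

text \<open>The amount may equal \<open>q\<close>: this happens when an inflow of 0 is undone by a
  shift by \<open>q - 0\<close>.\<close>

lemma tri_calc_shift:
  assumes J: "J f a out" and f: "ready f" "f rP = p" "f rF \<le> q" and p: "p < n * n * n"
    and Q: "\<And>f'. J f' a out \<Longrightarrow> agree {rk, ra, re, ry, rX, rOld, ru, rt} f f' \<Longrightarrow>
      f' rOld = block w a p \<Longrightarrow> f' rX = shift (block w a p) (f rF) \<Longrightarrow> Q f' a out"
  shows "tri x J S calc_shift (6 * w + 25) f a out Q"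
proof -
  let ?V = "{rk, ra, re, ry, rX, rOld, ru, rt}"
  let ?y = "block w a p"
  define z where "z = (?y + r) mod W"
  define z' where "z' = (if W < (z div q + 1) * q then z else z div q * q + (z mod q + f rF) mod q)"
  have y: "?y < W"
    using block_less W_def by simp
  have z: "z < W"
    using W_pos by (simp add: z_def)
  have zq: "z div q * q \<le> z" "z div q \<le> z"
    by simp_all
  have z': "z' \<le> 2 * W"
  proof -
    have "(z mod q + f rF) mod q < q"
      using q_pos by simp
    then show ?thesis
      using z zq(1) q_le unfolding z'_def by (simp split: if_split)
  qed
  note ready = readyD[OF f(1)]
  have last: "tri x J S (code [Arith Add rX rX rW, Arith Sub rX rX rR, Arith Mod rX rX rW]) 3 f' a out
      (\<lambda>f a out. J f a out \<and> Q f a out)"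
    if f': "J f' a out" "agree ?V f f'" "f' rOld = ?y" "f' rX = z'" for f'
  proof (rule tri_codeI[OF f'(1)])
    have "ready f'"
      using f(1) f'(2) by (rule ready_agree) auto
    note ready' = readyD[OF this]
    have "z' + W - r \<le> M" "(z' + W - r) mod W \<le> M" "z' + W \<le> M"
    proof -
      show "z' + W \<le> M"
        using z' M_bounds(2) by simp
      then show "z' + W - r \<le> M"
        by simp
      then show "(z' + W - r) mod W \<le> M"
        using mod_less_eq_dividend order_trans by blast
    qed
    moreover have "(z' + W - r) mod W = shift ?y (f rF)"
      by (simp add: shift_def z'_def z_def Let_def)
    ultimately show "straight x {10..<60} M [Arith Add rX rX rW, Arith Sub rX rX rR, Arith Mod rX rX rW] f'
        (\<lambda>g. agree {rX} f' g \<and> g rX = shift ?y (f rF))"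
      by (simp add: f' ready' agree_def)
    show "J g a out \<and> Q g a out" if "J g a out" "agree {rX} f' g \<and> g rX = shift ?y (f rF)" for g
      using that f' by (intro conjI Q) (simp_all add: agree_def)
  qed simp
  have middle: "tri x J S (IfLess rW ru Skip
       (code [Arith Mod rX rX rQ, Arith Add rX rX rF, Arith Mod rX rX rQ, Arith Mult rt rt rQ,
              Arith Add rX rt rX]) ;; code [Arith Add rX rX rW, Arith Sub rX rX rR, Arith Mod rX rX rW])
      10 f' a out Q"
    if f': "J f' a out" "agree ?V f f'" "f' rOld = ?y" "f' rX = z" "f' rt = z div q"
      "f' ru = (z div q + 1) * q" for f'
  proof -
    have "ready f'"
      using f(1) f'(2) by (rule ready_agree) auto
    note ready' = readyD[OF this]
    have F: "f' rF = f rF"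
      using f'(2) by (simp add: agree_def)
    show ?thesis
    proof (rule tri_time, rule tri_Seq, rule tri_If_J[OF f'(1)])
      assume "f' rW < f' ru"
      then have "z' = z"
        using f' by (simp add: z'_def ready')
      then have "f' rX = z'"
        using f' by simp
      then have "tri x J S (code [Arith Add rX rX rW, Arith Sub rX rX rR, Arith Mod rX rX rW]) 3 f' a out Q"
        by (rule tri_mono[OF last[OF f'(1-3)]]) auto
      then show "tri x J S Skip 0 f' a out
          (\<lambda>f a out. tri x J S (code [Arith Add rX rX rW, Arith Sub rX rX rR, Arith Mod rX rX rW]) 3 f a out Q)"
        by - (rule tri_Skip)
    next
      assume "\<not> f' rW < f' ru"
      then have z'_eq: "z' = z div q * q + (z mod q + f rF) mod q"
        using f' by (auto simp: z'_def ready')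
      have "z mod q \<le> M" "z mod q + f rF \<le> M" "(z mod q + f rF) mod q \<le> M" "z div q * q \<le> M" "z' \<le> M"
      proof -
        show "z mod q + f rF \<le> M"
          using f(3) q_le_M mod_less_divisor[OF q_pos, of z] by linarith
        then show "z mod q \<le> M" "(z mod q + f rF) mod q \<le> M"
          using mod_less_eq_dividend[of "z mod q + f rF" q] by linarith+
        show "z div q * q \<le> M" "z' \<le> M"
          using zq z z' M_bounds(2) by linarith+
      qed
      then have "straight x {10..<60} M [Arith Mod rX rX rQ, Arith Add rX rX rF, Arith Mod rX rX rQ, Arith Mult rt rt rQ,
              Arith Add rX rt rX] f' (\<lambda>g. agree {rX, rt} f' g \<and> g rX = z')"
        by (simp add: f' F ready' agree_def z'_eq)
      then show "tri x J S (code [Arith Mod rX rX rQ, Arith Add rX rX rF, Arith Mod rX rX rQ, Arith Mult rt rt rQ,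
              Arith Add rX rt rX]) 5 f' a out
          (\<lambda>f a out. J f a out \<and>
             tri x J S (code [Arith Add rX rX rW, Arith Sub rX rX rR, Arith Mod rX rX rW]) 3 f a out Q)"
      proof (rule tri_codeI[OF f'(1)])
        fix g
        assume g: "J g a out" "agree {rX, rt} f' g \<and> g rX = z'"
        then have g': "agree ?V f g" "g rOld = ?y" "g rX = z'"
          using f'(2,3) by (auto simp: agree_def)
        have "tri x J S (code [Arith Add rX rX rW, Arith Sub rX rX rR, Arith Mod rX rX rW]) 3 g a out Q"
          by (rule tri_mono[OF last[OF g(1) g']]) auto
        with g show "J g a out \<and>
            tri x J S (code [Arith Add rX rX rW, Arith Sub rX rX rR, Arith Mod rX rX rW]) 3 g a out Q"
          by simp
      qed simp
    qed simp
  qed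
  have bounds: "?y \<le> M" "?y + r \<le> M" "z \<le> M" "z div q \<le> M" "z div q + 1 \<le> M" "(z div q + 1) * q \<le> M"
  proof -
    show "?y \<le> M" "?y + r \<le> M" "z \<le> M" "z div q \<le> M"
      using y z r_less zq M_bounds(2) by linarith+
    show "(z div q + 1) * q \<le> M"
      unfolding add_mult_distrib using zq z q_le M_bounds(2) by linarith
    show "z div q + 1 \<le> M"
      using y z r_less zq M_bounds(2) by linarith
  qed
  show ?thesis
    unfolding calc_shift_def
  proof (rule tri_time, rule tri_code_SeqI[OF J])
    show "straight x {10..<60} M [Arith Add rk rP rZero] f (\<lambda>g. g = f(rk := p))"
      using p M_bounds(3) by (simp add: f ready)
    show "tri x J S (read_block ;;
     code [Arith Add rOld rX rZero, Arith Add rX rX rR, Arith Mod rX rX rW, Arith Div rt rX rQ,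
           Arith Add ru rt rOne, Arith Mult ru ru rQ] ;;
     IfLess rW ru Skip
       (code [Arith Mod rX rX rQ, Arith Add rX rX rF, Arith Mod rX rX rQ, Arith Mult rt rt rQ,
              Arith Add rX rt rX]) ;;
     code [Arith Add rX rX rW, Arith Sub rX rX rR, Arith Mod rX rX rW]) (6 * w + 5 + (6 + 10)) g a out Q"
      if g: "J g a out" "g = f(rk := p)" for g
    proof (rule tri_Seq, rule tri_read_block[OF g(1)])
      show "ready g"
        using f(1) by (rule ready_agree[where V = "{rk}"]) (auto simp: g(2) agree_def)
      show "g rk < n * n * n"
        using p g(2) by simp
      fix h
      assume h: "J h a out" "agree {ra, re, ry, rX} g h" "h rX = block w a (g rk)"
      have V: "agree ?V f h"
        using h g(2) by (auto simp: agree_def)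
      have "ready h"
        using f(1) V by (rule ready_agree) auto
      note ready' = readyD[OF this]
      have X: "h rX = ?y"
        using h g(2) by simp
      have s: "straight x {10..<60} M [Arith Add rOld rX rZero, Arith Add rX rX rR, Arith Mod rX rX rW, Arith Div rt rX rQ,
           Arith Add ru rt rOne, Arith Mult ru ru rQ] h
          (\<lambda>h'. agree {rOld, rX, rt, ru} h h' \<and> h' rOld = ?y \<and> h' rX = z \<and> h' rt = z div q \<and>
             h' ru = (z div q + 1) * q)"
        using bounds by (simp add: ready' X agree_def flip: z_def)
      show "tri x J S (code [Arith Add rOld rX rZero, Arith Add rX rX rR, Arith Mod rX rX rW, Arith Div rt rX rQ,
           Arith Add ru rt rOne, Arith Mult ru ru rQ] ;;
        IfLess rW ru Skip
         (code [Arith Mod rX rX rQ, Arith Add rX rX rF, Arith Mod rX rX rQ, Arith Mult rt rt rQ,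
              Arith Add rX rt rX]) ;;
        code [Arith Add rX rX rW, Arith Sub rX rX rR, Arith Mod rX rX rW]) (6 + 10) h a out Q"
      proof (rule tri_time, rule tri_code_SeqI[OF h(1) s])
        fix h'
        assume h': "J h' a out"
          "agree {rOld, rX, rt, ru} h h' \<and> h' rOld = ?y \<and> h' rX = z \<and> h' rt = z div q \<and>
             h' ru = (z div q + 1) * q"
        then have "agree ?V f h'"
          using V by (auto simp: agree_def)
        with h' show "tri x J S (IfLess rW ru Skip
         (code [Arith Mod rX rX rQ, Arith Add rX rX rF, Arith Mod rX rX rQ, Arith Mult rt rt rQ,
              Arith Add rX rt rX]) ;;
          code [Arith Add rX rX rW, Arith Sub rX rX rR, Arith Mod rX rX rW]) 10 h' a out Q"
          by (intro middle) auto
      qed simp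
    qed
  qed simp
qed

end

section \<open>Sweeping over the tape\<close>

abbreviation (input) "rA \<equiv> 17 :: nat"
abbreviation (input) "rA' \<equiv> 18 :: nat"

definition write_block :: com where
  "write_block =
     code [Arith Mult ra rP rB, Arith Add re ra rB] ;;
     WhileLess ra re
       (code [Arith Mod ry rX rTwo] ;; Do (CatWrite ra ry) ;;
        code [Arith Div rX rX rTwo, Arith Add ra ra rOne])"

text \<open>While block \<open>p\<close> is being overwritten, register \<open>K\<close> contains \<open>p + 1\<close> and register \<open>H\<close> the
  original content of the block.\<close>

definition store :: "nat \<Rightarrow> com" where
  "store h = Do (Arith Add rH h rZero) ;; Do (Arith Add rK rP rOne) ;; write_block"

text \<open>\<open>rC\<close> advances while \<open>rK\<close> still marks the block. Old and new
  position describe the same tape except for that block, so each single instruction keeps the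
  invariant; the mark is removed last.\<close>

definition forward :: com where
  "forward =
     code [Arith Add rP rC rZero] ;; calc_inflow ;; calc_shift ;; store rOld ;;
     code [Arith Mod rt rP rN, Arith Div rv rP rN, Arith Mod rv rv rN, Arith Add rv rv rOne,
           Ask In_Degree rd rv rv] ;;
     IfLess rt rd (Do (Arith Add rC rC rOne)) (code [Arith Sub rt rN rt] ;; Do (Arith Add rC rC rt)) ;;
     Do (Const rK 0)"

definition backward :: com where
  "backward =
     code [Arith Mod rt rC rN] ;;
     IfLess rZero rt (code [Arith Sub rP rC rOne])
       (code [Arith Sub rv rC rOne, Arith Div rv rv rN, Arith Mod rv rv rN, Arith Add rv rv rOne,
              Ask In_Degree rd rv rv, Arith Sub rP rC rN, Arith Add rP rP rd]) ;;
     calc_inflow ;; code [Arith Sub rF rQ rF] ;; calc_shift ;; store rX ;;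
     Do (Arith Add rC rP rZero) ;; Do (Const rK 0)"

definition there_and_back :: com where
  "there_and_back =
     WhileLess rC rTop forward ;;
     code [Ask Target rt rZero rZero, Arith Sub rt rt rOne, Arith Mult rt rt rN, Arith Add rP rTop rt] ;;
     calc_inflow ;; code [Arith Add rA' rF rZero] ;; WhileLess rZero rC backward"

definition compare :: com where
  "compare =
     Do (Const rBit 0) ;; there_and_back ;; code [Arith Add rA rA' rZero] ;;
     Do (Const rBit 1) ;; there_and_back ;;
     IfLess rA rA' (Do (Emit rOne)) (IfLess rA' rA (Do (Emit rOne)) (Do (Emit rZero)))"

definition fits :: "nat \<Rightarrow> (nat \<Rightarrow> nat) \<Rightarrow> bool" where
  "fits M f \<longleftrightarrow> (\<forall>k. f k \<le> M \<and> (60 \<le> k \<longrightarrow> f k = 0))"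

lemma fits_upd: "fits M f \<Longrightarrow> k < 60 \<Longrightarrow> v \<le> M \<Longrightarrow> fits M (f(k := v))"
  by (simp add: fits_def)

text \<open>The marked block is exempt from the description by \<open>state\<close>, since it may be
  half overwritten. The last clause says that no used block lies between it and \<open>rC\<close>;
  hence undoing a used block other than the marked one never requires reading the marked
  one.\<close>

definition tape_inv ::
    "nat \<Rightarrow> nat \<Rightarrow> nat \<Rightarrow> (nat \<Rightarrow> nat list) \<Rightarrow> nat \<Rightarrow> (nat \<Rightarrow> bool) \<Rightarrow> (nat \<Rightarrow> nat) \<Rightarrow> (nat \<Rightarrow> bool) \<Rightarrow> bool" where
  "tape_inv n w W nb src \<tau> f a \<longleftrightarrow>
     f rN = n \<and> f (Suc 0) = n * n \<and> f rB = w \<and> f rW = W \<and> 0 < f rQ \<and> f rQ \<le> W \<and> f rR < W \<and> f rBit \<le> 1 \<and>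
     f rC \<le> n * n * n \<and>
     (\<forall>k. f rK \<noteq> Suc k \<longrightarrow>
        block w a k = grid.state n (f rQ) (f rR) W nb src (block w \<tau>) (f rBit) (f rC) k) \<and>
     (f rK \<noteq> 0 \<longrightarrow> f rH = block w \<tau> (f rK - 1)) \<and>
     (f rK \<noteq> 0 \<longrightarrow> (\<forall>k. f rK \<le> k \<and> k < f rC \<longrightarrow> \<not> grid.used n nb k))"

text \<open>The first alternative belongs to the initialization and the coin flips, when the
  parameters of the sweeps are not yet set but the tape is untouched.\<close>

definition inv ::
    "nat \<Rightarrow> nat \<Rightarrow> nat \<Rightarrow> nat \<Rightarrow> (nat \<Rightarrow> nat list) \<Rightarrow> nat \<Rightarrow> (nat \<Rightarrow> bool) \<Rightarrow> assn" where
  "inv M n w W nb src \<tau> f a out \<longleftrightarrow>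
     fits M f \<and> (f rC = 0 \<and> f rK = 0 \<and> a = \<tau> \<or> tape_inv n w W nb src \<tau> f a)"

lemma inv_scratch:
  assumes "inv M n w W nb src \<tau> f a out" "k \<in> {10..<60}" "v \<le> M"
  shows "inv M n w W nb src \<tau> (f(k := v)) a out"
  using assms by (auto simp: inv_def tape_inv_def intro: fits_upd)

section \<open>Correctness of the forward and backward sweeps\<close>

locale sweep = machine n q r W nb src x "inv M n w W nb src \<tau>" S M w
  for n q r W nb src x \<tau> S M w +
  assumes w_pos: "0 < w" and M_ge: "2 \<le> M" and target_range: "target x \<in> {1..n}"
begin

abbreviation J where "J \<equiv> inv M n w W nb src \<tau>"

abbreviation st where "st \<equiv> state (block w \<tau>)"

definition good :: "nat \<Rightarrow> nat \<Rightarrow> (nat \<Rightarrow> nat) \<Rightarrow> bool" where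
  "good b c f \<longleftrightarrow> ready f \<and> fits M f \<and> f rBit = b \<and> f rC = c \<and> f rTop = n * n * n \<and> c \<le> n * n * n"

definition clean :: "nat \<Rightarrow> nat \<Rightarrow> (nat \<Rightarrow> nat) \<Rightarrow> (nat \<Rightarrow> bool) \<Rightarrow> bool" where
  "clean b c f a \<longleftrightarrow> good b c f \<and> f rK = 0 \<and> block w a = st b c"

definition held :: "nat \<Rightarrow> nat \<Rightarrow> nat \<Rightarrow> (nat \<Rightarrow> nat) \<Rightarrow> (nat \<Rightarrow> bool) \<Rightarrow> bool" where
  "held b c p f a \<longleftrightarrow> good b c f \<and> f rK = Suc p \<and> f rH = block w \<tau> p \<and>
     (\<forall>k. p < k \<and> k < c \<longrightarrow> \<not> used k) \<and> (\<forall>k. k \<noteq> p \<longrightarrow> block w a k = st b c k)"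

lemma goodD:
  assumes "good b c f"
  shows "ready f" "fits M f" "f rBit = b" "f rC = c" "f rTop = n * n * n" "c \<le> n * n * n"
  using assms by (simp_all add: good_def)

lemma clean_J: "clean b c f a \<Longrightarrow> J f a out"
  using q_pos q_le r_less by (auto simp: clean_def good_def inv_def tape_inv_def ready_def)

lemma held_J: "held b c p f a \<Longrightarrow> J f a out"
  using q_pos q_le r_less by (auto simp: held_def good_def inv_def tape_inv_def ready_def)

lemma J_fits: "J f a out \<Longrightarrow> fits M f"
  by (simp add: inv_def)

lemma good_agree:
  assumes "good b c f" "agree V f f'" "V \<inter> {..<14} \<subseteq> {rK, rH}" "fits M f'"
  shows "good b c f'"
proof -
  have "f' k = f k" if "k < 14" "k \<noteq> rK" "k \<noteq> rH" for k
    using assms(2,3) that by (auto simp: agree_def)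
  then show ?thesis
    using assms(1,4) by (simp add: good_def ready_def)
qed

lemma clean_agree:
  assumes "clean b c f a" "agree V f f'" "V \<inter> {..<14} = {}" "fits M f'"
  shows "clean b c f' a"
proof -
  have "good b c f'"
    using assms by (intro good_agree[of b c f V f']) (auto simp: clean_def)
  moreover have "f' rK = f rK"
    using assms(2,3) by (auto simp: agree_def disjoint_iff)
  ultimately show ?thesis
    using assms(1) by (simp add: clean_def)
qed

lemma block_upd: "addr div w \<noteq> k \<Longrightarrow> block w (a(addr := v)) k = block w a k"
  by (rule block_cong) auto

text \<open>The marked block may have any content, so its bits can be written one at a time, with
  the invariant intact in between.\<close>

lemma J_write:
  assumes "J f a out" "f rK = Suc p" "addr div w = p"
  shows "J f (a(addr := v)) out"
  using assms by (auto simp: inv_def tape_inv_def block_upd)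

lemma tri_write_block:
  assumes J: "J f a out" and f: "ready f" "f rK = Suc p" "f rP = p" "f rX = y" and y: "y < W" and p: "p < n * n * n"
    and Q: "\<And>f' a'. J f' a' out \<Longrightarrow> agree {ra, re, ry, rX} f f' \<Longrightarrow> block w a' p = y \<Longrightarrow>
      (\<And>k. k \<noteq> p \<Longrightarrow> block w a' k = block w a k) \<Longrightarrow> Q f' a' out"
  shows "tri x J S write_block (6 * w + 4) f a out Q"
proof -
  have "(p + 1) * w \<le> n * n * n * w"
    using p by (intro mult_le_mono1) simp
  then have pw: "p * w + w \<le> S"
    by (simp add: S_def)
  have y_le: "y \<le> M"
    using y M_bounds(2) by simp
  define I where "I f' a' out' \<longleftrightarrow> J f' a' out' \<and> out' = out \<and> agree {ra, re, ry, rX} f f' \<and>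
      p * w \<le> f' ra \<and> f' ra \<le> p * w + w \<and> f' re = p * w + w \<and> f' rX = y div 2 ^ (f' ra - p * w) \<and>
      (\<forall>i < f' ra - p * w. a' (p * w + i) = odd (y div 2 ^ i)) \<and> (\<forall>i. i div w \<noteq> p \<longrightarrow> a' i = a i)"
    for f' a' out'
  let ?body = "code [Arith Mod ry rX rTwo] ;; Do (CatWrite ra ry) ;; code [Arith Div rX rX rTwo, Arith Add ra ra rOne]"
  have body: "J f' a' out' \<and> tri x J S ?body 4 f' a' out' (\<lambda>f'' a'' out''. I f'' a'' out'' \<and> f'' re - f'' ra < f' re - f' ra)"
    if I: "I f' a' out'" and less: "f' ra < f' re" for f' a' out'
  proof
    have J': "J f' a' out" and out': "out' = out" and V: "agree {ra, re, ry, rX} f f'"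
      using I by (auto simp: I_def)
    then show "J f' a' out'"
      by simp
    have "ready f'"
      using f(1) V by (rule ready_agree) auto
    note ready' = readyD[OF this]
    define t where "t = f' ra - p * w"
    have t: "f' ra = p * w + t" "t < w" "f' re = p * w + w" "f' rX = y div 2 ^ t"
      using I less by (auto simp: I_def t_def)
    have K: "f' rK = Suc p"
      using f V by (simp add: agree_def)
    have old: "\<And>i. i < t \<Longrightarrow> a' (p * w + i) = odd (y div 2 ^ i)" "\<And>i. i div w \<noteq> p \<Longrightarrow> a' i = a i"
      using I by (auto simp: I_def t_def)
    have X_le: "y div 2 ^ t \<le> M" "y div 2 ^ t mod 2 \<le> M" "y div 2 ^ t div 2 \<le> M"
      using y_le div_le_dividend[of y "2 ^ t"] mod_less_eq_dividend[of "y div 2 ^ t" 2] by linarith+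
    have "tri x J S ?body 4 f' a' out (\<lambda>f'' a'' out''. I f'' a'' out'' \<and> f'' re - f'' ra < f' re - f' ra)"
    proof (rule tri_time, rule tri_code_SeqI[OF J', where t = "1 + 2"])
      show "straight x {10..<60} M [Arith Mod ry rX rTwo] f' (\<lambda>g. g = f'(ry := y div 2 ^ t mod 2))"
        using X_le by (simp add: ready' t)
      fix g
      assume g: "J g a' out" "g = f'(ry := y div 2 ^ t mod 2)"
      show "tri x J S (Do (CatWrite ra ry) ;; code [Arith Div rX rX rTwo, Arith Add ra ra rOne]) (1 + 2) g a' out
          (\<lambda>f'' a'' out''. I f'' a'' out'' \<and> f'' re - f'' ra < f' re - f' ra)"
      proof (rule tri_Seq, rule tri_CatWrite[where J = J, OF g(1)])
        show "g ra < S"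
          using t pw by (simp add: g(2))
        have ra: "g ra = p * w + t" and ry: "(g ry \<noteq> 0) = odd (y div 2 ^ t)"
          using t by (simp_all add: g(2) odd_iff_mod_2_eq_one)
        let ?a = "a'(p * w + t := odd (y div 2 ^ t))"
        have "(p * w + t) div w = p"
          using t(2) by simp
        then have "J g ?a out"
          using g K by (intro J_write[OF g(1)]) auto
        then have "tri x J S (code [Arith Div rX rX rTwo, Arith Add ra ra rOne]) 2 g ?a out
            (\<lambda>f'' a'' out''. I f'' a'' out'' \<and> f'' re - f'' ra < f' re - f' ra)"
        proof (rule tri_codeI)
          show "straight x {10..<60} M [Arith Div rX rX rTwo, Arith Add ra ra rOne] g
              (\<lambda>h. h = g(rX := y div 2 ^ Suc t, ra := p * w + Suc t))"
          proof -
            have "y div 2 ^ Suc t = y div 2 ^ t div 2"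
              by (simp add: power_Suc2 div_mult2_eq del: power_Suc)
            then show ?thesis
              using t X_le pw M_bounds(1) ready' by (simp add: g(2) del: power_Suc)
          qed
          fix h
          assume h: "J h ?a out" "h = g(rX := y div 2 ^ Suc t, ra := p * w + Suc t)"
          have "\<forall>i < Suc t. ?a (p * w + i) = odd (y div 2 ^ i)"
            using old(1) by (auto simp: less_Suc_eq)
          moreover have "\<forall>i. i div w \<noteq> p \<longrightarrow> ?a i = a i"
            using old(2) \<open>(p * w + t) div w = p\<close> by auto
          moreover have "agree {ra, re, ry, rX} f h"
            using V by (simp add: h(2) g(2) agree_def)
          ultimately have "I h ?a out"
            using h(1) t unfolding I_def by (simp add: h(2) g(2) less_Suc_eq)
          moreover have "h re - h ra < f' re - f' ra"
            using t by (simp add: h(2) g(2))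
          ultimately show "I h ?a out \<and> h re - h ra < f' re - f' ra" ..
        qed simp
        then show "tri x J S (code [Arith Div rX rX rTwo, Arith Add ra ra rOne]) 2 g
            (a'(g ra := (g ry \<noteq> 0))) out (\<lambda>f'' a'' out''. I f'' a'' out'' \<and> f'' re - f'' ra < f' re - f' ra)"
          by (simp only: ra ry)
      qed
    qed simp
    then show "tri x J S ?body 4 f' a' out' (\<lambda>f'' a'' out''. I f'' a'' out'' \<and> f'' re - f'' ra < f' re - f' ra)"
      unfolding out' .
  qed
  note ready = readyD[OF f(1)]
  show ?thesis
    unfolding write_block_def
  proof (rule tri_time, rule tri_code_SeqI[OF J])
    show "straight x {10..<60} M [Arith Mult ra rP rB, Arith Add re ra rB] f
        (\<lambda>g. g = f(ra := p * w, re := p * w + w))"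
      using pw M_bounds(1) by (simp add: ready f(3))
    fix g
    assume g: "J g a out" "g = f(ra := p * w, re := p * w + w)"
    show "tri x J S (WhileLess ra re ?body) (w * (4 + 2) + 2) g a out Q"
    proof (rule tri_While[where I = I and \<mu> = "\<lambda>f. f re - f ra" and t = 4])
      show "I g a out"
        using g f by (simp add: I_def agree_def)
      show "J f' a' out' \<and> Q f' a' out'" if I: "I f' a' out'" "\<not> f' ra < f' re" for f' a' out'
      proof
        have e: "f' ra = p * w + w"
          using I by (simp add: I_def)
        have "block w a' p = y mod 2 ^ w"
          unfolding block_def using I(1) e by (intro number_bits) (simp add: I_def)
        then have "block w a' p = y"
          using y by (simp add: W_def)
        moreover have "block w a' k = block w a k" if "k \<noteq> p" for k
          using I(1) that by (intro block_cong) (auto simp: I_def)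
        ultimately show "Q f' a' out'"
          using I(1) Q[of f' a'] by (auto simp: I_def)
      qed (use I in \<open>auto simp: I_def\<close>)
      show "J f' a' out'" if "I f' a' out'" for f' a' out'
        using that by (auto simp: I_def)
      show "w * (4 + 2) + 2 = (g re - g ra) * (4 + 2) + 2"
        by (simp add: g(2))
    qed (rule body)
  qed simp
qed

text \<open>\<open>rH\<close> is set before \<open>rK\<close>, because it is relied upon as soon as
  \<open>rK\<close> is nonzero. When the mark is set the block still has its old content, so nothing
  breaks at that moment.\<close>

lemma tri_store:
  assumes cl: "clean b c f a" and f: "f rP = p" "f h = block w \<tau> p" "f rX = y"
    and skipped: "\<And>k. p < k \<Longrightarrow> k < c \<Longrightarrow> \<not> used k" and h: "h \<in> {rOld, rX}" and y: "y < W" and p: "p < n * n * n"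
    and Q: "\<And>f' a'. held b c p f' a' \<Longrightarrow> block w a' p = y \<Longrightarrow> agree {rH, rK, ra, re, ry, rX} f f' \<Longrightarrow> Q f' a' out"
  shows "tri x J S (store h) (6 * w + 6) f a out Q"
proof -
  have g: "good b c f" "f rK = 0" "block w a = st b c"
    using cl by (simp_all add: clean_def)
  note good = goodD[OF g(1)]
  note ready = readyD[OF good(1)]
  define f1 where "f1 = f(rH := block w \<tau> p)"
  define f2 where "f2 = f1(rK := Suc p)"
  have "block w \<tau> p \<le> M"
    using block_less[of w \<tau> p] M_bounds(2) by (simp flip: W_def)
  then have b1: "fits M f1"
    unfolding f1_def using good by (intro fits_upd) auto
  then have b2: "fits M f2"
    unfolding f2_def using p M_bounds(3) by (intro fits_upd) auto
  have c1: "clean b c f1 a"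
    using g b1 good_agree[OF g(1), of "{rH}" f1] by (simp add: clean_def f1_def agree_def)
  have h2: "held b c p f2 a"
    using g b2 skipped good_agree[OF g(1), of "{rH, rK}" f2] by (simp add: held_def f1_def f2_def agree_def)
  show ?thesis
    unfolding store_def
  proof (rule tri_time, rule tri_Seq, rule tri_Arith[where J = J, OF clean_J[OF cl]],
      rule tri_Seq, rule tri_Arith[where J = J])
    have e1: "f(rH := apply_arith Add (f h) (f rZero)) = f1"
      using f by (simp add: f1_def ready)
    have e2: "f1(rK := apply_arith Add (f1 rP) (f1 rOne)) = f2"
      using f ready by (simp add: f1_def f2_def)
    show "J (f(rH := apply_arith Add (f h) (f rZero))) a out"
      unfolding e1 using c1 by (rule clean_J)
    show "tri x J S write_block (6 * w + 4)
        ((f(rH := apply_arith Add (f h) (f rZero)))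
         (rK := apply_arith Add ((f(rH := apply_arith Add (f h) (f rZero))) rP)
           ((f(rH := apply_arith Add (f h) (f rZero))) rOne))) a out Q"
      unfolding e1 e2
    proof (rule tri_write_block[OF held_J[OF h2]])
      show "ready f2"
        using h2 by (simp add: held_def good_def)
      show "f2 rK = Suc p" "f2 rP = p" "f2 rX = y"
        using f by (simp_all add: f1_def f2_def)
      fix f' a'
      assume f': "J f' a' out" "agree {ra, re, ry, rX} f2 f'" "block w a' p = y"
        "\<And>k. k \<noteq> p \<Longrightarrow> block w a' k = block w a k"
      have "good b c f'"
        using h2 J_fits[OF f'(1)] by (intro good_agree[OF _ f'(2)]) (auto simp: held_def)
      then have "held b c p f' a'"
        using h2 f'(2,4) by (simp add: held_def agree_def)
      moreover have "agree {rH, rK, ra, re, ry, rX} f f'"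
        using f'(2) by (auto simp: agree_def f1_def f2_def)
      ultimately show "Q f' a' out"
        using Q f'(3) by blast
    qed fact+
  qed simp
qed

lemma block_state_less: "block w \<tau> k < W"
  using block_less W_def by simp

lemma state_succ_block:
  assumes "used c"
  shows "st b (succ_block c) = (st b c)(c := shift (block w \<tau> c) (inflow b (st b c) c))"
proof -
  have "st b (succ_block c) = st b (Suc c)"
    using succ_block[OF assms] block_state_less by (intro state_skip) auto
  then show ?thesis
    by simp
qed

lemma state_pred_block:
  assumes "used c" "0 < c" "k \<noteq> pred_block c"
  shows "st b (pred_block c) k = st b c k"
proof -
  have "st b c = st b (Suc (pred_block c))"
    using pred_block[OF assms(1,2)] block_state_less by (intro state_skip) auto
  then show ?thesis
    using assms(3) by simp
qed

lemma clean_K: "held b c p f a \<Longrightarrow> block w a p = st b c p \<Longrightarrow> clean b c (f(rK := 0)) a"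
  by (auto simp: held_def clean_def good_def ready_def fun_eq_iff intro: fits_upd)

lemma tri_forward:
  assumes cl: "clean b c f a" and c: "c < n * n * n" "used c"
  shows "tri x J S forward (24 * w + 120) f a out
    (\<lambda>f' a' out'. clean b (succ_block c) f' a' \<and> f' rA = f rA \<and> out' = out)"
    (is "tri _ _ _ _ _ _ _ _ ?Q")
proof -
  have c_le: "c \<le> M"
    using c(1) M_bounds(3) by simp
  let ?new = "shift (block w \<tau> c) (inflow b (st b c) c)"
  have s: "succ_block c \<le> n * n * n"
    using succ_block c by blast
  have move: "tri x J S (IfLess rt rd (Do (Arith Add rC rC rOne)) (code [Arith Sub rt rN rt] ;; Do (Arith Add rC rC rt)) ;;
      Do (Const rK 0)) 6 g a' out ?Q"
    if g: "held b c c g a'" "block w a' c = ?new" "g rA = f rA" "g rt = c mod n" "g rd = length (nb (vert c))"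
    for g a'
  proof -
    note J = held_J[OF g(1)]
    have good: "good b c g"
      using g(1) by (simp add: held_def)
    note ready = readyD[OF goodD(1)[OF good]]
    have C: "g rC = c"
      using good by (simp add: good_def)
    have blocks: "block w a' = st b (succ_block c)"
      using g(1,2) by (auto simp: state_succ_block[OF c(2)] held_def)
    \<comment> \<open>The moment between the update of \<open>rC\<close> and the removal of the
      mark: block \<open>c\<close> is held with respect to the new position, and it already has the
      content that \<open>state\<close> prescribes.\<close>
    have last: "tri x J S (Do (Const rK 0)) 1 h a' out ?Q \<and> J h a' out"
      if h: "h rC = succ_block c" "agree {rC, rt} g h" "fits M h" for h
    proof -
      have "good b (succ_block c) h"
        using good h s by (simp add: good_def ready_def agree_def)
      moreover have "\<forall>k. c < k \<and> k < succ_block c \<longrightarrow> \<not> used k"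
        using succ_block(3)[OF c(2)] by auto
      ultimately have "held b (succ_block c) c h a'"
        using g(1) h blocks by (simp add: held_def agree_def)
      moreover from clean_K[OF this] have "clean b (succ_block c) (h(rK := 0)) a'"
        using blocks by simp
      moreover have "h rA = f rA"
        using g(3) h(2) by (simp add: agree_def)
      ultimately show ?thesis
        by (intro conjI tri_Const held_J) auto
    qed
    have upd: "fits M (g(rC := succ_block c))"
      using J_fits[OF J] s M_bounds(3) by (intro fits_upd) auto
    show ?thesis
    proof (rule tri_time, rule tri_Seq, rule tri_If_J[OF J])
      assume "g rt < g rd"
      then have "g rC + 1 = succ_block c"
        using g by (simp add: succ_block_def C)
      then show "tri x J S (Do (Arith Add rC rC rOne)) 1 g a' out (\<lambda>f a out. tri x J S (Do (Const rK 0)) 1 f a out ?Q)"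
        using last upd by (intro tri_Arith J) (simp_all add: ready agree_def)
    next
      assume "\<not> g rt < g rd"
      then have e: "c + (n - c mod n) = succ_block c"
        using g by (simp add: succ_block_def)
      show "tri x J S (code [Arith Sub rt rN rt] ;; Do (Arith Add rC rC rt)) (1 + 1) g a' out
          (\<lambda>f a out. J f a out \<and> tri x J S (Do (Const rK 0)) 1 f a out ?Q)"
      proof (rule tri_time, rule tri_code_SeqI[OF J])
        show "straight x {10..<60} M [Arith Sub rt rN rt] g (\<lambda>h. h = g(rt := n - c mod n))"
          using g n_le_M(1) by (simp add: ready)
        fix h
        assume h: "J h a' out" "h = g(rt := n - c mod n)"
        have "h rC + h rt = succ_block c"
          using e C by (simp add: h(2))
        moreover have "fits M (h(rC := succ_block c))"
          using J_fits[OF h(1)] s M_bounds(3) by (intro fits_upd) auto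
        ultimately show "tri x J S (Do (Arith Add rC rC rt)) 1 h a' out
            (\<lambda>f a out. J f a out \<and> tri x J S (Do (Const rK 0)) 1 f a out ?Q)"
          using last[of "h(rC := succ_block c)"] h(1)
          by (intro tri_Arith) (simp_all add: h(2) agree_def)
      qed simp
    qed simp
  qed
  show ?thesis
    unfolding forward_def
  proof (rule tri_time, rule tri_code_SeqI[OF clean_J[OF cl]])
    have good: "good b c f"
      using cl by (simp add: clean_def)
    show "straight x {10..<60} M [Arith Add rP rC rZero] f (\<lambda>g. g = f(rP := c))"
      using c_le good by (simp add: good_def ready_def)
    fix g
    assume g: "J g a out" "g = f(rP := c)"
    have clg: "clean b c g a"
      by (rule clean_agree[OF cl _ _ J_fits[OF g(1)], where V = "{rP}"]) (auto simp: g(2) agree_def)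
    show "tri x J S (calc_inflow ;; calc_shift ;; store rOld ;;
       code [Arith Mod rt rP rN, Arith Div rv rP rN, Arith Mod rv rv rN, Arith Add rv rv rOne, Ask In_Degree rd rv rv] ;;
       IfLess rt rd (Do (Arith Add rC rC rOne)) (code [Arith Sub rt rN rt] ;; Do (Arith Add rC rC rt)) ;;
       Do (Const rK 0)) (12 * w + 60 + (6 * w + 25 + (6 * w + 6 + (5 + 6)))) g a out ?Q"
    proof (rule tri_Seq, rule tri_calc_inflow[OF g(1), where p = c])
      show "ready g" "g rP = c" "c < n * n * n \<or> c mod n = 0 \<and> c < (n + 1) * (n * n)"
        using clg c by (simp_all add: clean_def good_def g(2))
      fix h
      assume h: "J h a out" "agree {rF, rk, ra, re, ry, rX, rj, ri, rv, rd, ru} g h"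
        "h rF = inflow (g rBit) (block w a) c"
      have clh: "clean b c h a"
        using clg h(2) by (rule clean_agree) (use J_fits[OF h(1)] in auto)
      have hF: "h rF = inflow b (st b c) c"
        using h(3) clg by (simp add: clean_def good_def)
      have hA: "h rP = c" "h rA = f rA"
        using h(2) by (simp_all add: agree_def g(2))
      show "tri x J S (calc_shift ;; store rOld ;;
       code [Arith Mod rt rP rN, Arith Div rv rP rN, Arith Mod rv rv rN, Arith Add rv rv rOne, Ask In_Degree rd rv rv] ;;
       IfLess rt rd (Do (Arith Add rC rC rOne)) (code [Arith Sub rt rN rt] ;; Do (Arith Add rC rC rt)) ;;
       Do (Const rK 0)) (6 * w + 25 + (6 * w + 6 + (5 + 6))) h a out ?Q"
      proof (rule tri_Seq, rule tri_calc_shift[OF h(1)])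
        show "ready h" "h rF \<le> q"
          using clh inflow_less[of b "st b c" c] by (simp_all add: clean_def good_def hF)
        fix h'
        assume h': "J h' a out" "agree {rk, ra, re, ry, rX, rOld, ru, rt} h h'"
          "h' rOld = block w a c" "h' rX = shift (block w a c) (h rF)"
        have clh': "clean b c h' a"
          using clh h'(2) by (rule clean_agree) (use J_fits[OF h'(1)] in auto)
        \<comment> \<open>The sweep has not reached block \<open>c\<close>, so its present content
          is the original one and \<open>rOld\<close> is the right value to hold.\<close>
        have X: "block w a c = block w \<tau> c"
          using clh' by (simp add: clean_def state_ge)
        have hA': "h' rP = c" "h' rA = f rA"
          using h'(2) hA by (simp_all add: agree_def)
        show "tri x J S (store rOld ;;
         code [Arith Mod rt rP rN, Arith Div rv rP rN, Arith Mod rv rv rN, Arith Add rv rv rOne, Ask In_Degree rd rv rv] ;;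
         IfLess rt rd (Do (Arith Add rC rC rOne)) (code [Arith Sub rt rN rt] ;; Do (Arith Add rC rC rt)) ;;
         Do (Const rK 0)) (6 * w + 6 + (5 + 6)) h' a out ?Q"
        proof (rule tri_Seq, rule tri_store[OF clh' hA'(1)])
          show "h' rOld = block w \<tau> c" "h' rX = ?new"
            using h'(3,4) by (simp_all add: X hF)
          show "?new < W"
            by (rule shift_less)
          fix k a'
          assume k: "held b c c k a'" "block w a' c = ?new" "agree {rH, rK, ra, re, ry, rX} h' k"
          have kA: "k rP = c" "k rA = f rA"
            using k(3) hA' by (simp_all add: agree_def)
          have goodk: "good b c k"
            using k(1) by (simp add: held_def)
          note ready = readyD[OF goodD(1)[OF goodk]]
          have bounds: "c mod n \<le> M" "c div n \<le> M" "c div n mod n \<le> M" "vert c \<le> M" "length (nb (vert c)) \<le> M"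
          proof -
            show "c mod n \<le> M" "c div n \<le> M"
              using c_le mod_less_eq_dividend div_le_dividend order_trans by blast+
            then show "c div n mod n \<le> M"
              using mod_less_eq_dividend order_trans by blast
            show "vert c \<le> M" "length (nb (vert c)) \<le> M"
              using vert_range[of c] nb_length[OF vert_range, of c] n_le_M(1) by auto
          qed
          show "tri x J S (code [Arith Mod rt rP rN, Arith Div rv rP rN, Arith Mod rv rv rN, Arith Add rv rv rOne, Ask In_Degree rd rv rv] ;;
           IfLess rt rd (Do (Arith Add rC rC rOne)) (code [Arith Sub rt rN rt] ;; Do (Arith Add rC rC rt)) ;;
           Do (Const rK 0)) (5 + 6) k a' out ?Q"
          proof (rule tri_time, rule tri_code_SeqI[OF held_J[OF k(1)]])
            show "straight x {10..<60} M
              [Arith Mod rt rP rN, Arith Div rv rP rN, Arith Mod rv rv rN, Arith Add rv rv rOne, Ask In_Degree rd rv rv] k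
              (\<lambda>k'. agree {rt, rv, rd} k k' \<and> k' rt = c mod n \<and> k' rd = length (nb (vert c)))"
              using bounds answers(1)[OF vert_range, of c] kA
              by (simp add: ready agree_def vert_def del: answer.simps)
            fix k'
            assume k': "J k' a' out" "agree {rt, rv, rd} k k' \<and> k' rt = c mod n \<and> k' rd = length (nb (vert c))"
            have "good b c k'"
              using goodk conjunct1[OF k'(2)] by (rule good_agree) (use J_fits[OF k'(1)] in auto)
            then have "held b c c k' a'"
              using k(1) k'(2) by (simp add: held_def agree_def)
            then show "tri x J S (IfLess rt rd (Do (Arith Add rC rC rOne)) (code [Arith Sub rt rN rt] ;; Do (Arith Add rC rC rt)) ;;
               Do (Const rK 0)) 6 k' a' out ?Q"
              by (rule move) (use k(2) k'(2) kA in \<open>simp_all add: agree_def\<close>)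
          qed simp
        qed (use c in simp_all)
      qed (use c hA in simp_all)
    qed
  qed simp
qed

lemma tri_backward:
  assumes cl: "clean b c f a" and c: "0 < c" "used c"
  shows "tri x J S backward (24 * w + 120) f a out
    (\<lambda>f' a' out'. clean b (pred_block c) f' a' \<and> f' rA = f rA \<and> f' rA' = f rA' \<and> out' = out)"
    (is "tri _ _ _ _ _ _ _ _ ?Q")
proof -
  define p where "p = pred_block c"
  have c_le: "c \<le> n * n * n"
    using cl by (simp add: clean_def good_def)
  have p: "p < c" "used p" "p < n * n * n" "p \<le> M"
    using pred_block[OF c(2,1)] c_le M_bounds(3) by (simp_all add: p_def)
  have c_leM: "c \<le> M"
    using c_le M_bounds(3) by simp
  let ?rest = "calc_inflow ;; code [Arith Sub rF rQ rF] ;; calc_shift ;; store rX ;;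
     Do (Arith Add rC rP rZero) ;; Do (Const rK 0)"
  have rest: "tri x J S ?rest (12 * w + 60 + (1 + (6 * w + 25 + (6 * w + 6 + (1 + 1))))) g a out ?Q"
    if g: "clean b c g a" "g rP = p" "g rA = f rA" "g rA' = f rA'" for g
  proof (rule tri_Seq, rule tri_calc_inflow[OF clean_J[OF g(1)], where p = p])
    show "ready g" "g rP = p" "p < n * n * n \<or> p mod n = 0 \<and> p < (n + 1) * (n * n)"
      using g p by (simp_all add: clean_def good_def)
    fix h
    assume h: "J h a out" "agree {rF, rk, ra, re, ry, rX, rj, ri, rv, rd, ru} g h"
      "h rF = inflow (g rBit) (block w a) p"
    have clh: "clean b c h a"
      using g(1) h(2) by (rule clean_agree) (use J_fits[OF h(1)] in auto)
    let ?F = "inflow b (st b c) p"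
    have hF: "h rF = ?F"
      using h(3) g(1) by (simp add: clean_def good_def)
    have F: "?F < q"
      by (rule inflow_less)
    have hP: "h rP = p" "h rA = f rA" "h rA' = f rA'"
      using h(2) g by (simp_all add: agree_def)
    show "tri x J S (code [Arith Sub rF rQ rF] ;; calc_shift ;; store rX ;;
       Do (Arith Add rC rP rZero) ;; Do (Const rK 0)) (1 + (6 * w + 25 + (6 * w + 6 + (1 + 1)))) h a out ?Q"
    proof (rule tri_time, rule tri_code_SeqI[OF h(1)])
      show "straight x {10..<60} M [Arith Sub rF rQ rF] h (\<lambda>i. i = h(rF := q - ?F))"
        using clh q_le_M by (simp add: hF clean_def good_def ready_def)
      fix i
      assume i: "J i a out" "i = h(rF := q - ?F)"
      have cli: "clean b c i a"
        by (rule clean_agree[OF clh _ _ J_fits[OF i(1)], where V = "{rF}"]) (auto simp: i(2) agree_def)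
      show "tri x J S (calc_shift ;; store rX ;;
       Do (Arith Add rC rP rZero) ;; Do (Const rK 0)) (6 * w + 25 + (6 * w + 6 + (1 + 1))) i a out ?Q"
      proof (rule tri_Seq, rule tri_calc_shift[OF i(1)])
        show "ready i" "i rP = p" "i rF \<le> q"
          using cli hP by (simp_all add: clean_def good_def i(2))
        fix i'
        assume i': "J i' a out" "agree {rk, ra, re, ry, rX, rOld, ru, rt} i i'"
          "i' rOld = block w a p" "i' rX = shift (block w a p) (i rF)"
        have cli': "clean b c i' a"
          using cli i'(2) by (rule clean_agree) (use J_fits[OF i'(1)] in auto)
        \<comment> \<open>The inflow that was once added is recomputed from the current tape, so
          that the shift by \<open>q - ?F\<close> recovers the original content.\<close>
        have "block w a p = shift (block w \<tau> p) ?F"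
          using clh state_at[OF p(1), of "block w \<tau>" b] by (simp add: clean_def)
        then have X: "i' rX = block w \<tau> p"
          using i'(4) shift_inverse[OF block_state_less F] by (simp add: i(2))
        have iP: "i' rP = p" "i' rA = f rA" "i' rA' = f rA'"
          using i'(2) hP by (simp_all add: agree_def i(2))
        show "tri x J S (store rX ;; Do (Arith Add rC rP rZero) ;; Do (Const rK 0))
            (6 * w + 6 + (1 + 1)) i' a out ?Q"
        proof (rule tri_Seq, rule tri_store[OF cli' iP(1) X X _ _ block_state_less p(3)])
          show "\<not> used k" if "p < k" "k < c" for k
            using pred_block(3)[OF c(2,1), of k] that by (simp add: p_def)
          fix k a'
          assume k: "held b c p k a'" "block w a' p = block w \<tau> p" "agree {rH, rK, ra, re, ry, rX} i' k"
          have goodk: "good b c k"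
            using k(1) by (simp add: held_def)
          let ?k = "k(rC := p)"
          have "fits M ?k"
            using goodk p(4) by (intro fits_upd) (auto simp: good_def)
          then have "good b p ?k"
            using goodk p(3) by (simp add: good_def ready_def)
          moreover have "block w a' l = st b p l" if "l \<noteq> p" for l
            using k(1) that state_pred_block[OF c(2,1), of l] by (simp add: held_def p_def)
          ultimately have heldp: "held b p p ?k a'"
            using k(1) by (simp add: held_def)
          have clp: "clean b p (?k(rK := 0)) a'"
            by (rule clean_K[OF heldp]) (simp add: k(2) state_ge)
          have e: "k(rC := apply_arith Add (k rP) (k rZero)) = ?k"
            using goodk k(3) iP by (simp add: good_def ready_def agree_def)
          show "tri x J S (Do (Arith Add rC rP rZero) ;; Do (Const rK 0)) (1 + 1) k a' out ?Q"
          proof (rule tri_Seq, rule tri_Arith[where J = J, OF held_J[OF k(1)]], unfold e,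
              rule tri_Const[where J = J, OF held_J[OF heldp]])
            show "?Q (?k(rK := 0)) a' out"
              using clp k(3) iP by (simp add: agree_def p_def)
          qed
        qed simp
      qed (use p in simp_all)
    qed simp
  qed
  note J = clean_J[OF cl]
  note ready = readyD[OF goodD(1), of b c f]
  have good: "good b c f"
    using cl by (simp add: clean_def)
  note ready = readyD[OF goodD(1)[OF good]]
  have C: "f rC = c"
    using good by (simp add: good_def)
  have clV: "clean b c g a" if "agree {rt, rv, rd, rP} f g" "J g a out" for g
    using cl that(1) by (rule clean_agree) (use J_fits[OF that(2)] in auto)
  show ?thesis
    unfolding backward_def
  proof (rule tri_time, rule tri_code_SeqI[OF J])
    have "c mod n \<le> M"
      using c_leM mod_less_eq_dividend order_trans by blast
    then show "straight x {10..<60} M [Arith Mod rt rC rN] f (\<lambda>g. g = f(rt := c mod n))"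
      by (simp add: ready C)
    fix g
    assume g: "J g a out" "g = f(rt := c mod n)"
    have ag: "agree {rt, rv, rd, rP} f g"
      by (simp add: g(2) agree_def)
    note clg = clV[OF ag g(1)]
    show "tri x J S (IfLess rZero rt (code [Arith Sub rP rC rOne])
       (code [Arith Sub rv rC rOne, Arith Div rv rv rN, Arith Mod rv rv rN, Arith Add rv rv rOne,
              Ask In_Degree rd rv rv, Arith Sub rP rC rN, Arith Add rP rP rd]) ;; ?rest)
       (1 + 7 + 2 + (12 * w + 60 + (1 + (6 * w + 25 + (6 * w + 6 + (1 + 1)))))) g a out ?Q"
    proof (rule tri_Seq, rule tri_If_J[OF g(1)])
      assume "g rZero < g rt"
      then have pc: "p = c - 1"
        by (simp add: g(2) ready p_def pred_block_def)
      show "tri x J S (code [Arith Sub rP rC rOne]) 1 g a out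
          (\<lambda>f a out. tri x J S ?rest (12 * w + 60 + (1 + (6 * w + 25 + (6 * w + 6 + (1 + 1))))) f a out ?Q)"
      proof (rule tri_codeI[OF g(1)])
        show "straight x {10..<60} M [Arith Sub rP rC rOne] g (\<lambda>h. h = g(rP := p))"
          using p(4) by (simp add: g(2) ready C pc)
        fix h
        assume h: "J h a out" "h = g(rP := p)"
        have "clean b c h a"
          by (rule clV) (use h g(2) in \<open>simp_all add: agree_def\<close>)
        then show "tri x J S ?rest (12 * w + 60 + (1 + (6 * w + 25 + (6 * w + 6 + (1 + 1))))) h a out ?Q"
          by (rule rest) (simp_all add: h(2) g(2))
      qed simp
    next
      assume "\<not> g rZero < g rt"
      then have pc: "p = c - n + length (nb (vert (c - 1)))"
        by (simp add: g(2) ready p_def pred_block_def)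
      let ?v = "(c - 1) div n"
      have v: "?v mod n + 1 = vert (c - 1)"
        by (simp add: vert_def)
      have bounds: "c - 1 \<le> M" "?v \<le> M" "?v mod n \<le> M" "vert (c - 1) \<le> M" "length (nb (vert (c - 1))) \<le> M"
        "c - n \<le> M"
      proof -
        show "c - 1 \<le> M" "c - n \<le> M"
          using c_leM by simp_all
        then show "?v \<le> M"
          using div_le_dividend order_trans by blast
        then show "?v mod n \<le> M"
          using mod_less_eq_dividend order_trans by blast
        show "vert (c - 1) \<le> M" "length (nb (vert (c - 1))) \<le> M"
          using vert_range[of "c - 1"] nb_length[OF vert_range, of "c - 1"] n_le_M(1) by auto
      qed
      show "tri x J S (code [Arith Sub rv rC rOne, Arith Div rv rv rN, Arith Mod rv rv rN, Arith Add rv rv rOne,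
              Ask In_Degree rd rv rv, Arith Sub rP rC rN, Arith Add rP rP rd]) 7 g a out
          (\<lambda>f a out. J f a out \<and>
             tri x J S ?rest (12 * w + 60 + (1 + (6 * w + 25 + (6 * w + 6 + (1 + 1))))) f a out ?Q)"
      proof (rule tri_codeI[OF g(1)])
        show "straight x {10..<60} M [Arith Sub rv rC rOne, Arith Div rv rv rN, Arith Mod rv rv rN, Arith Add rv rv rOne,
              Ask In_Degree rd rv rv, Arith Sub rP rC rN, Arith Add rP rP rd] g
            (\<lambda>h. agree {rv, rd, rP} g h \<and> h rP = p)"
          using bounds answers(1)[OF vert_range, of "c - 1"] v p(4) pc
          by (simp add: g(2) ready C agree_def del: answer.simps)
        fix h
        assume h: "J h a out" "agree {rv, rd, rP} g h \<and> h rP = p"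
        then have "agree {rt, rv, rd, rP} f h"
          using ag by (simp add: agree_def)
        note clh = clV[OF this h(1)]
        have "tri x J S ?rest (12 * w + 60 + (1 + (6 * w + 25 + (6 * w + 6 + (1 + 1))))) h a out ?Q"
          by (rule rest[OF clh]) (use h(2) in \<open>simp_all add: agree_def g(2)\<close>)
        with h(1) show "J h a out \<and>
            tri x J S ?rest (12 * w + 60 + (1 + (6 * w + 25 + (6 * w + 6 + (1 + 1))))) h a out ?Q" ..
      qed simp
    qed
  qed simp
qed

definition blocks :: nat where
  "blocks = card {k. k < n * n * n \<and> used k}"

text \<open>Both loops are measured by used blocks, those still ahead of \<open>rC\<close> and those
  below it. The result is read off between them, while the tape is in its final state.\<close>

lemma tri_there_and_back:
  assumes cl: "clean b 0 f a"
  shows "tri x J S there_and_back ((2 * blocks + 1) * (24 * w + 140)) f a out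
    (\<lambda>f' a' out'. clean b 0 f' a' \<and> f' rA = f rA \<and> out' = out \<and>
       f' rA' = inflow b (st b (n * n * n)) (start n (target x)))"
    (is "tri _ _ _ _ _ _ _ _ ?Q")
proof -
  let ?top = "n * n * n"
  let ?v = "inflow b (st b ?top) (start n (target x))"
  define I where "I f' a' out' \<longleftrightarrow>
      out' = out \<and> f' rA = f rA \<and> (\<exists>c. clean b c f' a' \<and> used c)" for f' a' out'
  define I' where "I' f' a' out' \<longleftrightarrow> I f' a' out' \<and> f' rA' = ?v" for f' a' out'
  let ?\<mu> = "\<lambda>f'. card {k. f' rC \<le> k \<and> k < ?top \<and> used k}"
  let ?\<nu> = "\<lambda>f'. card {k. k < f' rC \<and> used k}"
  let ?mid = "code [Ask Target rt rZero rZero, Arith Sub rt rt rOne, Arith Mult rt rt rN, Arith Add rP rTop rt] ;;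
     calc_inflow ;; code [Arith Add rA' rF rZero] ;; WhileLess rZero rC backward"
  have C: "f rC = 0"
    using cl by (simp add: clean_def good_def)
  have inwards: "tri x J S (WhileLess rZero rC backward) (blocks * (24 * w + 120 + 2) + 2) g a' out ?Q"
    if g: "clean b ?top g a'" "g rA = f rA" "g rA' = ?v" for g a'
  proof (rule tri_While[where I = I' and \<mu> = ?\<nu> and t = "24 * w + 120"])
    show "I' g a' out"
      using g used_top by (auto simp: I_def I'_def)
    show "blocks * (24 * w + 120 + 2) + 2 = ?\<nu> g * (24 * w + 120 + 2) + 2"
      using g(1) by (simp add: blocks_def clean_def good_def)
    show "J h a'' out''" if "I' h a'' out''" for h a'' out''
      using that clean_J by (auto simp: I_def I'_def)
    show "J h a'' out'' \<and> ?Q h a'' out''" if h: "I' h a'' out''" "\<not> h rZero < h rC" for h a'' out''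
    proof -
      obtain c where c: "clean b c h a''"
        using h by (auto simp: I_def I'_def)
      then have "c = 0"
        using h(2) by (simp add: clean_def good_def ready_def)
      then show ?thesis
        using c h(1) clean_J by (auto simp: I_def I'_def)
    qed
    show "J h a'' out'' \<and> tri x J S backward (24 * w + 120) h a'' out''
        (\<lambda>h' a' out'. I' h' a' out' \<and> ?\<nu> h' < ?\<nu> h)"
      if h: "I' h a'' out''" "h rZero < h rC" for h a'' out''
    proof -
      obtain c where c: "clean b c h a''" "used c"
        using h by (auto simp: I_def I'_def)
      have hC: "h rC = c" "0 < c"
        using h(2) c by (simp_all add: clean_def good_def ready_def)
      note pb = pred_block[OF c(2) hC(2)]
      have "card {k. k < pred_block c \<and> used k} < card {k. k < c \<and> used k}"
        using pb by (intro psubset_card_mono) auto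
      then have "?\<nu> h' < ?\<nu> h" if "clean b (pred_block c) h' a3" for h' a3
        using that by (simp add: clean_def good_def hC)
      then have "tri x J S backward (24 * w + 120) h a'' out''
          (\<lambda>h' a' out'. I' h' a' out' \<and> ?\<nu> h' < ?\<nu> h)"
        by - (rule tri_mono[OF tri_backward[OF c(1) hC(2) c(2)] order_refl],
          use h(1) pb(2) in \<open>auto simp: I_def I'_def\<close>)
      with clean_J[OF c(1)] show ?thesis ..
    qed
  qed
  have mid: "tri x J S ?mid (4 + (12 * w + 60 + (1 + (blocks * (24 * w + 120 + 2) + 2)))) g a' out ?Q"
    if g: "clean b ?top g a'" "g rA = f rA" for g a'
  proof (rule tri_time, rule tri_code_SeqI[OF clean_J[OF g(1)]])
    have good: "good b ?top g"
      using g(1) by (simp add: clean_def)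
    note ready = readyD[OF goodD(1)[OF good]]
    have s: "start n (target x) = ?top + (target x - 1) * n"
      by (simp add: start_def mult.assoc)
    have "(target x - 1) * n \<le> n * n"
      using target_range by (intro mult_le_mono1) auto
    then have "(target x - 1) * n \<le> M" "?top + (target x - 1) * n \<le> M"
      using n_le_M M_bounds(3) by linarith+
    moreover have "target x \<le> M" "target x - 1 \<le> M"
      using target_range n_le_M(1) by auto
    note bounds = calculation this
    show "straight x {10..<60} M
        [Ask Target rt rZero rZero, Arith Sub rt rt rOne, Arith Mult rt rt rN, Arith Add rP rTop rt] g
        (\<lambda>h. h = g(rt := (target x - 1) * n, rP := start n (target x)))"
      using bounds goodD(5)[OF good] by (simp add: ready s)
    fix h
    assume h: "J h a' out" "h = g(rt := (target x - 1) * n, rP := start n (target x))"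
    have clh: "clean b ?top h a'"
      by (rule clean_agree[OF g(1) _ _ J_fits[OF h(1)], where V = "{rt, rP}"]) (auto simp: h(2) agree_def)
    show "tri x J S (calc_inflow ;; code [Arith Add rA' rF rZero] ;; WhileLess rZero rC backward)
        (12 * w + 60 + (1 + (blocks * (24 * w + 120 + 2) + 2))) h a' out ?Q"
    proof (rule tri_Seq, rule tri_calc_inflow[OF h(1), where p = "start n (target x)"])
      show "ready h" "h rP = start n (target x)"
        using clh by (simp_all add: clean_def good_def h(2))
      show "start n (target x) < ?top \<or> start n (target x) mod n = 0 \<and> start n (target x) < (n + 1) * (n * n)"
        using index_simps(1)[OF target_range, of 0 n] start_add_less[OF target_range, of 0 n] n_pos by simp
      fix h'
      assume h': "J h' a' out" "agree {rF, rk, ra, re, ry, rX, rj, ri, rv, rd, ru} h h'"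
        "h' rF = inflow (h rBit) (block w a') (start n (target x))"
      have clh': "clean b ?top h' a'"
        using clh h'(2) by (rule clean_agree) (use J_fits[OF h'(1)] in auto)
      have F: "h' rF = ?v" "h' rA = f rA"
        using h'(2,3) clh g(2) by (simp_all add: clean_def good_def agree_def h(2))
      show "tri x J S (code [Arith Add rA' rF rZero] ;; WhileLess rZero rC backward)
          (1 + (blocks * (24 * w + 120 + 2) + 2)) h' a' out ?Q"
      proof (rule tri_time, rule tri_code_SeqI[OF h'(1)])
        show "straight x {10..<60} M [Arith Add rA' rF rZero] h' (\<lambda>k. k = h'(rA' := ?v))"
          using F inflow_less[of b "st b ?top" "start n (target x)"] q_le_M clh'
          by (simp add: clean_def good_def ready_def)
        fix k
        assume k: "J k a' out" "k = h'(rA' := ?v)"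
        have "clean b ?top k a'"
          by (rule clean_agree[OF clh' _ _ J_fits[OF k(1)], where V = "{rA'}"]) (auto simp: k(2) agree_def)
        then show "tri x J S (WhileLess rZero rC backward) (blocks * (24 * w + 120 + 2) + 2) k a' out ?Q"
          by (rule inwards) (simp_all add: k(2) F)
      qed simp
    qed
  qed simp
  show ?thesis
    unfolding there_and_back_def
  proof (rule tri_time, rule tri_Seq, rule tri_While[where I = I and \<mu> = ?\<mu> and t = "24 * w + 120"])
    show "I f a out"
      using cl used_0 by (auto simp: I_def)
    show "blocks * (24 * w + 120 + 2) + 2 = ?\<mu> f * (24 * w + 120 + 2) + 2"
      by (simp add: blocks_def C)
    show "J h a'' out''" if "I h a'' out''" for h a'' out''
      using that clean_J by (auto simp: I_def)
    show "J h a'' out'' \<and> tri x J S ?mid (4 + (12 * w + 60 + (1 + (blocks * (24 * w + 120 + 2) + 2)))) h a'' out'' ?Q"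
      if h: "I h a'' out''" "\<not> h rC < h rTop" for h a'' out''
    proof -
      obtain c where c: "clean b c h a''"
        using h by (auto simp: I_def)
      then have "c = ?top"
        using h(2) by (simp add: clean_def good_def)
      then show ?thesis
        using c h(1) clean_J mid by (auto simp: I_def)
    qed
    show "J h a'' out'' \<and> tri x J S forward (24 * w + 120) h a'' out''
        (\<lambda>h' a' out'. I h' a' out' \<and> ?\<mu> h' < ?\<mu> h)"
      if h: "I h a'' out''" "h rC < h rTop" for h a'' out''
    proof -
      obtain c where c: "clean b c h a''" "used c"
        using h by (auto simp: I_def)
      have hC: "h rC = c" "c < ?top"
        using h(2) c by (simp_all add: clean_def good_def)
      note sb = succ_block[OF c(2)]
      have "card {k. succ_block c \<le> k \<and> k < ?top \<and> used k} < card {k. c \<le> k \<and> k < ?top \<and> used k}"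
      proof (rule psubset_card_mono)
        have "c \<in> {k. c \<le> k \<and> k < ?top \<and> used k} - {k. succ_block c \<le> k \<and> k < ?top \<and> used k}"
          using sb(1) c(2) hC(2) by simp
        moreover have "{k. succ_block c \<le> k \<and> k < ?top \<and> used k} \<subseteq> {k. c \<le> k \<and> k < ?top \<and> used k}"
          using sb(1) by (intro Collect_mono) (metis less_imp_le order_trans)
        ultimately show "{k. succ_block c \<le> k \<and> k < ?top \<and> used k} \<subset> {k. c \<le> k \<and> k < ?top \<and> used k}"
          by blast
      qed simp
      then have "?\<mu> h' < ?\<mu> h" if "clean b (succ_block c) h' a3" for h' a3
        using that by (simp add: clean_def good_def hC)
      then have "tri x J S forward (24 * w + 120) h a'' out''
          (\<lambda>h' a' out'. I h' a' out' \<and> ?\<mu> h' < ?\<mu> h)"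
        by - (rule tri_mono[OF tri_forward[OF c(1) hC(2) c(2)] order_refl],
          use h(1) sb(2) in \<open>auto simp: I_def\<close>)
      with clean_J[OF c(1)] show ?thesis ..
    qed
  qed (simp add: algebra_simps)
qed

text \<open>At position 0 the state is the original tape for either bit, so the bit can be switched
  there without violating the invariant.\<close>

lemma clean_Bit:
  assumes "clean b 0 f a" "b' \<le> 1"
  shows "clean b' 0 (f(rBit := b')) a"
proof -
  have "fits M (f(rBit := b'))"
    using assms M_1 by (intro fits_upd) (auto simp: clean_def good_def)
  then show ?thesis
    using assms by (simp add: clean_def good_def ready_def)
qed

lemma tri_compare:
  assumes cl: "clean b 0 f a"
  shows "tri x J S compare ((4 * blocks + 4) * (24 * w + 140)) f a out
    (\<lambda>f' a' out'. J f' a' out' \<and> a' = \<tau> \<and>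
       out' = out @ [inflow 0 (st 0 (n * n * n)) (start n (target x)) \<noteq>
                     inflow 1 (st 1 (n * n * n)) (start n (target x))])"
    (is "tri _ _ _ _ _ _ _ _ ?Q")
proof -
  let ?v = "\<lambda>b. inflow b (st b (n * n * n)) (start n (target x))"
  let ?t = "(2 * blocks + 1) * (24 * w + 140)"
  have \<tau>: "a = \<tau>" if "clean b 0 g a" for b g a
    using that by (intro block_inject[OF w_pos]) (simp add: clean_def)
  let ?emit = "IfLess rA rA' (Do (Emit rOne)) (IfLess rA' rA (Do (Emit rOne)) (Do (Emit rZero)))"
  have emit: "tri x J S ?emit (1 + (1 + 1 + 2) + 2) g a' out ?Q"
    if g: "clean 1 0 g a'" "g rA = ?v 0" "g rA' = ?v 1" for g a'
  proof -
    have J: "J g a' out'" for out'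
      by (rule clean_J[OF g(1)])
    have ready: "g rOne = 1" "g rZero = 0"
      using g(1) by (simp_all add: clean_def good_def ready_def)
    show ?thesis
      using J g \<tau>[OF g(1)] ready
      by (intro tri_If_J[OF J] tri_Emit J) auto
  qed
  show ?thesis
    unfolding compare_def
  proof (rule tri_time, rule tri_Seq, rule tri_Const[where J = J, OF clean_J[OF cl]],
      rule tri_Seq, rule tri_mono[OF tri_there_and_back[OF clean_Bit[OF cl]] order_refl])
    show "0 \<le> (1 :: nat)"
      by simp
    fix g a' out'
    assume g: "clean 0 0 g a' \<and> g rA = (f(rBit := 0)) rA \<and> out' = out \<and> g rA' = ?v 0"
    then have clg: "clean 0 0 g a'" and out': "out' = out"
      by auto
    show "tri x J S (code [Arith Add rA rA' rZero] ;; Do (Const rBit 1) ;; there_and_back ;; ?emit)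
        (1 + (1 + (?t + (1 + (1 + 1 + 2) + 2)))) g a' out' ?Q"
      unfolding out'
    proof (rule tri_time, rule tri_code_SeqI[OF clean_J[OF clg]])
      show "straight x {10..<60} M [Arith Add rA rA' rZero] g (\<lambda>h. h = g(rA := ?v 0))"
        using g inflow_less[of 0 "st 0 (n * n * n)" "start n (target x)"] q_le_M
        by (simp add: clean_def good_def ready_def)
      fix h
      assume h: "J h a' out" "h = g(rA := ?v 0)"
      have clh: "clean 0 0 h a'"
        by (rule clean_agree[OF clg _ _ J_fits[OF h(1)], where V = "{rA}"]) (auto simp: h(2) agree_def)
      show "tri x J S (Do (Const rBit 1) ;; there_and_back ;; ?emit)
          (1 + (?t + (1 + (1 + 1 + 2) + 2))) h a' out ?Q"
      proof (rule tri_Seq, rule tri_Const[where J = J, OF h(1)],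
          rule tri_Seq, rule tri_mono[OF tri_there_and_back[OF clean_Bit[OF clh]] order_refl])
        show "1 \<le> (1 :: nat)"
          by simp
        fix k a'' out''
        assume k: "clean 1 0 k a'' \<and> k rA = (h(rBit := 1)) rA \<and> out'' = out \<and> k rA' = ?v 1"
        then have "tri x J S ?emit (1 + (1 + 1 + 2) + 2) k a'' out ?Q"
          by (intro emit) (auto simp: h(2))
        then show "tri x J S ?emit (1 + (1 + 1 + 2) + 2) k a'' out'' ?Q"
          using k by simp
      qed
    qed simp
  qed (simp add: algebra_simps)
qed

end

section \<open>Most coin outcomes are good\<close>

text \<open>The coins form one number \<open>u\<close>, from which remainder and quotient extract
  modulus and shift. Since \<open>u\<close> ranges over a full product, the two are independent and
  uniform.\<close>

lemma card_mod_div: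
  assumes "0 < (b::nat)"
  shows "card {u. u < a * b \<and> P (u mod b) (u div b)} = (\<Sum>s<b. card {r. r < a \<and> P s r})"
proof -
  have "bij_betw (\<lambda>u. (u mod b, u div b)) {u. u < a * b \<and> P (u mod b) (u div b)} (SIGMA s:{..<b}. {r. r < a \<and> P s r})"
  proof (rule bij_betw_byWitness[where f' = "\<lambda>(s, r). r * b + s"])
    have "r * b + s < a * b" if "s < b" "r < a" for r s
    proof -
      have "r * b + s < (r + 1) * b"
        using that by simp
      also have "\<dots> \<le> a * b"
        using that by (intro mult_le_mono1) simp
      finally show ?thesis .
    qed
    then show "(\<lambda>(s, r). r * b + s) ` (SIGMA s:{..<b}. {r. r < a \<and> P s r}) \<subseteq> {u. u < a * b \<and> P (u mod b) (u div b)}"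
      by auto
  qed (use assms in \<open>auto simp: less_mult_imp_div_less\<close>)
  then have "card {u. u < a * b \<and> P (u mod b) (u div b)} = card (SIGMA s:{..<b}. {r. r < a \<and> P s r})"
    by (rule bij_betw_same_card)
  then show ?thesis
    by simp
qed

text \<open>For fixed \<open>y\<close> the map from \<open>r\<close> to \<open>(y + r) mod W\<close>
  is injective, and the bad values lie in the incomplete last interval, which has
  \<open>W mod q\<close> elements.\<close>

lemma card_not_whole:
  assumes "0 < q" "y < W"
  shows "card {r. r < W \<and> \<not> ((y + r) mod W div q + 1) * q \<le> W} \<le> q"
proof -
  have "card {r. r < W \<and> \<not> ((y + r) mod W div q + 1) * q \<le> W} \<le> card {W div q * q..<W}"
  proof (rule card_inj_on_le)
    show "inj_on (\<lambda>r. (y + r) mod W) {r. r < W \<and> \<not> ((y + r) mod W div q + 1) * q \<le> W}"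
    proof (rule inj_onI)
      fix r r'
      assume "r \<in> {r. r < W \<and> \<not> ((y + r) mod W div q + 1) * q \<le> W}" "r' \<in> {r. r < W \<and> \<not> ((y + r) mod W div q + 1) * q \<le> W}"
        "(y + r) mod W = (y + r') mod W"
      then have "[y + r = y + r'] (mod W)" "r < W" "r' < W"
        by (simp_all add: cong_def)
      then have "[r = r'] (mod W)"
        by (simp only: cong_add_lcancel_nat)
      with \<open>r < W\<close> \<open>r' < W\<close> show "r = r'"
        by (simp add: cong_def)
    qed
    show "(\<lambda>r. (y + r) mod W) ` {r. r < W \<and> \<not> ((y + r) mod W div q + 1) * q \<le> W} \<subseteq> {W div q * q..<W}"
    proof clarify
      fix r
      assume "r < W"
      assume nw: "\<not> ((y + r) mod W div q + 1) * q \<le> W"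
      let ?z = "(y + r) mod W"
      have "W < (?z div q + 1) * q"
        using nw by simp
      then have "W div q < ?z div q + 1"
        using assms(1) by (simp add: less_mult_imp_div_less)
      then have "W div q * q \<le> ?z div q * q"
        by (intro mult_le_mono1) simp
      also have "\<dots> \<le> ?z"
        by simp
      finally show "?z \<in> {W div q * q..<W}"
        using assms by simp
    qed
  qed simp
  also have "\<dots> = W mod q"
    using minus_div_mult_eq_mod[of W q] by simp
  also have "\<dots> \<le> q"
    using assms(1) by (simp add: less_imp_le)
  finally show ?thesis .
qed

text \<open>A union bound: moduli dividing \<open>N\<close> account for a quarter of the coins, and
  each of the \<open>n * n * n\<close> blocks is cut off for at most \<open>Q * Q\<close> of them,
  together another quarter.\<close>

lemma card_good_coins:
  assumes n: "0 < n" and Q: "2 ^ 15 * n ^ 32 \<le> Q" "4 * (n * n * n) * Q \<le> W"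
    and N: "0 < N" "N \<le> n ^ n" and X: "\<And>k. X k < W"
  shows "W * Q \<le> 2 * card {u. u < W * Q \<and> \<not> Suc (u mod Q) dvd N \<and>
    (\<forall>k < n * n * n. ((X k + u div Q) mod W div Suc (u mod Q) + 1) * Suc (u mod Q) \<le> W)}"
proof -
  let ?G = "{u. u < W * Q \<and> \<not> Suc (u mod Q) dvd N \<and> (\<forall>k < n * n * n. ((X k + u div Q) mod W div Suc (u mod Q) + 1) * Suc (u mod Q) \<le> W)}"
  let ?A = "{u. u < W * Q \<and> Suc (u mod Q) dvd N}"
  let ?B = "\<lambda>k. {u. u < W * Q \<and> \<not> ((X k + u div Q) mod W div Suc (u mod Q) + 1) * Suc (u mod Q) \<le> W}"
  have Q_pos: "0 < Q"
    using Q(1) n by (cases Q) auto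
  have A: "4 * card ?A \<le> W * Q"
  proof -
    have "card ?A = (\<Sum>s<Q. card {r. r < W \<and> Suc s dvd N})"
      using card_mod_div[OF Q_pos, of W "\<lambda>s r. Suc s dvd N"] by simp
    also have "\<dots> = (\<Sum>s<Q. if Suc s dvd N then W else 0)"
      by (intro sum.cong) auto
    also have "\<dots> = W * card {s. s < Q \<and> Suc s dvd N}"
      by (simp add: sum.If_cases Int_def)
    also have "card {s. s < Q \<and> Suc s dvd N} = card {q \<in> {1..Q}. q dvd N}"
      by (rule bij_betw_same_card[of Suc], rule bij_betw_byWitness[where f' = "\<lambda>q. q - 1"]) auto
    finally have "card ?A = W * card {q \<in> {1..Q}. q dvd N}" .
    moreover have "4 * card {q \<in> {1..Q}. q dvd N} \<le> Q"
    \<comment> \<open>From \<open>ln N \<le> n * ln n \<le> n ^ 2\<close>; the sixteenth power in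
      the bound for \<open>Q\<close> thus becomes \<open>n ^ 32\<close>.\<close>
    proof (rule card_divisors_le[OF N(1), of "n ^ 2"])
      have "ln (real N) \<le> ln (real (n ^ n))"
        using N by (intro ln_mono) (auto simp del: of_nat_power)
      also have "\<dots> = real n * ln (real n)"
        using n by (simp add: ln_realpow)
      also have "\<dots> \<le> real n * real n"
        using n ln_le_minus_one[of "real n"] by (intro mult_left_mono) auto
      finally show "ln (real N) \<le> real (n ^ 2)"
        by (simp add: power2_eq_square)
      show "1 \<le> n ^ 2"
        using n by simp
      show "2 ^ 15 * (n ^ 2) ^ 16 \<le> Q"
        using Q(1) by (simp flip: power_mult)
    qed
    ultimately show ?thesis
      by simp
  qed
  have B: "card (?B k) \<le> Q * Q" for k
  proof -
    have "card (?B k) = (\<Sum>s<Q. card {r. r < W \<and> \<not> ((X k + r) mod W div Suc s + 1) * Suc s \<le> W})"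
      using card_mod_div[OF Q_pos, of W "\<lambda>s r. \<not> ((X k + r) mod W div Suc s + 1) * Suc s \<le> W"] by simp
    also have "\<dots> \<le> (\<Sum>s<Q. Q)"
    proof (rule sum_mono)
      fix s
      assume "s \<in> {..<Q}"
      then show "card {r. r < W \<and> \<not> ((X k + r) mod W div Suc s + 1) * Suc s \<le> W} \<le> Q"
        using card_not_whole[OF _ X, of "Suc s" k] by simp
    qed
    finally show ?thesis
      by simp
  qed
  have fin: "finite {u. u < W * Q \<and> P u}" for P
    by simp
  have "card {..<W * Q} \<le> card (?G \<union> (?A \<union> (\<Union>k<n * n * n. ?B k)))"
    by (rule card_mono) auto
  also have "\<dots> \<le> card ?G + (card ?A + card (\<Union>k<n * n * n. ?B k))"
    by (intro order_trans[OF card_Un_le] add_mono order_refl card_Un_le)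
  also have "card (\<Union>k<n * n * n. ?B k) \<le> (\<Sum>k<n * n * n. card (?B k))"
    by (rule card_UN_le) simp
  also have "\<dots> \<le> n * n * n * (Q * Q)"
    using sum_mono[of "{..<n * n * n}" "\<lambda>k. card (?B k)" "\<lambda>k. Q * Q"] B by simp
  finally have le: "W * Q \<le> card ?G + (card ?A + n * n * n * (Q * Q))"
    by simp
  have "4 * (n * n * n * (Q * Q)) \<le> W * Q"
    using mult_le_mono1[OF Q(2), of Q] by (simp add: mult.assoc)
  with le A show ?thesis
    by linarith
qed

section \<open>The algorithm\<close>

abbreviation (input) "rQs \<equiv> 40 :: nat"
abbreviation (input) "rFull \<equiv> 41 :: nat"
abbreviation (input) "rz \<equiv> 42 :: nat"
abbreviation (input) "rCoins \<equiv> 43 :: nat"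
abbreviation (input) "rGoal \<equiv> 44 :: nat"

text \<open>\<open>rGoal\<close> becomes \<open>2 ^ 15 * n ^ 32\<close> by repeated squaring. The
  loop finds the least power of two that is not smaller and counts the exponent in
  \<open>rB\<close>, which is doubled because \<open>W\<close> is the square of that power.\<close>

definition initialize :: com where
  "initialize =
     code [Const rOne 1, Const rTwo 2, Ask Vertex_Count rN rN rN, Arith Mult rNN rN rN,
           Arith Mult rTop rNN rN, Arith Mult rGoal rNN rNN, Arith Mult rGoal rGoal rGoal,
           Arith Mult rGoal rGoal rGoal, Arith Mult rGoal rGoal rGoal, Const rz 32768,
           Arith Mult rGoal rGoal rz, Const rQs 1, Const rB 0] ;;
     WhileLess rQs rGoal (code [Arith Add rQs rQs rQs, Arith Add rB rB rOne]) ;;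
     code [Arith Add rB rB rB, Arith Mult rW rQs rQs, Arith Mult rFull rW rQs, Const rz 1, Const rCoins 0]"

text \<open>\<open>rz\<close> is doubled along with each coin and thus serves as a counter, so the
  loop test needs no logarithm.\<close>

definition flip_coins :: com where
  "flip_coins =
     WhileLess rz rFull
       (code [Arith Add rz rz rz, Arith Add rCoins rCoins rCoins] ;; Do (Flip ry) ;;
        code [Arith Add rCoins rCoins ry])"

definition use_coins :: com where
  "use_coins = code [Arith Div rR rCoins rQs, Arith Mod rQ rCoins rQs, Arith Add rQ rQ rOne]"

definition reach_com :: com where
  "reach_com = initialize ;; flip_coins ;; use_coins ;; compare"

text \<open>The threshold of \<open>card_divisors_le\<close> for \<open>y = n ^ 2\<close>.\<close>

definition goal :: "nat \<Rightarrow> nat" where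
  "goal n = 2 ^ 15 * n ^ 32"

definition bits :: "nat \<Rightarrow> nat" where
  "bits n = (LEAST k. goal n \<le> 2 ^ k)"

definition width :: "nat \<Rightarrow> nat" where
  "width n = 2 * bits n"

text \<open>The number of coin outcomes is the cube of a power of two below
  \<open>2 * goal n\<close>, hence below \<open>8 * goal n ^ 3\<close>; a further factor of 8 leaves
  slack for intermediate results.\<close>

definition limit :: "nat \<Rightarrow> nat" where
  "limit n = 64 * goal n ^ 3"

lemma goal_le: "goal n \<le> 2 ^ bits n"
  unfolding bits_def by (rule LeastI[of _ "goal n"]) (simp add: less_imp_le)

lemma less_goal: "k < bits n \<Longrightarrow> 2 ^ k < goal n"
  unfolding bits_def using not_less_Least[of k "\<lambda>k. goal n \<le> 2 ^ k"] by simp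

lemma goal_pos: "0 < n \<Longrightarrow> 2 ^ 15 \<le> goal n"
  by (simp add: goal_def)

lemma cube_le_goal:
  assumes "0 < n"
  shows "4 * (n * n * n) \<le> goal n"
proof -
  have "n ^ 3 \<le> n ^ 32"
    using assms by (intro power_increasing) auto
  then have "n * n * n \<le> n ^ 32"
    by (simp add: power3_eq_cube)
  then have "4 * (n * n * n) \<le> 2 ^ 15 * n ^ 32"
    by (intro mult_le_mono) auto
  then show ?thesis
    by (simp add: goal_def)
qed

lemma bits_pos:
  assumes "0 < n"
  shows "0 < bits n"
proof (rule ccontr)
  assume "\<not> 0 < bits n"
  then show False
    using goal_le[of n] goal_pos[OF assms] by simp
qed

lemma power_bits_less:
  assumes "0 < n"
  shows "2 ^ bits n < 2 * goal n"
proof -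
  have "(2::nat) ^ bits n = 2 * 2 ^ (bits n - 1)"
    using bits_pos[OF assms] by (cases "bits n") auto
  then show ?thesis
    using less_goal[of "bits n - 1" n] bits_pos[OF assms] by simp
qed

section \<open>Initialization and the distribution of the coins\<close>

locale coin_machine =
  fixes n src :: nat and nb :: "nat \<Rightarrow> nat list" and x :: stcon_input and \<tau> :: "nat \<Rightarrow> bool"
  assumes n_pos: "0 < n"
    and nb_range: "\<And>v. v \<in> {1..n} \<Longrightarrow> set (nb v) \<subseteq> {1..n}"
    and nb_length: "\<And>v. v \<in> {1..n} \<Longrightarrow> length (nb v) < n"
    and count: "vertex_count x = n" and nb: "in_nbrs x = nb" and source: "source x = src"
    and src_range: "src \<in> {1..n}" and target: "target x \<in> {1..n}"
begin

abbreviation Qs where "Qs \<equiv> 2 ^ bits n :: nat"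
abbreviation W where "W \<equiv> 2 ^ width n :: nat"
abbreviation S where "S \<equiv> n * n * n * width n"
abbreviation M where "M \<equiv> limit n"

lemma W_eq: "W = Qs * Qs"
  by (simp add: width_def power_add mult_2)

lemma full_eq: "W * Qs = 2 ^ (3 * bits n)"
  by (simp add: width_def flip: power_add)

lemma cube_bound:
  assumes "a \<le> 2 * goal n" "b \<le> 2 * goal n" "c \<le> 2 * goal n"
  shows "8 * (a * b * c) \<le> M"
proof -
  have "a * b * c \<le> 2 * goal n * (2 * goal n) * (2 * goal n)"
    using assms by (intro mult_le_mono)
  also have "\<dots> = 8 * goal n ^ 3"
    by (simp add: power3_eq_cube)
  finally show ?thesis
    by (simp add: limit_def)
qed

lemma bounds: "8 * (W * Qs) \<le> M" "8 * W \<le> M" "8 * Qs \<le> M" "S \<le> M" "32 * (n * n * n) \<le> M" "8 * goal n \<le> M"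
  "8 * width n \<le> M" "8 * 32768 \<le> M"
proof -
  note p = power_bits_less[OF n_pos]
  have 1: "1 \<le> 2 * goal n"
    using goal_pos[OF n_pos] by simp
  have b: "2 * bits n \<le> 2 * goal n"
  proof -
    have "2 * bits n \<le> 2 ^ bits n"
    proof -
      obtain j where j: "bits n = Suc j"
        using bits_pos[OF n_pos] by (cases "bits n") auto
      have "Suc j \<le> 2 ^ j"
        by (rule Suc_leI) (rule less_exp)
      then have "2 * Suc j \<le> 2 * 2 ^ j"
        by (rule mult_le_mono2)
      then show ?thesis
        by (simp only: j power_Suc)
    qed
    then show ?thesis
      using p by simp
  qed
  show "8 * (W * Qs) \<le> M"
    using cube_bound[of Qs Qs Qs] p by (simp add: W_eq)
  show "8 * W \<le> M"
    using cube_bound[of Qs Qs 1] p 1 by (simp add: W_eq)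
  show "8 * Qs \<le> M"
    using cube_bound[of Qs 1 1] p 1 by simp
  show g: "8 * goal n \<le> M"
    using cube_bound[of "goal n" 1 1] 1 by simp
  show "32 * (n * n * n) \<le> M"
    using g cube_le_goal[OF n_pos] by linarith
  show "8 * width n \<le> M"
    using cube_bound[of "width n" 1 1] 1 b by (simp add: width_def)
  show "8 * 32768 \<le> M"
    using g goal_pos[OF n_pos] by simp
  have "8 * (n * n * n * width n * 1) \<le> M"
    using cube_le_goal[OF n_pos] b 1 by (intro cube_bound) (auto simp: width_def)
  then show "S \<le> M"
    by simp
qed

text \<open>The invariant of the phase before the sweeps: any register other than \<open>rC\<close>
  and \<open>rK\<close> may be set up in any order, since the tape is still the original
  one.\<close>

definition blank :: assn where
  "blank f a out \<longleftrightarrow> fits M f \<and> f rC = 0 \<and> f rK = 0 \<and> a = \<tau>"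

abbreviation Inv where "Inv \<equiv> inv M n (width n) W nb src \<tau>"

lemma blank_J: "blank f a out \<Longrightarrow> Inv f a out"
  by (simp add: blank_def inv_def)

sublocale blank: scratch x blank S M "{..<60} - {rC, rK}"
  by unfold_locales (auto simp: blank_def intro: fits_upd)

lemma tri_blank: "tri x blank S c t f a out Q \<Longrightarrow> tri x Inv S c t f a out Q"
  by (erule tri_weaken) (rule blank_J)

definition prepared :: "nat \<Rightarrow> nat \<Rightarrow> (nat \<Rightarrow> nat) \<Rightarrow> bool" where
  "prepared z u f \<longleftrightarrow> f rN = n \<and> f (Suc 0) = n * n \<and> f rB = width n \<and> f rW = W \<and> f rBit = 0 \<and>
     f rOne = 1 \<and> f rTwo = 2 \<and> f rZero = 0 \<and> f rTop = n * n * n \<and> f rQs = Qs \<and> f rFull = W * Qs \<and>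
     f rz = z \<and> f rCoins = u"

lemma tri_initialize:
  "tri x blank S initialize (20 + 4 * bits n) (\<lambda>_. 0) \<tau> []
     (\<lambda>f a out. blank f a out \<and> out = [] \<and> prepared 1 0 f)"
    (is "tri _ _ _ _ _ _ _ _ ?Q")
proof -
  let ?f = "\<lambda>k. (\<lambda>_. 0)(rOne := 1, rTwo := 2, rN := n, Suc 0 := n * n, rTop := n * n * n, rGoal := goal n,
    rz := 32768, rQs := 2 ^ k, rB := k)"
  define I where "I f a out \<longleftrightarrow> blank f a out \<and> out = [] \<and> (\<exists>k\<le>bits n. f = ?f k)" for f a out
  have b0: "blank (\<lambda>_. 0) \<tau> []"
    by (simp add: blank_def fits_def)
  have le: "k \<le> M" if "k \<le> n ^ 32" for k
  proof -
    have "n ^ 32 \<le> goal n"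
      by (simp add: goal_def)
    then show ?thesis
      using that bounds(6) by linarith
  qed
  have pw: "n * n * (n * n) = n ^ 4" "n ^ 4 * n ^ 4 = n ^ 8" "n ^ 8 * n ^ 8 = n ^ 16" "n ^ 16 * n ^ 16 = n ^ 32"
    "n ^ 32 * 32768 = goal n"
    by (simp_all add: goal_def power_add[symmetric] flip: power2_eq_square power_mult)
  have "n ^ k \<le> M" if "k \<le> 32" for k
    using n_pos that by (intro le power_increasing) auto
  from this[of 1] this[of 2] this[of 3] this[of 4] this[of 8] this[of 16] this[of 32]
  have pw_le: "n \<le> M" "n * n \<le> M" "n * n * n \<le> M" "n ^ 4 \<le> M" "n ^ 8 \<le> M" "n ^ 16 \<le> M" "n ^ 32 \<le> M"
    by (simp_all add: power2_eq_square power3_eq_cube)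
  let ?last = "code [Arith Add rB rB rB, Arith Mult rW rQs rQs, Arith Mult rFull rW rQs, Const rz 1, Const rCoins 0]"
  show ?thesis
    unfolding initialize_def
  proof (rule tri_time, rule blank.tri_code_SeqI[OF b0])
    show "straight x ({..<60} - {rC, rK}) M [Const rOne 1, Const rTwo 2, Ask Vertex_Count rN rN rN, Arith Mult rNN rN rN,
           Arith Mult rTop rNN rN, Arith Mult rGoal rNN rNN, Arith Mult rGoal rGoal rGoal,
           Arith Mult rGoal rGoal rGoal, Arith Mult rGoal rGoal rGoal, Const rz 32768,
           Arith Mult rGoal rGoal rz, Const rQs 1, Const rB 0] (\<lambda>_. 0) (\<lambda>f. f = ?f 0)"
      using pw_le bounds(6,8) by (simp add: count pw) (auto simp: fun_eq_iff)
    fix f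
    assume f: "blank f \<tau> []" "f = ?f 0"
    show "tri x blank S (WhileLess rQs rGoal (code [Arith Add rQs rQs rQs, Arith Add rB rB rOne]) ;; ?last)
        (bits n * (2 + 2) + 2 + 5) f \<tau> [] ?Q"
    proof (rule tri_Seq, rule tri_While[where I = I and \<mu> = "\<lambda>f. bits n - f rB" and t = 2])
      show "I f \<tau> []"
        using f by (auto simp: I_def)
      show "bits n * (2 + 2) + 2 = (bits n - f rB) * (2 + 2) + 2"
        using f by simp
      show "blank f a out" if "I f a out" for f a out
        using that by (auto simp: I_def)
      show "blank f a out \<and> tri x blank S (code [Arith Add rQs rQs rQs, Arith Add rB rB rOne]) 2 f a out
          (\<lambda>f' a' out'. I f' a' out' \<and> bits n - f' rB < bits n - f rB)"
        if I: "I f a out" and less: "f rQs < f rGoal" for f a out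
      proof
        show b: "blank f a out"
          using I by (auto simp: I_def)
        obtain k where k: "k \<le> bits n" "f = ?f k"
          using I by (auto simp: I_def)
        have "k \<noteq> bits n"
          using less goal_le[of n] by (auto simp: k(2))
        then have kb: "k < bits n"
          using k by simp
        then have "(2::nat) ^ Suc k \<le> Qs"
          by (intro power_increasing) auto
        then have "2 ^ k + 2 ^ k \<le> M"
          using bounds(3) by simp
        moreover have "k + 1 \<le> M"
          using kb bounds(7) by (simp add: width_def)
        ultimately have s: "straight x ({..<60} - {rC, rK}) M [Arith Add rQs rQs rQs, Arith Add rB rB rOne] f
            (\<lambda>f'. f' = ?f (Suc k))"
          by (simp add: k(2)) (auto simp: fun_eq_iff)
        show "tri x blank S (code [Arith Add rQs rQs rQs, Arith Add rB rB rOne]) 2 f a out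
          (\<lambda>f' a' out'. I f' a' out' \<and> bits n - f' rB < bits n - f rB)"
        proof (rule blank.tri_codeI[OF b s])
          fix f'
          assume f': "blank f' a out" "f' = ?f (Suc k)"
          then have "\<exists>k\<le>bits n. f' = ?f k"
            using kb by (intro exI[of _ "Suc k"]) auto
          then have "I f' a out"
            using f'(1) I by (simp add: I_def)
          moreover have "f' rB = Suc k" "f rB = k"
            by (simp_all add: f'(2) k(2))
          ultimately show "I f' a out \<and> bits n - f' rB < bits n - f rB"
            using kb by simp
        qed simp
      qed
      show "blank f a out \<and> tri x blank S ?last 5 f a out ?Q" if I: "I f a out" and nl: "\<not> f rQs < f rGoal" for f a out
      proof
        show b: "blank f a out"
          using I by (auto simp: I_def)
        obtain k where k: "k \<le> bits n" "f = ?f k"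
          using I by (auto simp: I_def)
        have "\<not> k < bits n"
          using nl less_goal[of k n] by (auto simp: k(2))
        then have kb: "k = bits n"
          using k by simp
        show "tri x blank S ?last 5 f a out ?Q"
        proof (rule blank.tri_codeI[OF b])
          show "straight x ({..<60} - {rC, rK}) M [Arith Add rB rB rB, Arith Mult rW rQs rQs, Arith Mult rFull rW rQs,
              Const rz 1, Const rCoins 0] f (\<lambda>f. prepared 1 0 f)"
            using bounds by (simp add: k(2) kb prepared_def W_eq) (simp add: width_def)
        qed (use I in \<open>auto simp: I_def\<close>)
      qed
    qed
  qed simp
qed

lemma card_interval_split:
  "card {v \<in> {a..<a + b + c}. P v} = card {v \<in> {a..<a + b}. P v} + card {v \<in> {a + b..<a + b + (c::nat)}. P v}"
proof -
  have "card {v \<in> {a..<a + b + c}. P v} =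
      card ({v \<in> {a..<a + b}. P v} \<union> {v \<in> {a + b..<a + b + c}. P v})"
    by (rule arg_cong[of _ _ card]) auto
  also have "\<dots> = card {v \<in> {a..<a + b}. P v} + card {v \<in> {a + b..<a + b + c}. P v}"
    by (rule card_Un_disjoint) auto
  finally show ?thesis .
qed

lemma floorlog_2_power: "floorlog 2 (2 ^ k) = Suc k"
proof -
  have "floorlog 2 1 = 1"
    by (simp add: floorlog_def)
  then show ?thesis
    using floorlog_power[of 1 2 k] by simp
qed

lemma power_le_full: "k \<le> 3 * bits n \<Longrightarrow> 2 ^ k \<le> W * Qs"
  unfolding full_eq by (intro power_increasing) auto

lemma double_coins:
  assumes "prepared (2 ^ k) u f" "u < 2 ^ k" "k < 3 * bits n"
  shows "straight x ({..<60} - {rC, rK}) M [Arith Add rz rz rz, Arith Add rCoins rCoins rCoins] f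
      (\<lambda>f'. prepared (2 ^ Suc k) (2 * u) f')"
    and "prepared (2 ^ Suc k) (2 * u) g \<Longrightarrow> g ry = b \<Longrightarrow> b \<le> 1 \<Longrightarrow>
      straight x ({..<60} - {rC, rK}) M [Arith Add rCoins rCoins ry] g (prepared (2 ^ Suc k) (2 * u + b))"
proof -
  have "2 ^ Suc k \<le> M"
    using power_le_full[of "Suc k"] assms(3) bounds(1) by simp
  then have "2 ^ k + 2 ^ k \<le> M" "u + u \<le> M" "2 * u + 1 \<le> M"
    using assms(2) by simp_all
  then show "straight x ({..<60} - {rC, rK}) M [Arith Add rz rz rz, Arith Add rCoins rCoins rCoins] f
      (\<lambda>f'. prepared (2 ^ Suc k) (2 * u) f')"
    and "prepared (2 ^ Suc k) (2 * u) g \<Longrightarrow> g ry = b \<Longrightarrow> b \<le> 1 \<Longrightarrow>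
      straight x ({..<60} - {rC, rK}) M [Arith Add rCoins rCoins ry] g (prepared (2 ^ Suc k) (2 * u + b))"
    using assms(1) by (simp_all add: prepared_def)
qed

lemma blank_flip: "blank f a out \<Longrightarrow> b \<le> 1 \<Longrightarrow> blank (f(ry := b)) a out"
  using bounds(8) by (intro blank.J_scratch) auto

lemma prepared_flip: "prepared z u f \<Longrightarrow> prepared z u (f(ry := b))"
  by (simp add: prepared_def)

lemma tri_flip_coins:
  assumes "blank f a []" "prepared 1 0 f"
  shows "tri x blank S flip_coins (18 * bits n + 2) f a []
     (\<lambda>f a out. blank f a out \<and> out = [] \<and> (\<exists>u<W * Qs. prepared (W * Qs) u f))"
    (is "tri _ _ _ _ _ _ _ _ ?Q")
proof -
  define I where "I f a out \<longleftrightarrow> blank f a out \<and> out = [] \<and>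
    (\<exists>k\<le>3 * bits n. \<exists>u<2 ^ k. prepared (2 ^ k) u f)" for f a out
  show ?thesis
    unfolding flip_coins_def
  \<comment> \<open>The measure has to be a function of the registers; \<open>floorlog\<close>
    recovers the number of coins so far from \<open>rz = 2 ^ k\<close>.\<close>
  proof (rule tri_While[where I = I and \<mu> = "\<lambda>f. 3 * bits n + 1 - floorlog 2 (f rz)" and t = 4])
    show "I f a []"
      unfolding I_def using assms by (intro conjI exI[of _ 0]) auto
    show "18 * bits n + 2 = (3 * bits n + 1 - floorlog 2 (f rz)) * (4 + 2) + 2"
      using assms(2) floorlog_2_power[of 0] by (simp add: prepared_def)
    show "blank g a out" if "I g a out" for g a out
      using that by (auto simp: I_def)
    show "blank g a out \<and> ?Q g a out" if I: "I g a out" and nl: "\<not> g rz < g rFull" for g a out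
    proof -
      obtain k u where k: "k \<le> 3 * bits n" "u < 2 ^ k" "prepared (2 ^ k) u g"
        using I by (auto simp: I_def)
      have "2 ^ k = W * Qs"
        using power_le_full[OF k(1)] k(3) nl by (simp add: prepared_def)
      then show ?thesis
        using k I by (auto simp: I_def)
    qed
    let ?body = "code [Arith Add rz rz rz, Arith Add rCoins rCoins rCoins] ;; Do (Flip ry) ;; code [Arith Add rCoins rCoins ry]"
    let ?R = "\<lambda>g f' a' out'. I f' a' out' \<and> 3 * bits n + 1 - floorlog 2 (f' rz) < 3 * bits n + 1 - floorlog 2 (g rz)"
    show "blank g a out \<and> tri x blank S ?body 4 g a out (?R g)"
      if I: "I g a out" and less: "g rz < g rFull" for g a out
    proof
      show b: "blank g a out"
        using I by (auto simp: I_def)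
      obtain k u where k: "k \<le> 3 * bits n" "u < 2 ^ k" "prepared (2 ^ k) u g"
        using I by (auto simp: I_def)
      have "k \<noteq> 3 * bits n"
        using less k(3) by (auto simp: prepared_def full_eq)
      then have kb: "k < 3 * bits n"
        using k(1) by simp
      have add: "tri x blank S (code [Arith Add rCoins rCoins ry]) 1 h a out (?R g)"
        if h: "blank h a out" "prepared (2 ^ Suc k) (2 * u) h" "h ry = b" "b \<le> 1" for h b
      proof (rule blank.tri_codeI[OF h(1) double_coins(2)[OF k(3,2) kb h(2-4)]])
        fix i
        assume i: "blank i a out" "prepared (2 ^ Suc k) (2 * u + b) i"
        have "2 * u + b < 2 ^ Suc k"
          using k(2) h(4) by simp
        then have "I i a out"
          unfolding I_def using I i kb
          by (intro conjI exI[of _ "Suc k"] exI[of _ "2 * u + b"]) (auto simp: I_def)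
        moreover have "i rz = 2 ^ Suc k" "g rz = 2 ^ k"
          using i(2) k(3) by (simp_all add: prepared_def)
        ultimately show "?R g i a out"
          using kb by (simp only: floorlog_2_power) simp
      qed simp
      show "tri x blank S ?body 4 g a out (?R g)"
      proof (rule tri_time, rule blank.tri_code_SeqI[OF b double_coins(1)[OF k(3,2) kb], where t = "1 + 1"])
        fix h
        assume h: "blank h a out" "prepared (2 ^ Suc k) (2 * u) h"
        show "tri x blank S (Do (Flip ry) ;; code [Arith Add rCoins rCoins ry]) (1 + 1) h a out (?R g)"
        proof (rule tri_Seq, rule tri_Flip[where J = blank, OF h(1)])
          show "tri x blank S (code [Arith Add rCoins rCoins ry]) 1 (h(ry := 0)) a out (?R g)"
            by (rule add[where b = 0]) (use h in \<open>auto intro: blank_flip prepared_flip\<close>)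
          show "tri x blank S (code [Arith Add rCoins rCoins ry]) 1 (h(ry := 1)) a out (?R g)"
            by (rule add[where b = 1]) (use h in \<open>auto intro: blank_flip prepared_flip\<close>)
        qed
      qed simp
    qed
  qed
qed

text \<open>The coins collected so far are the leading bits \<open>u\<close>. The remaining
  \<open>d\<close> coins extend them to a uniformly distributed number in an interval of length
  \<open>2 ^ d\<close>, and the bound is the share of good numbers in it.\<close>

lemma ptri_flip_coins:
  fixes good :: "nat \<Rightarrow> bool"
  defines "g \<equiv> \<lambda>f a out. if blank f a out \<and> out = [] \<and> prepared (W * Qs) (f rCoins) f \<and> f rCoins < W * Qs
    then of_bool (good (f rCoins)) else 0 :: real"
  assumes "blank f a []" "prepared (2 ^ k) u f" "u < 2 ^ k" "k + d = 3 * bits n"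
  shows "ptri x flip_coins (6 * d + 2) f a [] g (card {v \<in> {u * 2 ^ d..<(u + 1) * 2 ^ d}. good v} / 2 ^ d)"
  using assms(2-)
proof (induction d arbitrary: f a k u)
  case 0
  then have k: "2 ^ k = W * Qs"
    by (simp add: full_eq)
  have "{v \<in> {u..<u + 1}. good v} = (if good u then {u} else {})"
    by auto
  moreover have "\<not> f rz < f rFull" "f rCoins = u"
    using 0(2) k by (simp_all add: prepared_def)
  ultimately show ?case
    using 0 k unfolding flip_coins_def by (intro ptri_While_exit[THEN ptri_time]) (simp_all add: g_def)
next
  case (Suc d)
  let ?good = "\<lambda>u d. real (card {v \<in> {u * 2 ^ d..<(u + 1) * 2 ^ d}. good v}) / 2 ^ d"
  let ?body = "code [Arith Add rz rz rz, Arith Add rCoins rCoins rCoins] ;; Do (Flip ry) ;; code [Arith Add rCoins rCoins ry]"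
  have kb: "k < 3 * bits n"
    using Suc.prems by simp
  \<comment> \<open>Lower bounds at successive points of the loop body: \<open>h1\<close> before the
    flip, \<open>h2\<close> after it, \<open>h\<close> at the end. Each is 0 at states that the run
    cannot be in.\<close>
  define h where "h f' a' out' = (if blank f' a' out' \<and> out' = [] \<and> prepared (2 ^ Suc k) (f' rCoins) f' \<and>
    f' rCoins < 2 ^ Suc k then ?good (f' rCoins) d else 0)" for f' a' and out' :: "bool list"
  define h1 where "h1 f' a' out' = (if blank f' a' out' \<and> out' = [] \<and> prepared (2 ^ Suc k) (2 * u) f'
    then ?good u (Suc d) else 0)" for f' a' and out' :: "bool list"
  define h2 where "h2 f' a' out' = (if blank f' a' out' \<and> out' = [] \<and> prepared (2 ^ Suc k) (2 * u) f' \<and> f' ry \<le> 1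
    then ?good (2 * u + f' ry) d else 0)" for f' a' and out' :: "bool list"
  \<comment> \<open>The next coin selects one half of the interval, so the share of good numbers is
    the mean of the shares in the halves.\<close>
  have split: "?good u (Suc d) = (?good (2 * u + 0) d + ?good (2 * u + 1) d) / 2"
  proof -
    define A B where "A = 2 * u * 2 ^ d" and "B = (2::nat) ^ d"
    have e: "u * 2 ^ Suc d = A" "(u + 1) * 2 ^ Suc d = A + B + B" "(2 * u + 0) * 2 ^ d = A"
      "(2 * u + 0 + 1) * 2 ^ d = A + B" "(2 * u + 1) * 2 ^ d = A + B" "(2 * u + 1 + 1) * 2 ^ d = A + B + B"
      by (simp_all add: A_def B_def algebra_simps)
    have "real (card {v \<in> {A..<A + B + B}. good v}) =
        real (card {v \<in> {A..<A + B}. good v}) + real (card {v \<in> {A + B..<A + B + B}. good v})"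
      unfolding card_interval_split by simp
    then show ?thesis
      unfolding e by (simp add: field_simps)
  qed
  have body: "ptri x ?body (2 + (1 + 1)) f a [] h (?good u (Suc d))"
  proof (rule ptri_Seq[where h = h1])
    show "ptri x (code [Arith Add rz rz rz, Arith Add rCoins rCoins rCoins]) 2 f a [] h1 (?good u (Suc d))"
    proof (rule ptri_tri)
      show "tri x blank S (code [Arith Add rz rz rz, Arith Add rCoins rCoins rCoins]) 2 f a []
          (\<lambda>f a out. blank f a out \<and> out = [] \<and> prepared (2 ^ Suc k) (2 * u) f)"
        by (rule blank.tri_codeI[OF Suc.prems(1) double_coins(1)[OF Suc.prems(2,3) kb]]) auto
    qed (simp add: h1_def)
    fix f' a' out'
    show "ptri x (Do (Flip ry) ;; code [Arith Add rCoins rCoins ry]) (1 + 1) f' a' out' h (h1 f' a' out')"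
    proof (cases "blank f' a' out' \<and> out' = [] \<and> prepared (2 ^ Suc k) (2 * u) f'")
      case True
      show ?thesis
      proof (rule ptri_Seq[where h = h2], rule ptri_Flip)
        show "h1 f' a' out' \<le> (h2 (f'(ry := 0)) a' out' + h2 (f'(ry := 1)) a' out') / 2"
          using True split by (simp add: h1_def h2_def blank_flip prepared_flip)
        fix f'' a'' out''
        show "ptri x (code [Arith Add rCoins rCoins ry]) 1 f'' a'' out'' h (h2 f'' a'' out'')"
        proof (cases "blank f'' a'' out'' \<and> out'' = [] \<and> prepared (2 ^ Suc k) (2 * u) f'' \<and> f'' ry \<le> 1")
          case True
          define b where "b = f'' ry"
          have lt: "2 * u + b < 2 ^ Suc k"
            using True Suc.prems(3) by (simp add: b_def)
          show ?thesis
          proof (rule ptri_tri)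
            show "tri x blank S (code [Arith Add rCoins rCoins ry]) 1 f'' a'' out''
                (\<lambda>f a out. blank f a out \<and> out = [] \<and> prepared (2 ^ Suc k) (2 * u + b) f)"
              using True by (intro blank.tri_codeI[OF _ double_coins(2)[OF Suc.prems(2,3) kb, of f'' b]])
                (auto simp: b_def)
            show "h2 f'' a'' out'' \<le> h f a out"
              if "blank f a out \<and> out = [] \<and> prepared (2 ^ Suc k) (2 * u + b) f" for f a out
            proof -
              have "f rCoins = 2 * u + b"
                using that by (simp add: prepared_def)
              then show ?thesis
                using that True lt by (auto simp: h_def h2_def b_def)
            qed
          qed
        next
          case False
          have "h2 f'' a'' out'' = 0"
            using False unfolding h2_def by (rule if_not_P)
          then show ?thesis
            by (simp only: ptri_0)
        qed
      qed
    next
      case False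
      have "h1 f' a' out' = 0"
        using False unfolding h1_def by (rule if_not_P)
      then show ?thesis
        by (simp only: ptri_0)
    qed
  qed
  have rest: "ptri x flip_coins (6 * d + 2) f' a' out' g (h f' a' out')" for f' a' out'
  proof (cases "blank f' a' out' \<and> out' = [] \<and> prepared (2 ^ Suc k) (f' rCoins) f' \<and> f' rCoins < 2 ^ Suc k")
    case True
    then have "ptri x flip_coins (6 * d + 2) f' a' [] g (?good (f' rCoins) d)"
      using Suc.prems(4) by (intro Suc.IH[of f' a' "Suc k" "f' rCoins"]) auto
    moreover have "h f' a' out' = ?good (f' rCoins) d"
      using True unfolding h_def by (rule if_P)
    ultimately show ?thesis
      using True by (simp only:)
  next
    case False
    have "h f' a' out' = 0"
      using False unfolding h_def by (rule if_not_P)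
    then show ?thesis
      by (simp only: ptri_0)
  qed
  have less: "f rz < f rFull"
  proof -
    have "(2::nat) ^ k < 2 ^ (3 * bits n)"
      using kb by (intro power_strict_increasing) auto
    then show ?thesis
      using Suc.prems(2) by (simp add: prepared_def full_eq)
  qed
  have "ptri x flip_coins (2 + (1 + 1) + (6 * d + 2) + 2) f a [] g (?good u (Suc d))"
    using rest unfolding flip_coins_def by (rule ptri_While_step[OF less body])
  then show ?case
    by (rule ptri_time) simp
qed

section \<open>The comparison for a fixed coin outcome\<close>

abbreviation N where "N \<equiv> grid.walks nb src n (target x)"

definition good_coins :: "nat \<Rightarrow> bool" where
  "good_coins u \<longleftrightarrow> \<not> Suc (u mod Qs) dvd N \<and> (\<forall>k < n * n * n.
     ((block (width n) \<tau> k + u div Qs) mod W div Suc (u mod Qs) + 1) * Suc (u mod Qs) \<le> W)"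

definition nodes :: nat where
  "nodes = n * (\<Sum>v = 1..n. length (nb v) + 1)"

lemma grid_I: "0 < q \<Longrightarrow> q \<le> W \<Longrightarrow> r < W \<Longrightarrow> grid n q r W nb"
  using n_pos nb_range nb_length by unfold_locales

text \<open>Once the coins are fixed, the rest is deterministic: soundness holds for every
  \<open>u\<close>, and completeness becomes an implication from \<open>good_coins u\<close>.
  Probability can thus be reduced to counting \<open>u\<close>.\<close>

lemma tri_main:
  assumes f: "blank f a []" "prepared (W * Qs) u f" and u: "u < W * Qs"
  shows "tri x Inv S (use_coins ;; compare) (3 + (4 * nodes + 4) * (24 * width n + 140)) f a []
    (\<lambda>f' a' out'. Inv f' a' out' \<and> a' = \<tau> \<and> (\<exists>ans. out' = [ans] \<and>
       (ans \<longrightarrow> (src, target x) \<in> {(u, v). v \<in> {1..n} \<and> u \<in> set (nb v)}\<^sup>*) \<and> (good_coins u \<longrightarrow> ans)))"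
    (is "tri _ _ _ _ _ _ _ _ ?Q")
proof -
  let ?q = "Suc (u mod Qs)" and ?r = "u div Qs"
  have q: "0 < ?q" "?q \<le> W" "?r < W"
  proof -
    have "?q \<le> Qs"
      by (simp add: Suc_le_eq)
    also have "\<dots> \<le> W"
      by (simp add: W_eq)
    finally show "?q \<le> W" .
    show "?r < W"
      using u by (simp add: less_mult_imp_div_less)
  qed simp
  interpret sweep n ?q ?r W nb src x \<tau> S M "width n"
  proof unfold_locales
    show "inv M n (width n) W nb src \<tau> (f(k := v)) a out"
      if "inv M n (width n) W nb src \<tau> f a out" "k \<in> {10..<60}" "v \<le> M" for f a out k v
      using that by (rule inv_scratch)
    show "0 < width n"
      using bits_pos[OF n_pos] by (simp add: width_def)
  qed (use q n_pos nb_range nb_length count nb source src_range target bounds in auto)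
  have blocks: "blocks \<le> nodes"
    using card_used by (simp add: blocks_def nodes_def)
  show ?thesis
    unfolding use_coins_def
  proof (rule tri_time, rule tri_Seq, rule tri_blank, rule blank.tri_codeI[OF f(1)])
    have "?q \<le> M" "?r \<le> M" "u mod Qs \<le> M"
      using q bounds(2) by linarith+
    then show "straight x ({..<60} - {rC, rK}) M [Arith Div rR rCoins rQs, Arith Mod rQ rCoins rQs, Arith Add rQ rQ rOne] f
        (\<lambda>g. g = f(rR := ?r, rQ := ?q))"
      using f(2) by (simp add: prepared_def)
    show "length [Arith Div rR rCoins rQs, Arith Mod rQ rCoins rQs, Arith Add rQ rQ rOne] \<le> 3"
      by simp
    fix g
    assume g: "blank g a []" "g = f(rR := ?r, rQ := ?q)"
    \<comment> \<open>Here the invariant passes to its second alternative: with \<open>q\<close> and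
      \<open>r\<close> set, the untouched tape is the state at position 0.\<close>
    have "clean 0 0 g a"
      using f(2) g(1) by (simp add: clean_def good_def ready_def prepared_def blank_def g(2))
    from tri_compare[OF this, of "[]"]
    show "tri x J S compare ((4 * nodes + 4) * (24 * width n + 140)) g a [] ?Q"
    proof (rule tri_mono)
      show "(4 * blocks + 4) * (24 * width n + 140) \<le> (4 * nodes + 4) * (24 * width n + 140)"
        using blocks by (intro mult_le_mono1) simp
      fix f' a' out'
      let ?ans = "inflow 0 (st 0 (n * n * n)) (start n (target x)) \<noteq> inflow 1 (st 1 (n * n * n)) (start n (target x))"
      assume fin: "J f' a' out' \<and> a' = \<tau> \<and> out' = [] @ [?ans]"
      have "(src, target x) \<in> edges\<^sup>*" if ?ans
        using that by (rule sound[OF target])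
      moreover have ?ans if "good_coins u"
      proof (rule complete[OF _ target])
        show "whole (block (width n) \<tau> k)" if "k < n * n * n" for k
          using that \<open>good_coins u\<close>
          by (simp add: whole_def good_coins_def)
        show "\<not> ?q dvd walks n (target x)"
          using that by (simp add: good_coins_def)
      qed
      ultimately show "?Q f' a' out'"
        using fin by (auto simp: edges_def)
    qed
  qed simp
qed

lemma card_good:
  assumes "0 < N"
  shows "W * Qs \<le> 2 * card {u. u < W * Qs \<and> good_coins u}"
proof -
  \<comment> \<open>\<open>grid.walks\<close> takes only \<open>nb\<close> and \<open>src\<close> as
    parameters; \<open>q = 1\<close> and \<open>r = 0\<close> are the simplest values meeting the
    locale assumptions.\<close>
  interpret grid n 1 0 W nb src
    by (rule grid_I) auto
  have "4 * (n * n * n) * Qs \<le> W"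
    using cube_le_goal[OF n_pos] goal_le[of n] unfolding W_eq by (intro mult_le_mono1) linarith
  moreover have "N \<le> n ^ n"
    using walks_le[OF target] .
  moreover have "block (width n) \<tau> k < W" for k
    by (rule block_less)
  ultimately show ?thesis
    using card_good_coins[OF n_pos _ _ assms, of Qs W "block (width n) \<tau>"] goal_le[of n]
    by (simp add: good_coins_def goal_def)
qed

end

section \<open>The revert routine\<close>

abbreviation (input) "rI \<equiv> 16 :: nat"

definition extract_bit :: com where
  "extract_bit =
     code [Arith Mod rt rI rB] ;;
     WhileLess rZero rt (code [Arith Div rX rX rTwo, Arith Sub rt rt rOne]) ;;
     code [Arith Mod rI rX rTwo]"

definition lookup_stored :: com where
  "lookup_stored =
     IfLess rP rC
       (calc_inflow ;; code [Arith Sub rF rQ rF] ;; calc_shift ;; extract_bit)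
       (Do (CatRead rI rI))"

text \<open>The block is compared with the marked one through \<open>rt = P + 1\<close>. Inequality
  is expressed by two tests, so \<open>lookup_stored\<close> occurs twice.\<close>

definition lookup :: com where
  "lookup =
     code [Const rOne 1, Const rTwo 2, Arith Div rP rI rB, Arith Add rt rP rOne] ;;
     IfLess rt rK lookup_stored
       (IfLess rK rt lookup_stored (code [Arith Add rX rH rZero] ;; extract_bit))"

definition scratch_regs :: "nat list" where
  "scratch_regs = [10..<16] @ [17..<32]"

lemma set_scratch_regs: "set scratch_regs = {10..<32} - {rI}"
  unfolding scratch_regs_def set_append set_upt by auto

lemma length_scratch_regs: "length scratch_regs = 21"
  by (simp add: scratch_regs_def)

text \<open>All registers other than that of the answer have to end as they were at the pause, and
  the routine's own scratch registers were 0 then.\<close>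

definition clean_up :: com where
  "clean_up = code (map (\<lambda>k. Const k 0) scratch_regs)"

definition revert_com :: com where
  "revert_com = lookup ;; clean_up"

context scratch
begin

lemma tri_clear:
  assumes "J f a out" "set ks \<subseteq> V"
  shows "tri x J S (code (map (\<lambda>k. Const k 0) ks)) (length ks) f a out
    (\<lambda>f' a' out'. J f' a' out' \<and> a' = a \<and> out' = out \<and> f' = (\<lambda>k. if k \<in> set ks then 0 else f k))"
proof (rule tri_codeI[OF assms(1)])
  show "straight x V M (map (\<lambda>k. Const k 0) ks) f (\<lambda>f'. f' = (\<lambda>k. if k \<in> set ks then 0 else f k))"
    using assms(2)
  proof (induction ks arbitrary: f)
    case (Cons k ks)
    then have "straight x V M (map (\<lambda>k. Const k 0) ks) (f(k := 0))
        (\<lambda>f'. f' = (\<lambda>l. if l \<in> set ks then 0 else (f(k := 0)) l))"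
      by simp
    then have "straight x V M (map (\<lambda>k. Const k 0) ks) (f(k := 0))
        (\<lambda>f'. f' = (\<lambda>l. if l \<in> set (k # ks) then 0 else f l))"
      by (rule straight_mono) auto
    with Cons.prems show ?case
      by simp
  qed simp
qed auto

end

locale frozen_tape = machine n q r W nb src x "\<lambda>f a out. fits M f \<and> a = a0 \<and> out = out0" S M w
  for n q r W nb src x a0 out0 S M w
begin

abbreviation J where "J \<equiv> (\<lambda>f a out. fits M f \<and> a = a0 \<and> out = out0)"

lemma tri_extract_bit:
  assumes J: "J f a out" and f: "ready f" "f rX = y" "f rI = i" and y: "y \<le> M" and i: "i \<le> M" and w: "0 < w"
    and Q: "\<And>f'. fits M f' \<Longrightarrow> agree {rX, rt, rI} f f' \<Longrightarrow> f' rI = y div 2 ^ (i mod w) mod 2 \<Longrightarrow> Q f' a0 out0"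
  shows "tri x J S extract_bit (4 * w + 4) f a out Q"
proof -
  define I where "I f' a out \<longleftrightarrow> J f' a out \<and> agree {rX, rt} f f' \<and> f' rt \<le> i mod w \<and>
    f' rX = y div 2 ^ (i mod w - f' rt)" for f' and a :: "nat \<Rightarrow> bool" and out :: "bool list"
  have le: "y div k \<le> M" "y div k mod l \<le> M" for k l
    using y div_le_dividend[of y k] mod_less_eq_dividend[of "y div k" l] by linarith+
  have le': "y div k div l \<le> M" for k l
    using le(1)[of k] div_le_dividend[of "y div k" l] by linarith
  have loop: "tri x J S (WhileLess rZero rt (code [Arith Div rX rX rTwo, Arith Sub rt rt rOne]) ;;
     code [Arith Mod rI rX rTwo]) (i mod w * (2 + 2) + 2 + 1) g a0 out0 Q"
    if g: "J g a0 out0" "g = f(rt := i mod w)" for g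
  proof (rule tri_Seq, rule tri_While[where I = I and \<mu> = "\<lambda>f. f rt" and t = 2])
    show "I g a0 out0"
      using g f by (simp add: I_def agree_def)
    show "i mod w * (2 + 2) + 2 = g rt * (2 + 2) + 2"
      by (simp add: g(2))
    show "J h a' out'" if "I h a' out'" for h a' out'
      using that by (simp add: I_def)
    show "J h a' out' \<and> tri x J S (code [Arith Mod rI rX rTwo]) 1 h a' out' Q"
      if I: "I h a' out'" and nl: "\<not> h rZero < h rt" for h a' out'
    proof
      show J: "J h a' out'"
        using I by (simp add: I_def)
      have ready: "ready h"
        using I f(1) by (auto simp: I_def intro: ready_agree)
      have "h rX = y div 2 ^ (i mod w)"
        using I nl by (simp add: I_def readyD[OF ready])
      then have s: "straight x {10..<60} M [Arith Mod rI rX rTwo] h (\<lambda>k. k = h(rI := y div 2 ^ (i mod w) mod 2))"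
        using le by (simp add: readyD[OF ready])
      show "tri x J S (code [Arith Mod rI rX rTwo]) 1 h a' out' Q"
      proof (rule tri_codeI[OF J s])
        fix k
        assume k: "J k a' out'" "k = h(rI := y div 2 ^ (i mod w) mod 2)"
        have ag: "agree {rX, rt, rI} f k"
          using I by (simp add: I_def agree_def k(2))
        have e: "a' = a0" "out' = out0" "fits M k"
          using k(1) by auto
        show "Q k a' out'"
          unfolding e(1,2) by (rule Q[OF e(3) ag]) (simp add: k(2))
      qed simp
    qed
    show "J h a' out' \<and> tri x J S (code [Arith Div rX rX rTwo, Arith Sub rt rt rOne]) 2 h a' out'
        (\<lambda>h' a' out'. I h' a' out' \<and> h' rt < h rt)"
      if I: "I h a' out'" and less: "h rZero < h rt" for h a' out'
    proof
      show J: "J h a' out'"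
        using I by (simp add: I_def)
      have ready: "ready h"
        using I f(1) by (auto simp: I_def intro: ready_agree)
      define t where "t = h rt - 1"
      have t: "h rt = Suc t" "Suc t \<le> i mod w"
        using I less by (auto simp: I_def t_def readyD[OF ready])
      have X: "h rX div 2 = y div 2 ^ (i mod w - t)"
      proof -
        have "i mod w - t = Suc (i mod w - Suc t)"
          using t(2) by simp
        then have "y div 2 ^ (i mod w - t) = y div 2 ^ (i mod w - Suc t) div 2"
          by (simp add: power_Suc2 div_mult2_eq del: power_Suc)
        then show ?thesis
          using I t(1) by (simp add: I_def)
      qed
      have "t \<le> M"
        using t(2) i mod_less_eq_dividend[of i w] by linarith
      then have s: "straight x {10..<60} M [Arith Div rX rX rTwo, Arith Sub rt rt rOne] h
          (\<lambda>k. k = h(rX := y div 2 ^ (i mod w - t), rt := t))"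
        using le(1) by (simp add: readyD[OF ready] X t(1))
      show "tri x J S (code [Arith Div rX rX rTwo, Arith Sub rt rt rOne]) 2 h a' out'
        (\<lambda>h' a' out'. I h' a' out' \<and> h' rt < h rt)"
      proof (rule tri_codeI[OF J s])
        fix k
        assume k: "J k a' out'" "k = h(rX := y div 2 ^ (i mod w - t), rt := t)"
        then show "I k a' out' \<and> k rt < h rt"
          using I t by (simp add: I_def agree_def)
      qed simp
    qed
  qed
  show ?thesis
    unfolding extract_bit_def
  proof (rule tri_time, rule tri_code_SeqI[OF J])
    have "i mod w \<le> M"
      using i mod_less_eq_dividend[of i w] by linarith
    then show "straight x {10..<60} M [Arith Mod rt rI rB] f (\<lambda>g. g = f(rt := i mod w))"
      by (simp add: readyD[OF f(1)] f(3))
    show "tri x J S (WhileLess rZero rt (code [Arith Div rX rX rTwo, Arith Sub rt rt rOne]) ;;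
     code [Arith Mod rI rX rTwo]) (i mod w * (2 + 2) + 2 + 1) g a out Q"
      if "J g a out" "g = f(rt := i mod w)" for g
      using loop[of g] that by simp
    show "length [Arith Mod rt rI rB] + (i mod w * (2 + 2) + 2 + 1) \<le> 4 * w + 4"
      using mod_less_divisor[OF w, of i] by simp
  qed
qed

end

context coin_machine
begin

lemma tri_revert:
  assumes inv: "Inv c a0 out0" and i: "i < S"
    and f0: "\<And>k. k < 10 \<Longrightarrow> f0 k = c k" "f0 rI = i" "\<And>k. 10 \<le> k \<Longrightarrow> k \<noteq> rI \<Longrightarrow> f0 k = 0"
  shows "tri x (\<lambda>f a out. fits M f \<and> a = a0 \<and> out = out0) S revert_com (100 * width n + 400) f0 a0 out0
    (\<lambda>f' a out. fits M f' \<and> a = a0 \<and> out = out0 \<and> f' = f0(rI := of_bool (\<tau> i)))"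
proof -
  let ?J = "\<lambda>f a out. fits M f \<and> a = a0 \<and> out = out0"
  let ?w = "width n"
  let ?V = "{10..<32} :: nat set"
  let ?L = "\<lambda>f a out. ?J f a out \<and> agree ?V f0 f \<and> f rI = of_bool (\<tau> i)"
  have w: "0 < ?w"
    using bits_pos[OF n_pos] by (simp add: width_def)
  have iM: "i \<le> M"
    using i bounds(4) by simp
  interpret R: scratch x ?J S M "{10..<60}"
    by unfold_locales (auto intro: fits_upd)
  have c: "fits M c"
    using inv by (simp add: inv_def)
  have f0_fits: "fits M f0"
    unfolding fits_def
  proof (intro allI conjI impI)
    fix k
    show "f0 k \<le> M"
      using f0 c iM by (cases "k < 10"; cases "k = rI") (auto simp: fits_def)
    show "f0 k = 0" if "60 \<le> k"
      using f0(3) that by simp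
  qed
  \<comment> \<open>The block width is taken from the paused register and not assumed to be
    \<open>?w\<close>: during the initialization it may still be anything, even 0.\<close>
  let ?B = "f0 rB" and ?p = "i div f0 rB"
  let ?ready = "\<lambda>g. agree {rOne, rTwo, rP, rt} f0 g \<and> g rOne = 1 \<and> g rTwo = 2 \<and> g rP = ?p \<and> g rt = ?p + 1"
  have M_1: "2 \<le> M"
    using bounds(8) by linarith
  have J_inv: "f0 rC = 0 \<and> f0 rK = 0 \<and> a0 = \<tau> \<or> tape_inv n ?w W nb src \<tau> f0 a0"
  proof -
    have "c 0 = f0 0" "c (Suc 0) = f0 (Suc 0)" "c rB = f0 rB" "c rW = f0 rW" "c rQ = f0 rQ" "c rR = f0 rR"
      "c rBit = f0 rBit" "c rC = f0 rC" "c rK = f0 rK" "c rH = f0 rH"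
      using f0(1) by simp_all
    then show ?thesis
      using inv unfolding inv_def tape_inv_def by (simp only:)
  qed
  have read: "tri x ?J S (Do (CatRead rI rI)) 1 g a0 out0 ?L"
    if g: "?J g a0 out0" "?ready g" and bit: "a0 i = \<tau> i" for g
  proof (rule R.tri_CatRead_scratch[OF g(1)])
    have "g rI = i"
      using g(2) f0(2) by (simp add: agree_def)
    then show "?L (g(rI := of_bool (a0 (g rI)))) a0 out0"
      if "?J (g(rI := of_bool (a0 (g rI)))) a0 out0"
      using that i bit g(2) by (auto simp: agree_def)
    show "g rI < S"
      using \<open>g rI = i\<close> i by simp
  qed (use M_1 in auto)
  let ?stored = "tri x ?J S lookup_stored (30 * ?w + 120)"
  have lookup: "tri x ?J S lookup (100 * ?w + 300) f0 a0 out0 ?L"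
    if stored: "\<And>g. ?J g a0 out0 \<Longrightarrow> ?ready g \<Longrightarrow> f0 rK \<noteq> ?p + 1 \<Longrightarrow> ?stored g a0 out0 ?L"
      and held: "\<And>g. ?J g a0 out0 \<Longrightarrow> ?ready g \<Longrightarrow> f0 rK = ?p + 1 \<Longrightarrow>
        tri x ?J S (code [Arith Add rX rH rZero] ;; extract_bit) (4 * ?w + 5) g a0 out0 ?L"
    unfolding lookup_def
  proof (rule tri_time, rule R.tri_code_SeqI)
    show "?J f0 a0 out0"
      using f0_fits by simp
    have "?p \<le> M" "?p + 1 \<le> M"
    proof -
      have "?p \<le> i"
        by simp
      then show "?p \<le> M" "?p + 1 \<le> M"
        using i bounds(4) by linarith+
    qed
    then show "straight x {10..<60} M [Const rOne 1, Const rTwo 2, Arith Div rP rI rB, Arith Add rt rP rOne] f0 ?ready"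
      using M_1 f0(2) by (simp add: agree_def)
    fix g
    assume g: "?J g a0 out0" "?ready g"
    have K: "g rK = f0 rK" "g rt = ?p + 1"
      using g(2) by (simp_all add: agree_def)
    show "tri x ?J S (IfLess rt rK lookup_stored
       (IfLess rK rt lookup_stored (code [Arith Add rX rH rZero] ;; extract_bit)))
       (30 * ?w + 120 + (30 * ?w + 120 + (4 * ?w + 5) + 2) + 2) g a0 out0 ?L"
    proof (rule R.tri_If_J[OF g(1)])
      show "?stored g a0 out0 ?L" if "g rt < g rK"
        using that K g by (intro stored) auto
      show "tri x ?J S (IfLess rK rt lookup_stored (code [Arith Add rX rH rZero] ;; extract_bit))
          (30 * ?w + 120 + (4 * ?w + 5) + 2) g a0 out0 (\<lambda>f a out. ?J f a out \<and> ?L f a out)"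
        if nl: "\<not> g rt < g rK"
      proof (rule tri_mono[OF _ order_refl])
        show "tri x ?J S (IfLess rK rt lookup_stored (code [Arith Add rX rH rZero] ;; extract_bit))
          (30 * ?w + 120 + (4 * ?w + 5) + 2) g a0 out0 ?L"
        proof (rule R.tri_If_J[OF g(1)])
          show "?stored g a0 out0 ?L" if "g rK < g rt"
            using that K g by (intro stored) auto
          assume "\<not> g rK < g rt"
          then have "tri x ?J S (code [Arith Add rX rH rZero] ;; extract_bit) (4 * ?w + 5) g a0 out0 ?L"
            using nl K g by (intro held) auto
          then show "tri x ?J S (code [Arith Add rX rH rZero] ;; extract_bit) (4 * ?w + 5) g a0 out0
              (\<lambda>f a out. ?J f a out \<and> ?L f a out)"
            by (rule tri_mono) auto
        qed
      qed auto
    qed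
  qed simp
  have lookup: "tri x ?J S lookup (100 * ?w + 300) f0 a0 out0 ?L"
    using J_inv
  proof
    \<comment> \<open>In the early phase \<open>rK = 0\<close> differs from \<open>?p + 1\<close>
      and nothing lies below \<open>rC\<close>, so the bit is read from the tape directly, whatever
      block index was computed.\<close>
    assume C: "f0 rC = 0 \<and> f0 rK = 0 \<and> a0 = \<tau>"
    show ?thesis
    proof (rule lookup)
      fix g
      assume g: "?J g a0 out0" "?ready g"
      have "g rC = 0"
        using g(2) C by (simp add: agree_def)
      have direct: "tri x ?J S (Do (CatRead rI rI)) 1 g a0 out0 (\<lambda>f a out. ?J f a out \<and> ?L f a out)"
        by (rule tri_mono[OF read[OF g] order_refl]) (use C in auto)
      show "?stored g a0 out0 ?L"
        unfolding lookup_stored_def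
      proof (rule tri_time, rule R.tri_If_J[OF g(1)])
        show "tri x ?J S (calc_inflow ;; code [Arith Sub rF rQ rF] ;; calc_shift ;; extract_bit) 0 g a0 out0 ?L"
          if "g rP < g rC"
          using that \<open>g rC = 0\<close> by simp
        show "tri x ?J S (Do (CatRead rI rI)) 1 g a0 out0 (\<lambda>f a out. ?J f a out \<and> ?L f a out)"
          by (rule direct)
      qed simp
    qed (use C in simp)
  next
    assume inv: "tape_inv n ?w W nb src \<tau> f0 a0"
    let ?q = "f0 rQ" and ?r = "f0 rR"
    have B: "?B = ?w"
      using inv by (simp add: tape_inv_def)
    interpret frozen_tape n ?q ?r W nb src x a0 out0 S M ?w
      using inv n_pos nb_range nb_length count nb source src_range bounds
      by unfold_locales (auto simp: tape_inv_def)
    let ?st = "state (block ?w \<tau>) (f0 rBit) (f0 rC)"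
    have ready: "ready g" if "agree {10..<32} f0 g" "g rOne = 1" "g rTwo = 2" "g rZero = 0" for g
      using inv that by (simp add: ready_def tape_inv_def agree_def)
    have p: "?p < n * n * n"
      using i unfolding B by (simp add: less_mult_imp_div_less)
    have bit: "a0 i = \<tau> i" if "block ?w a0 ?p = block ?w \<tau> ?p"
      using block_bit[OF w, of a0 i] block_bit[OF w, of \<tau> i] that by (simp add: B)
    have extracted: "tri x ?J S extract_bit (4 * ?w + 4) g a0 out0 ?L"
      if g: "?J g a0 out0" "agree {10..<32} f0 g" "ready g" "g rX = block ?w \<tau> ?p" "g rI = i" for g
    proof (rule tri_extract_bit[OF g(1,3-5) _ iM w])
      show "block ?w \<tau> ?p \<le> M"
        using block_less[of ?w \<tau> ?p] bounds(2) by linarith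
      fix f'
      assume f': "fits M f'" "agree {rX, rt, rI} g f'" "f' rI = block ?w \<tau> ?p div 2 ^ (i mod ?w) mod 2"
      have "block ?w \<tau> ?p div 2 ^ (i mod ?w) mod 2 = of_bool (\<tau> i)"
        using block_bit[OF w, of \<tau> i] by (auto simp: B mod2_eq_if)
      then show "?L f' a0 out0"
        using f' g(2) by (auto simp: agree_def)
    qed
    show ?thesis
    proof (rule lookup)
      fix g
      assume g: "?J g a0 out0" "?ready g"
      have V: "agree {10..<32} f0 g"
        using g(2) by (auto simp: agree_def)
      have Z: "g rZero = 0" "g rI = i" "g rP = ?p"
        using g(2) f0 by (simp_all add: agree_def)
      have rg: "ready g"
        using V g(2) Z(1) by (intro ready) auto
      note rdy = readyD[OF rg]
      {
        assume K: "f0 rK = ?p + 1"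
        have H: "g rH = block ?w \<tau> ?p"
          using inv K g(2) by (simp add: tape_inv_def agree_def)
        show "tri x ?J S (code [Arith Add rX rH rZero] ;; extract_bit) (4 * ?w + 5) g a0 out0 ?L"
        proof (rule tri_time, rule R.tri_code_SeqI[OF g(1)])
          have "block ?w \<tau> ?p \<le> M"
            using block_less[of ?w \<tau> ?p] bounds(2) by linarith
          then show "straight x {10..<60} M [Arith Add rX rH rZero] g (\<lambda>h. h = g(rX := block ?w \<tau> ?p))"
            by (simp add: H rdy)
          fix h
          assume h: "?J h a0 out0" "h = g(rX := block ?w \<tau> ?p)"
          show "tri x ?J S extract_bit (4 * ?w + 4) h a0 out0 ?L"
          proof (rule extracted[OF h(1)])
            show "agree {10..<32} f0 h"
              using V by (simp add: h(2) agree_def)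
            show "ready h"
              using rg by (rule ready_agree[where V = "{rX}"]) (auto simp: h(2) agree_def)
          qed (use Z in \<open>simp_all add: h(2)\<close>)
        qed simp
      }
      assume K: "f0 rK \<noteq> ?p + 1"
      have blk: "block ?w a0 ?p = ?st ?p"
        using inv K by (simp add: tape_inv_def)
      have C: "g rC = f0 rC"
        using g(2) by (simp add: agree_def)
      show "?stored g a0 out0 ?L"
        unfolding lookup_stored_def
      proof (rule tri_time, rule R.tri_If_J[OF g(1)])
        assume "\<not> g rP < g rC"
        then have "block ?w a0 ?p = block ?w \<tau> ?p"
          using blk C Z by (simp add: state_ge)
        then show "tri x ?J S (Do (CatRead rI rI)) 1 g a0 out0 (\<lambda>f a out. ?J f a out \<and> ?L f a out)"
          by - (rule tri_mono[OF read[OF g] order_refl], use bit in auto)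
      next
        assume "g rP < g rC"
        then have pC: "?p < f0 rC"
          using C Z by simp
        let ?F = "inflow (f0 rBit) ?st ?p"
        have F: "inflow (g rBit) (block ?w a0) ?p = ?F"
        proof (cases "used ?p")
          case True
          have "block ?w a0 k = ?st k" if "k < ?p" for k
          proof -
            \<comment> \<open>Otherwise the used block \<open>?p\<close> would lie between the
              marked block \<open>k\<close> and \<open>rC\<close>, against the last clause of
              \<open>tape_inv\<close>. So the inflow is computed without the half-written
              block.\<close>
            have "f0 rK \<noteq> Suc k"
              using inv that True pC unfolding tape_inv_def by (metis Suc_leI nat.distinct(1))
            then show ?thesis
              using inv by (simp add: tape_inv_def)
          qed
          then have "inflow (f0 rBit) (block ?w a0) ?p = ?F"
            by (rule inflow_cong)
          moreover have "g rBit = f0 rBit"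
            using g(2) by (simp add: agree_def)
          ultimately show ?thesis
            by (simp only:)
        qed (simp add: inflow_def)
        have X: "block ?w a0 ?p = shift (block ?w \<tau> ?p) ?F"
          using blk state_at[OF pC] by simp
        show "tri x ?J S (calc_inflow ;; code [Arith Sub rF rQ rF] ;; calc_shift ;; extract_bit)
            (12 * ?w + 60 + (1 + (6 * ?w + 25 + (4 * ?w + 4)))) g a0 out0 ?L"
        proof (rule tri_Seq, rule tri_calc_inflow[OF g(1) rg Z(3)])
          fix h
          assume h: "?J h a0 out0" "agree {rF, rk, ra, re, ry, rX, rj, ri, rv, rd, ru} g h"
            "h rF = inflow (g rBit) (block ?w a0) ?p"
          have rh: "ready h"
            using rg h(2) by (rule ready_agree) auto
          have hV: "agree {10..<32} f0 h" "h rI = i" "h rP = ?p"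
            using V Z h(2) by (auto simp: agree_def)
          show "tri x ?J S (code [Arith Sub rF rQ rF] ;; calc_shift ;; extract_bit)
              (1 + (6 * ?w + 25 + (4 * ?w + 4))) h a0 out0 ?L"
          proof (rule tri_time, rule R.tri_code_SeqI[OF h(1)])
            show "straight x {10..<60} M [Arith Sub rF rQ rF] h (\<lambda>k. k = h(rF := ?q - ?F))"
              using q_le_M by (simp add: h(3) F readyD[OF rh])
            fix k
            assume k: "?J k a0 out0" "k = h(rF := ?q - ?F)"
            have rk: "ready k"
              using rh by (rule ready_agree[where V = "{rF}"]) (auto simp: k(2) agree_def)
            show "tri x ?J S (calc_shift ;; extract_bit) (6 * ?w + 25 + (4 * ?w + 4)) k a0 out0 ?L"
            proof (rule tri_Seq, rule tri_calc_shift[OF k(1) rk])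
              show "k rP = ?p" "k rF \<le> ?q" "?p < n * n * n"
                using hV p by (simp_all add: k(2))
              fix l
              assume l: "?J l a0 out0" "agree {rk, ra, re, ry, rX, rOld, ru, rt} k l"
                "l rX = shift (block ?w a0 ?p) (k rF)"
              have "l rX = block ?w \<tau> ?p"
                using l(3) shift_inverse[OF block_less inflow_less] by (simp add: k(2) X)
              moreover have "ready l"
                using rk l(2) by (rule ready_agree) auto
              moreover have "agree {10..<32} f0 l" "l rI = i"
                using hV l(2) by (auto simp: k(2) agree_def)
              ultimately show "tri x ?J S extract_bit (4 * ?w + 4) l a0 out0 ?L"
                using l(1) by (intro extracted) auto
            qed
          qed simp
        qed (use p in simp)
      qed simp
    qed
  qed
  have clean_up: "tri x ?J S clean_up 21 f a0 out0
      (\<lambda>f' a out. fits M f' \<and> a = a0 \<and> out = out0 \<and> f' = f0(rI := of_bool (\<tau> i)))"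
    if f: "?L f a0 out0" for f
    unfolding clean_up_def
  proof (rule tri_mono[OF R.tri_clear])
    show "?J f a0 out0" "set scratch_regs \<subseteq> {10..<60}" "length scratch_regs \<le> 21"
      using f by (auto simp: set_scratch_regs length_scratch_regs)
    fix f' a out
    assume f': "?J f' a out \<and> a = a0 \<and> out = out0 \<and> f' = (\<lambda>k. if k \<in> set scratch_regs then 0 else f k)"
    have "f' k = (f0(rI := of_bool (\<tau> i))) k" for k
    proof (cases "k \<in> ?V \<and> k \<noteq> rI")
      case True
      then have "k \<in> set scratch_regs" "10 \<le> k"
        by (auto simp: set_scratch_regs)
      then show ?thesis
        using f' f0(3)[of k] True by simp
    next
      case False
      then have "k \<notin> set scratch_regs"
        by (auto simp: set_scratch_regs)
      moreover have "f' = (\<lambda>k. if k \<in> set scratch_regs then 0 else f k)"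
        using f' by blast
      ultimately have "f' k = f k"
        by simp
      moreover have "f k = (f0(rI := of_bool (\<tau> i))) k"
        using f False by (cases "k = rI") (simp_all add: agree_def)
      ultimately show ?thesis
        by simp
    qed
    then have "f' = f0(rI := of_bool (\<tau> i))"
      by (rule ext)
    moreover have "fits M f'" "a = a0" "out = out0"
      using f' by blast+
    ultimately show "fits M f' \<and> a = a0 \<and> out = out0 \<and> f' = f0(rI := of_bool (\<tau> i))"
      by (intro conjI)
  qed
  show ?thesis
    unfolding revert_com_def
  proof (rule tri_time, rule tri_Seq, rule tri_mono[OF lookup order_refl])
    fix f a out
    assume f: "?L f a out"
    then have e: "a = a0" "out = out0"
      by auto
    show "tri x ?J S clean_up 21 f a out
        (\<lambda>f' a out. fits M f' \<and> a = a0 \<and> out = out0 \<and> f' = f0(rI := of_bool (\<tau> i)))"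
      unfolding e by (rule clean_up) (use f in auto)
  qed simp
qed

section \<open>The complete program: time, success probability, and paths as walks\<close>

abbreviation E where "E \<equiv> {(u, v). v \<in> {1..n} \<and> u \<in> set (nb v)}"

definition run_time :: nat where
  "run_time = 20 + 4 * bits n + (18 * bits n + 2 + (3 + (4 * nodes + 4) * (24 * width n + 140)))"

lemma tri_reach:
  "tri x Inv S reach_com run_time (\<lambda>_. 0) \<tau> []
    (\<lambda>f a out. Inv f a out \<and> a = \<tau> \<and> (\<exists>ans. out = [ans] \<and> (ans \<longrightarrow> (src, target x) \<in> E\<^sup>*)))"
    (is "tri _ _ _ _ _ _ _ _ ?Q")
  unfolding reach_com_def run_time_def
proof (rule tri_Seq, rule tri_mono[OF tri_blank[OF tri_initialize] order_refl])
  fix f a out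
  assume f: "blank f a out \<and> out = [] \<and> prepared 1 0 f"
  then have out: "out = []"
    by simp
  show "tri x Inv S (flip_coins ;; use_coins ;; compare)
      (18 * bits n + 2 + (3 + (4 * nodes + 4) * (24 * width n + 140))) f a out ?Q"
    unfolding out
  proof (rule tri_Seq, rule tri_mono[OF tri_blank[OF tri_flip_coins] order_refl])
    show "blank f a []" "prepared 1 0 f"
      using f by auto
    fix g a' out'
    assume g: "blank g a' out' \<and> out' = [] \<and> (\<exists>u<W * Qs. prepared (W * Qs) u g)"
    then obtain u where u: "u < W * Qs" "prepared (W * Qs) u g"
      by blast
    have out': "out' = []" and "blank g a' []"
      using g by auto
    show "tri x Inv S (use_coins ;; compare) (3 + (4 * nodes + 4) * (24 * width n + 140)) g a' out' ?Q"
      unfolding out' by (rule tri_mono[OF tri_main[OF \<open>blank g a' []\<close> u(2,1)] order_refl]) auto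
  qed
qed

lemma ptri_reach:
  assumes N: "0 < N"
  shows "ptri x reach_com run_time (\<lambda>_. 0) \<tau> [] (\<lambda>f a out. of_bool (out = [True])) (1 / 2)"
proof -
  let ?g = "\<lambda>f a out. of_bool (out = [True]) :: real"
  define h1 where "h1 f a out = (if blank f a out \<and> out = [] \<and> prepared 1 0 f then 1 / 2 else 0 :: real)" for f a out
  define h2 where "h2 f a out = (if blank f a out \<and> out = [] \<and> prepared (W * Qs) (f rCoins) f \<and> f rCoins < W * Qs
    then of_bool (good_coins (f rCoins)) else 0 :: real)" for f a out
  have main: "ptri x (use_coins ;; compare) (3 + (4 * nodes + 4) * (24 * width n + 140)) f a out ?g (h2 f a out)"
    for f a out
  proof (cases "blank f a out \<and> out = [] \<and> prepared (W * Qs) (f rCoins) f \<and> f rCoins < W * Qs \<and> good_coins (f rCoins)")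
    case True
    then have out: "out = []" and b: "blank f a []" and p: "prepared (W * Qs) (f rCoins) f" "f rCoins < W * Qs"
      and good: "good_coins (f rCoins)"
      by auto
    have "h2 f a out = 1"
      using True unfolding h2_def by auto
    then show ?thesis
      unfolding out by - (rule ptri_tri[OF tri_main[OF b p]], use good in auto)
  next
    case False
    then have "h2 f a out = 0"
      unfolding h2_def by (auto simp del: of_bool_eq_0_iff)
    then show ?thesis
      by (simp only: ptri_0)
  qed
  have coins: "ptri x (flip_coins ;; use_coins ;; compare)
      (18 * bits n + 2 + (3 + (4 * nodes + 4) * (24 * width n + 140))) f a out ?g (h1 f a out)" for f a out
  proof (cases "blank f a out \<and> out = [] \<and> prepared 1 0 f")
    case True
    then have out: "out = []" and b: "blank f a []" and p: "prepared (2 ^ 0) 0 f"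
      by auto
    let ?\<rho> = "real (card {v \<in> {0 * 2 ^ (3 * bits n)..<(0 + 1) * 2 ^ (3 * bits n)}. good_coins v}) / 2 ^ (3 * bits n)"
    have "ptri x flip_coins (6 * (3 * bits n) + 2) f a [] h2 ?\<rho>"
      unfolding h2_def by (rule ptri_flip_coins[OF b p]) auto
    then have "ptri x (flip_coins ;; use_coins ;; compare)
        (6 * (3 * bits n) + 2 + (3 + (4 * nodes + 4) * (24 * width n + 140))) f a [] ?g ?\<rho>"
      using main by (rule ptri_Seq)
    note p = this
    have le: "h1 f a out \<le> ?\<rho>"
    proof -
      have "real (W * Qs) \<le> real (2 * card {u. u < W * Qs \<and> good_coins u})"
        using card_good[OF N] by (simp only: of_nat_le_iff)
      moreover have "{v \<in> {0 * 2 ^ (3 * bits n)..<(0 + 1) * 2 ^ (3 * bits n)}. good_coins v} =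
          {u. u < W * Qs \<and> good_coins u}"
        unfolding full_eq by auto
      ultimately show ?thesis
        using True unfolding full_eq h1_def by (simp add: field_simps)
    qed
    show ?thesis
      using ptri_le[OF ptri_time[OF p] le] unfolding out by simp
  next
    case False
    then have "h1 f a out = 0"
      unfolding h1_def by (rule if_not_P)
    then show ?thesis
      by (simp only: ptri_0)
  qed
  have "ptri x initialize (20 + 4 * bits n) (\<lambda>_. 0) \<tau> [] h1 (1 / 2)"
    by (rule ptri_tri[OF tri_initialize]) (simp add: h1_def)
  then show ?thesis
    unfolding reach_com_def run_time_def using coins by (rule ptri_Seq)
qed

lemma walks_pos:
  assumes "0 < grid.walks nb src i u" "pcas u p v" "set p \<subseteq> E"
  shows "0 < grid.walks nb src (i + length p) v"
proof -
  interpret grid n 1 0 W nb src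
    by (rule grid_I) auto
  show ?thesis
    using assms
  proof (induction p arbitrary: i u)
    case (Cons e p)
    obtain w where e: "e = (u, w)"
      using Cons.prems by (cases e) auto
    then have "u \<in> set (nb w)"
      using Cons.prems by auto
    from Cons.prems(1) walks_step[OF this] have "0 < walks (Suc i) w"
      by (rule order_less_le_trans)
    then have "0 < walks (Suc i + length p) v"
      using Cons.prems e by (intro Cons.IH) auto
    then show ?case
      by simp
  qed simp
qed

lemma N_pos:
  assumes "pcas src p (target x)" "set p \<subseteq> E" "length p \<le> n"
  shows "0 < N"
proof -
  interpret grid n 1 0 W nb src
    by (rule grid_I) auto
  have "0 < walks (0 + length p) (target x)"
    using assms by (intro walks_pos) auto
  also have "walks (0 + length p) (target x) \<le> N"
    using assms(3) by (intro walks_mono) simp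
  finally show ?thesis .
qed

end

section \<open>Renaming registers\<close>

text \<open>The revert routine is verified in the register layout of the main program and then moved
  by an injective renaming, because a pause shifts the registers.\<close>

fun rename :: "(nat \<Rightarrow> nat) \<Rightarrow> instr \<Rightarrow> instr" where
  "rename \<rho> (Const r k) = Const (\<rho> r) k"
| "rename \<rho> (Arith g r a b) = Arith g (\<rho> r) (\<rho> a) (\<rho> b)"
| "rename \<rho> (Jump l) = Jump l"
| "rename \<rho> (JumpLess a b l) = JumpLess (\<rho> a) (\<rho> b) l"
| "rename \<rho> (Flip r) = Flip (\<rho> r)"
| "rename \<rho> (Ask q r a b) = Ask q (\<rho> r) (\<rho> a) (\<rho> b)"
| "rename \<rho> (CatRead r a) = CatRead (\<rho> r) (\<rho> a)"
| "rename \<rho> (CatWrite a r) = CatWrite (\<rho> a) (\<rho> r)"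
| "rename \<rho> (Emit r) = Emit (\<rho> r)"

definition restrict_regs :: "(nat \<Rightarrow> nat) \<Rightarrow> config \<Rightarrow> config" where
  "restrict_regs \<rho> c = c\<lparr>regs := regs c \<circ> \<rho>\<rparr>"

lemma restrict_regs_simps [simp]:
  "pc (restrict_regs \<rho> c) = pc c" "regs (restrict_regs \<rho> c) = regs c \<circ> \<rho>"
  "cat (restrict_regs \<rho> c) = cat c" "outp (restrict_regs \<rho> c) = outp c"
  by (simp_all add: restrict_regs_def)

lemma exec_rename:
  assumes "inj \<rho>"
  shows "map_pmf (restrict_regs \<rho>) (exec x (rename \<rho> i) c) = exec x i (restrict_regs \<rho> c)"
proof -
  have upd: "(f(\<rho> r := v)) \<circ> \<rho> = (f \<circ> \<rho>)(r := v)" for f :: "nat \<Rightarrow> nat" and r v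
    using assms by (auto simp: fun_eq_iff inj_def)
  show ?thesis
    by (cases i) (auto simp: restrict_regs_def advance_def set_reg_def upd map_pmf_comp intro!: map_pmf_cong)
qed

lemma exec_rename_outside:
  assumes "d \<in> set_pmf (exec x (rename \<rho> i) c)" "k \<notin> range \<rho>"
  shows "regs d k = regs c k"
  using assms by (cases i) (auto simp: advance_def set_reg_def split: if_splits)

lemma halted_rename: "halted (map (rename \<rho>) P) c \<longleftrightarrow> halted P (restrict_regs \<rho> c)"
  by (simp add: halted_def)

lemma step_rename:
  assumes "inj \<rho>"
  shows "map_pmf (restrict_regs \<rho>) (step (map (rename \<rho>) P) x c) = step P x (restrict_regs \<rho> c)"
  using exec_rename[OF assms] by (auto simp: step_def halted_def)

lemma run_rename:
  assumes "inj \<rho>"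
  shows "map_pmf (restrict_regs \<rho>) (run (map (rename \<rho>) P) x k c) = run P x k (restrict_regs \<rho> c)"
proof (induction k arbitrary: c)
  case (Suc k)
  have "map_pmf (restrict_regs \<rho>) (run (map (rename \<rho>) P) x (Suc k) c) =
      bind_pmf (step (map (rename \<rho>) P) x c) (\<lambda>d. run P x k (restrict_regs \<rho> d))"
    by (simp add: map_bind_pmf Suc)
  also have "\<dots> = bind_pmf (map_pmf (restrict_regs \<rho>) (step (map (rename \<rho>) P) x c)) (run P x k)"
    by (simp add: bind_map_pmf)
  finally show ?case
    by (simp add: step_rename[OF assms])
qed simp

text \<open>Registers outside the range of the renaming include the one with the paused program
  counter and those with the scratch values of the paused run; this shows that they survive.\<close>

lemma run_rename_outside:
  assumes "d \<in> set_pmf (run (map (rename \<rho>) P) x k c)" "j \<notin> range \<rho>"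
  shows "regs d j = regs c j"
  using assms(1)
proof (induction k arbitrary: c)
  case (Suc k)
  then obtain e where e: "e \<in> set_pmf (step (map (rename \<rho>) P) x c)" "d \<in> set_pmf (run (map (rename \<rho>) P) x k e)"
    by auto
  have "regs e j = regs c j"
    using e(1) exec_rename_outside[OF _ assms(2)] by (auto simp: step_def halted_def split: if_splits)
  with Suc.IH[OF e(2)] show ?case
    by simp
qed simp

lemma cat_accesses_rename: "cat_accesses (map (rename \<rho>) P) c = cat_accesses P (restrict_regs \<rho> c)"
proof (cases "halted P (restrict_regs \<rho> c)")
  case False
  then have "pc c < length P"
    by (simp add: halted_def)
  then show ?thesis
    using False by (cases "P ! pc c") (simp_all add: cat_accesses_def halted_rename)
qed (simp add: cat_accesses_def halted_rename)

section \<open>Resource bounds\<close>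

lemma workspace_le:
  assumes "\<And>k. regs c k \<le> M" "\<And>k. K \<le> k \<Longrightarrow> regs c k = 0"
  shows "workspace c \<le> K * floorlog 2 M"
proof -
  have sub: "{r. regs c r \<noteq> 0} \<subseteq> {..<K}"
  proof
    fix r
    assume "r \<in> {r. regs c r \<noteq> 0}"
    then show "r \<in> {..<K}"
      using assms(2)[of r] by (cases "K \<le> r") auto
  qed
  have "workspace c \<le> (\<Sum>r | regs c r \<noteq> 0. floorlog 2 M)"
    unfolding workspace_def using assms(1) by (intro sum_mono floorlog_mono)
  also have "\<dots> = card {r. regs c r \<noteq> 0} * floorlog 2 M"
    by simp
  also have "\<dots> \<le> K * floorlog 2 M"
    using card_mono[OF _ sub] by (intro mult_le_mono1) simp
  finally show ?thesis .
qed

text \<open>By minimality \<open>bits n - 1\<close> is below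
  \<open>log 2 (goal n) = 15 + 32 * log 2 n\<close>, and \<open>16 + 32 = 48\<close> since
  \<open>lg n \<ge> 1\<close>.\<close>

lemma bits_le_lg:
  assumes "0 < n"
  shows "real (bits n) \<le> 48 * lg n"
proof -
  have lg: "1 \<le> lg n" "log 2 (real n) \<le> lg n"
    using assms by (auto simp: lg_def le_log_iff)
  have "2 ^ (bits n - 1) < goal n"
    using bits_pos[OF assms] by (intro less_goal) simp
  then have "real (2 ^ (bits n - 1)) < real (goal n)"
    by (simp only: of_nat_less_iff)
  then have "log 2 (real (2 ^ (bits n - 1))) < log 2 (real (goal n))"
    by (subst log_less_cancel_iff) simp_all
  also have "log 2 (real (goal n)) = log 2 (2 ^ 15 * real n ^ 32)"
    by (simp add: goal_def)
  also have "\<dots> = log 2 (2 ^ 15) + log 2 (real n ^ 32)"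
    using assms by (subst log_mult) auto
  also have "\<dots> = 15 + 32 * log 2 (real n)"
    using assms log_pow_cancel[of 2 15] by (simp add: log_nat_power)
  finally have "real (bits n) - 1 < 15 + 32 * log 2 (real n)"
    using bits_pos[OF assms] by (simp add: log_nat_power)
  then show ?thesis
    using lg by linarith
qed

text \<open>The summand \<open>l\<close> accounts for the program counter of the paused run, which
  occupies a register during the revert routine.\<close>

lemma floorlog_limit:
  assumes "0 < n"
  shows "floorlog 2 (limit n + l) \<le> 7 + 3 * bits n + l"
proof (rule floorlog_leI)
  have "goal n ^ 3 \<le> (2 ^ bits n) ^ 3"
    by (intro power_mono goal_le) simp
  then have "limit n \<le> 64 * (2 ^ bits n) ^ 3"
    by (simp add: limit_def)
  also have "\<dots> = 2 ^ (6 + 3 * bits n)"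
    by (simp add: power_add power_mult mult.commute[of 3] flip: power_mult)
  finally have 1: "limit n \<le> 2 ^ (6 + 3 * bits n)" .
  have "l < 2 ^ l"
    by (rule less_exp)
  also have "(2::nat) ^ l \<le> 2 ^ (6 + 3 * bits n + l)"
    by (intro power_increasing) auto
  finally have 2: "l < 2 ^ (6 + 3 * bits n + l)" .
  have "(2::nat) ^ (6 + 3 * bits n) \<le> 2 ^ (6 + 3 * bits n + l)"
    by (intro power_increasing) auto
  with 1 2 have "limit n + l < 2 * 2 ^ (6 + 3 * bits n + l)"
    by linarith
  then show "limit n + l < 2 ^ (7 + 3 * bits n + l)"
    by (simp add: power_add)
qed simp_all

definition reach_program :: program where
  "reach_program = compile 0 reach_com"

text \<open>Places the registers that the revert routine shares with the paused computation where the
  pause leaves them, the queried index in register 0, and all others above.\<close>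

definition shift_regs :: "nat \<Rightarrow> nat" where
  "shift_regs k = (if k < 10 then k + 2 else if k = rI then 0 else k + 60)"

definition revert_program :: program where
  "revert_program = map (rename shift_regs) (compile 0 revert_com)"

lemma inj_shift_regs: "inj shift_regs"
  by (auto simp: inj_def shift_regs_def split: if_splits)

lemma lead_pc:
  assumes "lead P x G Q t s" "\<And>d. Q d \<Longrightarrow> pc d \<le> length P"
  shows "lead P x (\<lambda>d. G d \<and> pc d \<le> length P) Q t s"
  using assms(1) by (induction t arbitrary: s) (auto simp: halted_def)

context coin_machine
begin

abbreviation Fin :: "config \<Rightarrow> bool" where
  "Fin d \<equiv> halted reach_program d \<and> guard Inv S reach_program d \<and> pc d \<le> length reach_program \<and> cat d = \<tau> \<and>
    (\<exists>ans. outp d = [ans] \<and> (ans \<longrightarrow> (src, target x) \<in> E\<^sup>*))"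

lemma init_eq: "init \<tau> = conf 0 (\<lambda>_. 0) \<tau> []"
  by (simp add: init_def conf_def)

lemma lead_reach:
  "lead reach_program x (\<lambda>d. guard Inv S reach_program d \<and> pc d \<le> length reach_program) Fin run_time (init \<tau>)"
  unfolding init_eq
proof (rule lead_pc)
  show "lead reach_program x (guard Inv S reach_program) Fin run_time (conf 0 (\<lambda>_. 0) \<tau> [])"
    unfolding reach_program_def
    by (rule lead_mono[OF tri_lead[OF tri_reach] order_refl]) auto
qed auto

lemma reach_final:
  "run_time \<le> k \<Longrightarrow> d \<in> set_pmf (run reach_program x k (init \<tau>)) \<Longrightarrow> Fin d"
  by (rule lead_final[OF lead_reach]) auto

lemma reach_reachable:
  assumes "d \<in> reachable_configs reach_program x (init \<tau>)"
  shows "Inv (regs d) (cat d) (outp d)" "cat_accesses reach_program d \<subseteq> {..<S}" "pc d \<le> length reach_program"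
  using lead_reachable[OF lead_reach _ assms] by (auto simp: guard_def)

lemma reach_prob:
  assumes "0 < N" "run_time \<le> k"
  shows "1 / 2 \<le> measure_pmf.prob (run reach_program x k (init \<tau>)) {d. outp d = [True]}"
proof -
  let ?E = "{d :: config. outp d = [True]}"
  have "pr reach_program x ?E (0 + run_time) (1 / 2) (conf 0 (\<lambda>_. 0) \<tau> [])"
  proof (rule ptriD[OF ptri_reach[OF assms(1)]])
    show "fragment reach_program 0 (compile 0 reach_com)"
      unfolding reach_program_def by (rule fragment_refl)
    fix f a out
    have "halted reach_program (conf (0 + code_size reach_com) f a out)"
      by (simp add: halted_def reach_program_def)
    then show "pr reach_program x ?E 0 (of_bool (out = [True])) (conf (0 + code_size reach_com) f a out)"
      unfolding pr_def by (simp add: run_halted indicator_def)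
  qed
  then show ?thesis
    using assms(2) by (simp add: pr_def init_eq)
qed

text \<open>Scratch register \<open>k\<close> of the routine is placed at \<open>k + 60\<close>,
  where the pause puts register \<open>k + 58\<close> of the main run; from 60 on these are
  0.\<close>

lemma paused_regs:
  assumes "fits M (regs c)"
  shows "k < 10 \<Longrightarrow> regs (restrict_regs shift_regs (paused i c)) k = regs c k"
    and "regs (restrict_regs shift_regs (paused i c)) rI = i"
    and "10 \<le> k \<Longrightarrow> k \<noteq> rI \<Longrightarrow> regs (restrict_regs shift_regs (paused i c)) k = 0"
proof -
  show "regs (restrict_regs shift_regs (paused i c)) k = regs c k" if "k < 10"
    using that by (simp add: paused_def shift_regs_def)
  show "regs (restrict_regs shift_regs (paused i c)) rI = i"
    by (simp add: paused_def shift_regs_def)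
  assume k: "10 \<le> k" "k \<noteq> rI"
  then have "shift_regs k = Suc (Suc (k + 58))"
    by (simp add: shift_regs_def)
  then have "regs (restrict_regs shift_regs (paused i c)) k = regs c (k + 58)"
    by (simp add: paused_def numeral_eq_Suc)
  then show "regs (restrict_regs shift_regs (paused i c)) k = 0"
    using assms k by (simp add: fits_def)
qed

definition revert_time :: nat where
  "revert_time = 100 * width n + 400"

lemma lead_revert:
  assumes inv: "Inv (regs c) (cat c) (outp c)" and i: "i < S"
  defines "c' \<equiv> restrict_regs shift_regs (paused i c)"
  defines "J' \<equiv> \<lambda>f a out. fits M f \<and> a = cat c \<and> out = outp c"
  shows "lead (compile 0 revert_com) x (guard J' S (compile 0 revert_com))
    (\<lambda>d. halted (compile 0 revert_com) d \<and> guard J' S (compile 0 revert_com) d \<and>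
       regs d = (regs c')(rI := of_bool (\<tau> i)) \<and> cat d = cat c \<and> outp d = outp c) revert_time c'"
proof -
  have fits: "fits M (regs c)"
    using inv by (simp add: inv_def)
  note r = paused_regs[OF fits, where i = i]
  have "c' = conf (pc c') (regs c') (cat c') (outp c')"
    by (simp add: conf_collapse)
  also have "\<dots> = conf 0 (regs c') (cat c) (outp c)"
    by (simp add: c'_def paused_def)
  finally have c': "c' = conf 0 (regs c') (cat c) (outp c)" .
  have "tri x J' S revert_com revert_time (regs c') (cat c) (outp c)
      (\<lambda>f' a out. fits M f' \<and> a = cat c \<and> out = outp c \<and> f' = (regs c')(rI := of_bool (\<tau> i)))"
    unfolding J'_def revert_time_def c'_def by (rule tri_revert[OF inv i r])
  then have "lead (compile 0 revert_com) x (guard J' S (compile 0 revert_com))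
    (\<lambda>d. halted (compile 0 revert_com) d \<and> guard J' S (compile 0 revert_com) d \<and> pc d = code_size revert_com \<and>
       fits M (regs d) \<and> cat d = cat c \<and> outp d = outp c \<and> regs d = (regs c')(rI := of_bool (\<tau> i)))
    revert_time (conf 0 (regs c') (cat c) (outp c))"
    by (rule tri_lead) (simp add: J'_def)
  then show ?thesis
    unfolding c'[symmetric] by (rule lead_mono) auto
qed

lemma revert_final:
  assumes inv: "Inv (regs c) (cat c) (outp c)" and i: "i < S" and k: "revert_time \<le> k"
    and d: "d \<in> set_pmf (run revert_program x k (paused i c))"
  shows "halted revert_program d" "regs d = (regs (paused i c))(0 := of_bool (\<tau> i))" "cat d = cat c" "outp d = outp c"
proof -
  let ?\<rho> = "restrict_regs shift_regs" and ?R = "compile 0 revert_com"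
  have "?\<rho> d \<in> set_pmf (map_pmf ?\<rho> (run revert_program x k (paused i c)))"
    using d by simp
  then have "?\<rho> d \<in> set_pmf (run ?R x k (?\<rho> (paused i c)))"
    unfolding revert_program_def run_rename[OF inj_shift_regs] .
  from lead_final[OF lead_revert[OF inv i] _ k this]
  have fin: "halted ?R (?\<rho> d) \<and> regs (?\<rho> d) = (regs (?\<rho> (paused i c)))(rI := of_bool (\<tau> i)) \<and>
      cat (?\<rho> d) = cat c \<and> outp (?\<rho> d) = outp c"
    by blast
  then show "halted revert_program d" "cat d = cat c" "outp d = outp c"
    by (simp_all add: revert_program_def halted_rename)
  show "regs d = (regs (paused i c))(0 := of_bool (\<tau> i))"
  proof
    fix k
    show "regs d k = ((regs (paused i c))(0 := of_bool (\<tau> i))) k"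
    proof (cases "k \<in> range shift_regs")
      case True
      then obtain l where l: "k = shift_regs l"
        by blast
      have "regs (?\<rho> d) = (regs (?\<rho> (paused i c)))(rI := of_bool (\<tau> i))"
        using fin by blast
      then have "regs (?\<rho> d) l = ((regs (?\<rho> (paused i c)))(rI := of_bool (\<tau> i))) l"
        by (rule fun_cong)
      moreover have "k = 0 \<longleftrightarrow> l = rI"
        by (auto simp: l shift_regs_def)
      ultimately show ?thesis
        by (auto simp: l)
    next
      case False
      have "0 = shift_regs rI"
        by (simp add: shift_regs_def)
      then have "k \<noteq> 0"
        using False by auto
      then show ?thesis
        using run_rename_outside[OF d[unfolded revert_program_def] False] by simp
    qed
  qed
qed

text \<open>Nonzero registers below 60 of the routine are moved to positions below 120, and those of
  the paused run end below 62; 130 is a round upper bound for both.\<close>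

lemma revert_reachable:
  assumes inv: "Inv (regs c) (cat c) (outp c)" and i: "i < S" and pc: "pc c \<le> l"
    and d: "d \<in> reachable_configs revert_program x (paused i c)"
  shows "workspace d \<le> 130 * floorlog 2 (M + l)" "cat_accesses revert_program d \<subseteq> {..<S}"
proof -
  let ?\<rho> = "restrict_regs shift_regs" and ?R = "compile 0 revert_com"
  obtain k where k: "d \<in> set_pmf (run revert_program x k (paused i c))"
    using d by (auto simp: reachable_configs_def)
  then have "?\<rho> d \<in> set_pmf (map_pmf ?\<rho> (run revert_program x k (paused i c)))"
    by simp
  then have "?\<rho> d \<in> set_pmf (run ?R x k (?\<rho> (paused i c)))"
    unfolding revert_program_def run_rename[OF inj_shift_regs] .
  then have reach: "?\<rho> d \<in> reachable_configs ?R x (?\<rho> (paused i c))"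
    by (auto simp: reachable_configs_def)
  have "guard (\<lambda>f a out. fits M f \<and> a = cat c \<and> out = outp c) S ?R (?\<rho> d)"
    by (rule lead_reachable[OF lead_revert[OF inv i] _ reach]) blast
  then have fits: "fits M (regs d \<circ> shift_regs)" and acc: "cat_accesses ?R (?\<rho> d) \<subseteq> {..<S}"
    by (simp_all add: guard_def)
  show "cat_accesses revert_program d \<subseteq> {..<S}"
    using acc by (simp add: revert_program_def cat_accesses_rename)
  have fits_c: "fits M (regs c)"
    using inv by (simp add: inv_def)
  have outside: "regs d j = regs (paused i c) j" if "j \<notin> range shift_regs" for j
    using run_rename_outside[OF k[unfolded revert_program_def] that] .
  have "i \<le> M"
    using i bounds(4) by simp
  then have pb: "regs (paused i c) j \<le> M + l" "62 \<le> j \<Longrightarrow> regs (paused i c) j = 0" for j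
    using fits_c pc by (auto simp: paused_def fits_def trans_le_add1 trans_le_add2 split: nat.split)
  show "workspace d \<le> 130 * floorlog 2 (M + l)"
  proof (rule workspace_le)
    fix j
    show "regs d j \<le> M + l"
    proof (cases "j \<in> range shift_regs")
      case True
      then obtain v where "j = shift_regs v"
        by blast
      then show ?thesis
        using fits by (auto simp: fits_def trans_le_add1)
    qed (use outside pb in simp)
    show "regs d j = 0" if "130 \<le> j"
    proof (cases "j \<in> range shift_regs")
      case True
      then obtain v where v: "j = shift_regs v"
        by blast
      then have "60 \<le> v"
        using that by (auto simp: shift_regs_def split: if_splits)
      then show ?thesis
        using fits v by (simp add: fits_def)
    qed (use outside pb that in simp)
  qed
qed

lemma run_time_le: "real run_time \<le> 4000 * real nodes * (real (bits n) + 1)"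
proof -
  have "(\<Sum>v = 1..n. 1) \<le> (\<Sum>v = 1..n. length (nb v) + 1)"
    by (intro sum_mono) simp
  then have "1 \<le> (\<Sum>v = 1..n. length (nb v) + 1)"
    using n_pos by simp
  then have nodes: "1 \<le> nodes"
    using n_pos by (simp add: nodes_def Suc_le_eq)
  have "run_time = 25 + 22 * bits n + (4 * nodes + 4) * (48 * bits n + 140)"
    by (simp add: run_time_def width_def)
  also have "\<dots> \<le> nodes * (25 + 22 * bits n) + (8 * nodes) * (48 * bits n + 140)"
    using nodes by (intro add_mono mult_le_mono1) auto
  also have "\<dots> \<le> 4000 * nodes * (bits n + 1)"
    by (simp add: algebra_simps)
  finally have "real run_time \<le> real (4000 * nodes * (bits n + 1))"
    by (simp only: of_nat_le_iff)
  then show ?thesis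
    by (simp add: algebra_simps)
qed

end

lemma lg_ge_1: "0 < n \<Longrightarrow> 1 \<le> lg n"
  by (simp add: lg_def le_log_iff)

lemma le_nat_floor: "real t \<le> T \<Longrightarrow> t \<le> nat \<lfloor>T\<rfloor>"
  by (simp add: le_nat_iff le_floor_iff)

theorem theorem1p5:
  shows "\<exists>(P :: program) (R :: program) (S :: nat \<Rightarrow> nat) (C :: real) (k :: nat).
    (\<forall>n. real (S n) \<le> C * real n ^ 3 * lg n ^ k) \<and>
    (\<forall>(n :: nat) (m :: nat) (G :: nat pair_pre_digraph) (u :: nat) (v :: nat) (x :: stcon_input).
       pair_digraph G \<longrightarrow> pverts G = {1..n} \<longrightarrow> card (parcs G) = m \<longrightarrow> m \<ge> n \<longrightarrow>
       u \<in> pverts G \<longrightarrow> v \<in> pverts G \<longrightarrow> presents x G u v \<longrightarrow>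
       catalytic_on P x (C * lg n) (S n) (C * real n * real m * lg n ^ k) \<and>
       decides_path_on P x (C * real n * real m * lg n ^ k) G u v \<and>
       locally_revertible_on P R x (C * lg n) (S n) (C * lg n ^ k))"
proof -
  define l where "l = length reach_program"
  define C :: real where "C = 1000000 + 130 * (200 + real l)"
  define S :: "nat \<Rightarrow> nat" where "S n = n * n * n * width n" for n
  have S: "real (S n) \<le> C * real n ^ 3 * lg n ^ 1" for n
  proof (cases "n = 0")
    case False
    have "real (S n) = real n ^ 3 * (2 * real (bits n))"
      by (simp add: S_def width_def power3_eq_cube)
    also have "\<dots> \<le> real n ^ 3 * (C * lg n)"
    proof (rule mult_left_mono)
      have "2 * real (bits n) \<le> 96 * lg n"
        using bits_le_lg[of n] False by simp
      also have "\<dots> \<le> C * lg n"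
        using lg_ge_1[of n] False by (intro mult_right_mono) (auto simp: C_def)
      finally show "2 * real (bits n) \<le> C * lg n" .
    qed simp
    finally show ?thesis
      by (simp add: mult_ac)
  qed (simp add: S_def)
  have main: "catalytic_on reach_program x (C * lg n) (S n) (C * real n * real m * lg n ^ 1) \<and>
       decides_path_on reach_program x (C * real n * real m * lg n ^ 1) G u v \<and>
       locally_revertible_on reach_program revert_program x (C * lg n) (S n) (C * lg n ^ 1)"
    if G: "pair_digraph G" "pverts G = {1..n}" "card (parcs G) = m" "n \<le> m" "u \<in> pverts G" "v \<in> pverts G"
      "presents x G u v"
    for n m G u v x
  proof -
    interpret pair_digraph G
      by fact
    define nb where "nb = in_nbrs x"
    have n: "0 < n"
      using G(2,5) by auto
    have x: "vertex_count x = n" "source x = u" "target x = v"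
      using G(2,7) by (auto simp: presents_def)
    have nb: "distinct (nb a)" "set (nb a) = {b. (b, a) \<in> parcs G}" if "a \<in> {1..n}" for a
      using G(2,7) that by (auto simp: presents_def nb_def)
    have arcs: "parcs G \<subseteq> {1..n} \<times> {1..n}"
      using wellformed' G(2) by auto
    have nb_length: "length (nb a) < n" if "a \<in> {1..n}" for a
    proof -
      have "length (nb a) = card (set (nb a))"
        using nb(1)[OF that] by (simp add: distinct_card)
      \<comment> \<open>The graph has no loops, so \<open>a\<close> is not its own in-neighbour;
        this frees the slot for staying.\<close>
      also have "\<dots> \<le> card ({1..n} - {a})"
        using nb(2)[OF that] arcs pair_no_loops[of "(a, a)"] by (intro card_mono) auto
      also have "\<dots> < n"
        using that n by simp
      finally show ?thesis .
    qed
    have machine: "coin_machine n u nb x"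
      using n nb arcs nb_length x G(2,5,6) by unfold_locales (auto simp: nb_def)
    have E: "{(a, b). b \<in> {1..n} \<and> a \<in> set (nb b)} = parcs G"
      using nb(2) arcs by auto
    have lg: "1 \<le> lg n"
      using n by (rule lg_ge_1)
    have C_pos: "0 \<le> C"
      by (simp add: C_def)
    have bits: "real (bits n) \<le> 48 * lg n"
      using n by (rule bits_le_lg)
    \<comment> \<open>Counting arcs by their heads gives \<open>n * (m + n)\<close>, and
      \<open>n \<le> m\<close> turns this into a bound by \<open>n * m\<close>.\<close>
    have nodes: "coin_machine.nodes n nb \<le> 2 * n * m"
    proof -
      have fin: "finite {b. (b, a) \<in> parcs G}" for a
        using finite_subset[of "{b. (b, a) \<in> parcs G}" "{1..n}"] arcs by auto
      have "parcs G = prod.swap ` (SIGMA a:{1..n}. {b. (b, a) \<in> parcs G})"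
        using arcs by (force simp: image_iff)
      moreover have "card (prod.swap ` (SIGMA a:{1..n}. {b. (b, a) \<in> parcs G})) =
          card (SIGMA a:{1..n}. {b. (b, a) \<in> parcs G})"
        by (rule card_image) (auto simp: inj_on_def)
      ultimately have "m = card (SIGMA a:{1..n}. {b. (b, a) \<in> parcs G})"
        using G(3) by simp
      also have "\<dots> = (\<Sum>a = 1..n. card {b. (b, a) \<in> parcs G})"
        using fin by simp
      also have "\<dots> = (\<Sum>a = 1..n. length (nb a))"
        using nb by (intro sum.cong) (auto simp flip: distinct_card)
      finally have "(\<Sum>a = 1..n. length (nb a) + 1) = m + n"
        using sum.distrib[of "\<lambda>a. length (nb a)" "\<lambda>_. 1" "{1..n}"] by simp
      then have "coin_machine.nodes n nb = n * (m + n)"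
        using coin_machine.nodes_def[OF machine] by simp
      also have "\<dots> \<le> n * (2 * m)"
        using G(4) by (intro mult_le_mono2) simp
      finally show ?thesis
        by simp
    qed
    have time: "coin_machine.run_time n nb \<le> nat \<lfloor>C * real n * real m * lg n ^ 1\<rfloor>"
    proof (rule le_nat_floor)
      have "real (coin_machine.run_time n nb) \<le> 4000 * real (coin_machine.nodes n nb) * (real (bits n) + 1)"
        using coin_machine.run_time_le[OF machine] .
      also have "\<dots> \<le> 4000 * real (2 * n * m) * (49 * lg n)"
        using nodes bits lg by (intro mult_mono) (simp_all del: of_nat_mult)
      also have "\<dots> = 392000 * (real n * real m * lg n)"
        by simp
      also have "\<dots> \<le> C * (real n * real m * lg n)"
        using lg by (intro mult_right_mono) (auto simp: C_def)
      finally show "real (coin_machine.run_time n nb) \<le> C * real n * real m * lg n ^ 1"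
        by (simp add: mult_ac)
    qed
    have rtime: "coin_machine.revert_time n \<le> nat \<lfloor>C * lg n ^ 1\<rfloor>"
    proof (rule le_nat_floor)
      have "real (coin_machine.revert_time n) = 200 * real (bits n) + 400"
        using coin_machine.revert_time_def[OF machine] by (simp add: width_def)
      also have "\<dots> \<le> 10000 * lg n"
        using bits lg by linarith
      also have "\<dots> \<le> C * lg n"
        using lg by (intro mult_right_mono) (auto simp: C_def)
      finally show "real (coin_machine.revert_time n) \<le> C * lg n ^ 1"
        by simp
    qed
    have space: "real (130 * floorlog 2 (limit n + l)) \<le> C * lg n"
    proof -
      have "real (floorlog 2 (limit n + l)) \<le> real (7 + 3 * bits n + l)"
        using floorlog_limit[OF n, of l] by (simp only: of_nat_le_iff)
      also have "\<dots> \<le> 7 * lg n + 144 * lg n + real l * lg n"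
        using bits lg mult_left_mono[OF lg, of "real l"] by simp
      finally have "real (130 * floorlog 2 (limit n + l)) \<le> 130 * ((151 + real l) * lg n)"
        by (simp add: algebra_simps)
      also have "\<dots> \<le> C * lg n"
        using lg by (simp add: C_def algebra_simps)
      finally show ?thesis .
    qed
    \<comment> \<open>A path without repeated vertices has fewer than \<open>n\<close> arcs; staying
      pads it to a lazy walk of length \<open>n\<close>.\<close>
    have N: "0 < grid.walks nb u n v" if ex: "\<exists>p. pre_digraph.apath (with_proj G) u p v"
    proof -
      obtain p where p: "apath u p v"
        using ex by blast
      then have "length p < card (pverts G)"
        by (rule length_apath_less)
      moreover have "pcas u p v" "set p \<subseteq> parcs G"
        using p by (auto simp: apath_def awalk_def)
      ultimately show ?thesis
        using coin_machine.N_pos[OF machine, of p, unfolded E x] G(2) by simp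
    qed
    have path: "\<exists>p. pre_digraph.apath (with_proj G) u p v" if "(u, v) \<in> (parcs G)\<^sup>*"
    proof -
      have "reachable G u w" if "(u, w) \<in> (parcs G)\<^sup>*" for w
        using that
      proof (induction rule: rtrancl_induct)
        case base
        then show ?case
          using G(5) by simp
      next
        case (step y z)
        from step(3,2) show ?case
          by (rule reachable_adj_trans)
      qed
      then show ?thesis
        using that by (simp add: reachable_apath)
    qed
    have halts: "\<forall>d\<in>set_pmf (final_dist reach_program x (C * real n * real m * lg n ^ 1) (init \<tau>)).
        halted reach_program d \<and> cat d = \<tau> \<and> (\<exists>ans. outp d = [ans] \<and> (ans \<longrightarrow> (u, v) \<in> (parcs G)\<^sup>*))" for \<tau>
      using coin_machine.reach_final[OF machine time, unfolded E x] unfolding final_dist_def by blast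
    have inv: "inv (limit n) n (width n) (2 ^ width n) nb u \<tau> (regs d) (cat d) (outp d)"
      "cat_accesses reach_program d \<subseteq> {..<S n}" "pc d \<le> l"
      if "d \<in> reachable_configs reach_program x (init \<tau>)" for d \<tau>
      using coin_machine.reach_reachable[OF machine that] by (simp_all add: S_def l_def)
    have ws: "real (workspace d) \<le> C * lg n" if "d \<in> reachable_configs reach_program x (init \<tau>)" for d \<tau>
    proof -
      have "fits (limit n) (regs d)"
        using inv(1)[OF that] by (simp add: inv_def)
      then have "workspace d \<le> 60 * floorlog 2 (limit n)"
        by (intro workspace_le) (auto simp: fits_def)
      also have "\<dots> \<le> 130 * floorlog 2 (limit n + l)"
        by (intro mult_le_mono floorlog_mono) auto
      finally show ?thesis
        using space by linarith
    qed
    have "catalytic_on reach_program x (C * lg n) (S n) (C * real n * real m * lg n ^ 1)"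
      unfolding catalytic_on_def halts_within_def space_bounded_def
      using halts inv(2) ws by simp
    moreover have "decides_path_on reach_program x (C * real n * real m * lg n ^ 1) G u v"
      unfolding decides_path_on_def
    proof (intro allI conjI impI)
      fix \<tau>
      let ?D = "final_dist reach_program x (C * real n * real m * lg n ^ 1) (init \<tau>)"
      show "\<forall>d\<in>set_pmf ?D. outp d \<in> {[True], [False]}"
        using halts[of \<tau>] by (metis (full_types) insert_iff)
      show "\<forall>d\<in>set_pmf ?D. outp d = [False]" if "\<nexists>p. pre_digraph.apath (with_proj G) u p v"
        using halts[of \<tau>] path that by (metis (full_types))
      show "1 / 2 \<le> measure_pmf.prob ?D {d. outp d = [True]}" if "\<exists>p. pre_digraph.apath (with_proj G) u p v"
        unfolding final_dist_def by (rule coin_machine.reach_prob[OF machine _ time]) (use N[OF that] in \<open>simp add: x\<close>)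
    qed
    moreover have "locally_revertible_on reach_program revert_program x (C * lg n) (S n) (C * lg n ^ 1)"
      unfolding locally_revertible_on_def
    proof (intro allI ballI impI)
      fix \<tau> c i
      assume c: "c \<in> reachable_configs reach_program x (init \<tau>)" and i: "i < S n"
      note fin = coin_machine.revert_final[OF machine inv(1)[OF c] i[unfolded S_def] rtime]
      note sp = coin_machine.revert_reachable[OF machine inv(1)[OF c] i[unfolded S_def] inv(3)[OF c]]
      have "real (workspace d) \<le> C * lg n" if "d \<in> reachable_configs revert_program x (paused i c)" for d
        using sp(1)[OF that] space by linarith
      then show "halts_within revert_program x (C * lg n ^ 1) (paused i c) \<and>
          space_bounded revert_program x (C * lg n) (S n) (paused i c) \<and>
          (\<forall>d\<in>set_pmf (final_dist revert_program x (C * lg n ^ 1) (paused i c)).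
            regs d = (regs (paused i c))(0 := of_bool (\<tau> i)) \<and> cat d = cat c \<and> outp d = outp c)"
        unfolding halts_within_def space_bounded_def final_dist_def S_def using fin sp(2) by simp
    qed
    ultimately show ?thesis
      by blast
  qed
  have "(\<forall>n. real (S n) \<le> C * real n ^ 3 * lg n ^ 1) \<and>
    (\<forall>(n :: nat) (m :: nat) (G :: nat pair_pre_digraph) (u :: nat) (v :: nat) (x :: stcon_input).
       pair_digraph G \<longrightarrow> pverts G = {1..n} \<longrightarrow> card (parcs G) = m \<longrightarrow> m \<ge> n \<longrightarrow>
       u \<in> pverts G \<longrightarrow> v \<in> pverts G \<longrightarrow> presents x G u v \<longrightarrow>
       catalytic_on reach_program x (C * lg n) (S n) (C * real n * real m * lg n ^ 1) \<and>
       decides_path_on reach_program x (C * real n * real m * lg n ^ 1) G u v \<and>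
       locally_revertible_on reach_program revert_program x (C * lg n) (S n) (C * lg n ^ 1))"
    by (rule conjI, intro allI, rule S, intro allI impI) (rule main; assumption)
  then show ?thesis
    by (intro exI)
qed

end
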